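(* Let $H,U,A,B$ satisfy (H1)--(H4) (as stated in the context), let $\omega>0$, and let $\Lambda_\omega$, $C$, $\widetilde J$, $J$, $V(t)$ and $U(t)=\Lambda_\omega V(t)\Lambda_\omega^{-1}$ be as defined in the context. Then $(U(t))_{t\in\mathbb{R}}$ is a strongly continuous group in $H$ whose infinitesimal generator is $$A_U:=\Lambda_\omega\bigl(-A^*-C^*\widetilde J C\Lambda_\omega\bigr)\Lambda_\omega^{-1},\qquad D(A_U)=\Lambda_\omega D(A^* ).$$ Moreover, it satisfies the variation of constants formula $$\langle U(t)x_0,y\rangle_{H,H'}=\langle e^{tA}x_0,y\rangle_{H,H'}-\int_0^t\langle JB^*\Lambda_\omega^{-1}U(r)x_0,\;B^*e^{(t-r)A^*}y\rangle_{U,U'}\,dr$$ for all $x_0\in H$, $y\in H'$ and $t\in\mathbb{R}$.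
   Context: Spaces and pairings. $H$ (state space) and $U$ (control space) are Hilbert spaces with duals $H'$, $U'$; $L(X,Y)$ denotes bounded linear operators. $\widetilde J:H\to H'$ and $J:U'\to U$ are the canonical (Riesz) isomorphisms. In the complex case, duals consist of continuous antilinear functionals and pairings $\langle\cdot,\cdot\rangle$ are linear in the first and antilinear in the second argument, so that $\langle x,\widetilde J y\rangle_{H,H'}=(x,y)_H$ and $\langle Jx',y'\rangle_{U,U'}=(x',y')_{U'}$; $\langle x',x\rangle_{H',H}=\overline{\langle x,x'\rangle_{H,H'}}$. Adjoints $^*$ are taken with respect to these duality pairings. Hypotheses. (H1) $A:D(A)\subset H\to H$ generates a strongly continuous group $e^{tA}$ on $H$. Then $A^*:D(A^* )\subset H'\to H'$ generates the strongly continuous group $e^{tA^*}=(e^{tA})^*$ on $H'$. $D(A^* )$ is a Hilbert space with norm $\|x\|_{D(A^* )}^2=\|x\|_{H'}^2+\|A^*x\|_{H'}^2$, and $H\subset D(A^* )'$ via $\langle x,y\rangle_{D(A^* )',D(A^* )}=\langle x,y\rangle_{H,H'}$. (H2) $B\in L(U,D(A^* )')$; $B^*\in L(D(A^* ),U')$ denotes its adjoint (identifying $D(A^* )''$ with $D(A^* )$). (H3) For every $T>0$ there is $c_1(T)>0$ with $\int_0^T\|B^*e^{-tA^*}x\|_{U'}^2dt\le c_1(T)\|x\|_{H'}^2$ for all $x\in D(A^* )$. (H4) There are $T>0$ and $c_2(T)>0$ with $c_2(T)\|x\|_{H'}^2\le\int_0^T\|B^*e^{-tA^*}x\|_{U'}^2dt$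 for all $x\in D(A^* )$. This $T$ is fixed from now on. Extension of $B^*$ along trajectories. For $y_0\in H'$ and $g\in L^1_{\rm loc}(\mathbb{R};H')$ put $y(t)=e^{-tA^*}y_0+\int_0^te^{-(t-r)A^*}g(r)\,dr$. For every $\tau>0$ there is $c>0$ such that $\int_{-\tau}^{\tau}\|B^*y(t)\|_{U'}^2dt\le c(\|y_0\|_{H'}^2+\|g\|_{L^1(-\tau,\tau;H')}^2)$ whenever $y_0\in D(A^* )$ and $g\in L^1(-\tau,\tau;D(A^* ))$. Hence $(y_0,g)\mapsto B^*y$ extends by density to all $y_0\in H'$, $g\in L^1_{\rm loc}(\mathbb{R};H')$, with values in $L^2_{\rm loc}(\mathbb{R};U')$; $B^*y$ denotes this extension. In particular ($g=0$) $t\mapsto B^*e^{-tA^*}x$ is an element of $L^2_{\rm loc}(\mathbb{R};U')$ for each $x\in H'$. Weighted Gramian. Fix $\omega>0$, set $T_\omega:=T+\frac1{2\omega}$, and let $e_\omega(s)=e^{-2\omega s}$ for $0\le s\le T$, $e_\omega(s)=2\omega e^{-2\omega T}(T_\omega-s)$ for $T\le s\le T_\omega$. The operator $\Lambda_\omega\in L(H',H)$ is defined by $$\langle\Lambda_\omega x,y\rangle_{H,H'}=\int_0^{T_\omega}e_\omega(s)\langle JB^*e^{-sA^*}x,B^*e^{-sA^*}y\rangle_{U,U'}ds,\qquad x,y\in H'.$$ It is self-adjoint, positive-definite and invertible, with $\Lambda_\omega^{-1}\in L(H,H')$. The operator $C$. Let $L\in L(H)$ be the positive-definite self-adjoint operator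 given by $$(Lx,y)_H=-\int_0^{T_\omega}e_\omega'(s)\langle JB^*e^{-sA^*}\Lambda_\omega^{-1}x,B^*e^{-sA^*}\Lambda_\omega^{-1}y\rangle_{U,U'}ds,$$ and $C:=\sqrt L\in L(H)$, with adjoint $C^*\in L(H')$, i.e. $\langle Cx,y\rangle_{H,H'}=\langle x,C^*y\rangle_{H,H'}$. Groups. $V(t)$ is the strongly continuous group on $H'$ generated by $-A^*-C^*\widetilde JC\Lambda_\omega$ with domain $D(A^* )$ (a bounded perturbation of $-A^*$); it satisfies $V(t)y_0=e^{-tA^*}y_0-\int_0^te^{-(t-r)A^*}C^*\widetilde JC\Lambda_\omega V(r)y_0\,dr$. Thus $t\mapsto B^*V(t)y_0$ is defined in $L^2_{\rm loc}(\mathbb{R};U')$ for every $y_0\in H'$ as the value, at the pair $(y_0,g)$ with $g=-C^*\widetilde JC\Lambda_\omega V(\cdot)y_0$, of the extension by density to $H'\times L^1_{\rm loc}(\mathbb{R};H')$ of the map $(y_0,g)\mapsto B^*y$, where $y(t)=e^{-tA^*}y_0+\int_0^te^{-(t-r)A^*}g(r)\,dr$. For $x_0\in H$, $U(t)x_0:=\Lambda_\omega V(t)\Lambda_\omega^{-1}x_0$ (the group $U(t)$ on $H$ is not to be confused with the control space $U$); accordingly $B^*\Lambda_\omega^{-1}U(r)x_0$ means $B^*V(r)\Lambda_\omega^{-1}x_0$. *)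

theory Defs
  imports "HOL-Analysis.Analysis"
begin

section \<open>Scalars\<close>

text \<open>
  Real and complex Hilbert spaces are treated uniformly over a scalar field of the following class.
  By Frobenius' theorem \<open>real\<close> and \<open>complex\<close> are its only members up to isomorphism. The inner
  product \<open>\<bullet>\<close> of \<^class>\<open>euclidean_space\<close> is the real one, so \<open>z \<bullet> 1\<close> is the real part of \<open>z\<close>.
\<close>

class rc_field = real_normed_field + euclidean_space

instance real :: rc_field ..
instance complex :: rc_field ..

definition kconj :: "'k::rc_field \<Rightarrow> 'k" where
  "kconj z = of_real (2 * (z \<bullet> 1)) - z"

lemma kconj_real: "kconj (x::real) = x"
  by (simp add: kconj_def)

lemma kconj_complex: "kconj (z::complex) = cnj z"
  by (simp add: kconj_def complex_eq_iff inner_complex_def)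


section \<open>Hilbert spaces, antiduals and operators\<close>

text \<open>The inner product is linear in its first and antilinear in its second argument.\<close>

locale hilbert = vector_space scl
  for scl :: "'k::rc_field \<Rightarrow> 'h::banach \<Rightarrow> 'h" +
  fixes ip :: "'h \<Rightarrow> 'h \<Rightarrow> 'k"
  assumes scl_of_real: "scl (of_real r) x = r *\<^sub>R x"
    and ip_add_left: "ip (x + y) z = ip x z + ip y z"
    and ip_scl_left: "ip (scl a x) y = a * ip x y"
    and ip_conj: "ip y x = kconj (ip x y)"
    and ip_norm: "ip x x = of_real ((norm x)\<^sup>2)"

lemma hilbert_real: "hilbert scaleR (inner :: 'a::{real_inner, banach} \<Rightarrow> 'a \<Rightarrow> real)"
  by unfold_locales
     (simp_all add: scaleR_add_right scaleR_add_left inner_add_left inner_add_right inner_commute kconj_real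
       power2_norm_eq_inner)

lemma hilbert_complex: "hilbert (*) (\<lambda>z w. z * cnj w)"
  by unfold_locales
     (simp_all add: algebra_simps scaleR_conv_of_real kconj_complex complex_norm_square[symmetric])

text \<open>
  The dual consists of the continuous antilinear functionals. It is a closed subspace (over the
  reals) of the Banach space of bounded real-linear maps, all of which it exhausts if the scalars
  are real; the norm inherited from there is the dual norm. Operators on a dual are functions on
  that ambient type of which only the values on \<open>antidual scl\<close> matter.
\<close>

definition antidual :: "('k::rc_field \<Rightarrow> 'h::banach \<Rightarrow> 'h) \<Rightarrow> ('h \<Rightarrow>\<^sub>L 'k) set" where
  "antidual scl = {f. \<forall>a x. blinfun_apply f (scl a x) = kconj a * blinfun_apply f x}"

definition dscl :: "'k::rc_field \<Rightarrow> ('h::banach \<Rightarrow>\<^sub>L 'k) \<Rightarrow> ('h \<Rightarrow>\<^sub>L 'k)" where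
  "dscl a f = Blinfun (\<lambda>x. a * blinfun_apply f x)"

text \<open>
  The pairing of a space with its dual, linear in the first argument. In the opposite order the
  pairing is the value of the functional.
\<close>

definition pr :: "'h::banach \<Rightarrow> ('h \<Rightarrow>\<^sub>L 'k::rc_field) \<Rightarrow> 'k" where
  "pr x f = kconj (blinfun_apply f x)"

text \<open>The Riesz isomorphism of a space onto its dual: \<open>pr x (riesz ip y) = ip x y\<close>.\<close>

definition riesz :: "('h::banach \<Rightarrow> 'h \<Rightarrow> 'k::rc_field) \<Rightarrow> 'h \<Rightarrow> ('h \<Rightarrow>\<^sub>L 'k)" where
  "riesz ip y = Blinfun (\<lambda>x. kconj (ip x y))"

definition bounded_op ::
  "'x::real_normed_vector set \<Rightarrow> ('k \<Rightarrow> 'x \<Rightarrow> 'x) \<Rightarrow>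
   'y::real_normed_vector set \<Rightarrow> ('k \<Rightarrow> 'y \<Rightarrow> 'y) \<Rightarrow> ('x \<Rightarrow> 'y) \<Rightarrow> bool" where
  "bounded_op X sX Y sY F \<longleftrightarrow>
     (\<forall>x\<in>X. F x \<in> Y) \<and>
     (\<forall>x\<in>X. \<forall>y\<in>X. F (x + y) = F x + F y) \<and>
     (\<forall>a. \<forall>x\<in>X. F (sX a x) = sY a (F x)) \<and>
     (\<exists>c. \<forall>x\<in>X. norm (F x) \<le> c * norm x)"

text \<open>The adjoint, with respect to \<open>pr\<close>, of an operator \<open>F\<close> with domain \<open>D\<close>.\<close>

definition adj_dom ::
  "('k::rc_field \<Rightarrow> 'h::banach \<Rightarrow> 'h) \<Rightarrow> 'h set \<Rightarrow> ('h \<Rightarrow> 'h) \<Rightarrow> ('h \<Rightarrow>\<^sub>L 'k) set" where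
  "adj_dom scl D F = {f \<in> antidual scl. \<exists>g \<in> antidual scl. \<forall>x\<in>D. pr (F x) f = pr x g}"

definition adj ::
  "('k::rc_field \<Rightarrow> 'h::banach \<Rightarrow> 'h) \<Rightarrow> 'h set \<Rightarrow> ('h \<Rightarrow> 'h) \<Rightarrow> ('h \<Rightarrow>\<^sub>L 'k) \<Rightarrow> ('h \<Rightarrow>\<^sub>L 'k)" where
  "adj scl D F f = (THE g. g \<in> antidual scl \<and> (\<forall>x\<in>D. pr (F x) f = pr x g))"

definition is_pos_sqrt ::
  "('k::rc_field \<Rightarrow> 'h::banach \<Rightarrow> 'h) \<Rightarrow> ('h \<Rightarrow> 'h \<Rightarrow> 'k) \<Rightarrow> ('h \<Rightarrow> 'h) \<Rightarrow> ('h \<Rightarrow> 'h) \<Rightarrow> bool" where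
  "is_pos_sqrt scl ip L C \<longleftrightarrow>
     bounded_op UNIV scl UNIV scl C \<and>
     (\<forall>x y. ip (C x) y = ip x (C y)) \<and>
     (\<forall>x. \<exists>r\<ge>0. ip (C x) x = of_real r) \<and>
     (\<forall>x. C (C x) = L x)"


section \<open>Strongly continuous groups\<close>

definition C0_group ::
  "'x::real_normed_vector set \<Rightarrow> ('k \<Rightarrow> 'x \<Rightarrow> 'x) \<Rightarrow> (real \<Rightarrow> 'x \<Rightarrow> 'x) \<Rightarrow> bool" where
  "C0_group X scl G \<longleftrightarrow>
     (\<forall>t. bounded_op X scl X scl (G t)) \<and>
     (\<forall>x\<in>X. G 0 x = x) \<and>
     (\<forall>s t. \<forall>x\<in>X. G (s + t) x = G s (G t x)) \<and>
     (\<forall>x\<in>X. continuous_on UNIV (\<lambda>t. G t x))"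

text \<open>The infinitesimal generator of \<open>G\<close> is \<open>F\<close> with domain exactly \<open>D\<close>.\<close>

definition has_generator ::
  "'x::real_normed_vector set \<Rightarrow> (real \<Rightarrow> 'x \<Rightarrow> 'x) \<Rightarrow> 'x set \<Rightarrow> ('x \<Rightarrow> 'x) \<Rightarrow> bool" where
  "has_generator X G D F \<longleftrightarrow> D \<subseteq> X \<and>
     (\<forall>x\<in>X. \<forall>y. ((\<lambda>h. (G h x - x) /\<^sub>R h) \<longlongrightarrow> y) (at 0) \<longleftrightarrow> x \<in> D \<and> y = F x)"


section \<open>The control operator\<close>

definition graph_norm :: "('x::real_normed_vector \<Rightarrow> 'x) \<Rightarrow> 'x \<Rightarrow> real" where
  "graph_norm F y = sqrt ((norm y)\<^sup>2 + (norm (F y))\<^sup>2)"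

text \<open>
  \<open>B\<close> is a bounded linear operator from the control space into the dual of the domain \<open>D\<close> of the
  operator \<open>F\<close> on the state dual, where \<open>D\<close> has the graph norm. Here \<open>B u\<close> is given as a
  functional, of which only the values on \<open>D\<close> matter. The last conjunct gives both the continuity
  of each \<open>B u\<close> and the boundedness of \<open>B\<close> for the dual norm.
\<close>

definition control_op ::
  "('k::rc_field \<Rightarrow> 'u::banach \<Rightarrow> 'u) \<Rightarrow> ('h::banach \<Rightarrow>\<^sub>L 'k) set \<Rightarrow>
   (('h \<Rightarrow>\<^sub>L 'k) \<Rightarrow> ('h \<Rightarrow>\<^sub>L 'k)) \<Rightarrow> ('u \<Rightarrow> ('h \<Rightarrow>\<^sub>L 'k) \<Rightarrow> 'k) \<Rightarrow> bool" where
  "control_op sclU D F B \<longleftrightarrow>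
     (\<forall>u. \<forall>y\<in>D. \<forall>z\<in>D. B u (y + z) = B u y + B u z) \<and>
     (\<forall>u a. \<forall>y\<in>D. B u (dscl a y) = kconj a * B u y) \<and>
     (\<forall>u v. \<forall>y\<in>D. B (u + v) y = B u y + B v y) \<and>
     (\<forall>a u. \<forall>y\<in>D. B (sclU a u) y = a * B u y) \<and>
     (\<exists>c. \<forall>u. \<forall>y\<in>D. norm (B u y) \<le> c * norm u * graph_norm F y)"

definition control_adj ::
  "('k::rc_field \<Rightarrow> 'u::banach \<Rightarrow> 'u) \<Rightarrow> ('u \<Rightarrow> ('h::banach \<Rightarrow>\<^sub>L 'k) \<Rightarrow> 'k) \<Rightarrow>
   ('h \<Rightarrow>\<^sub>L 'k) \<Rightarrow> ('u \<Rightarrow>\<^sub>L 'k)" where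
  "control_adj sclU B y = (THE f. f \<in> antidual sclU \<and> (\<forall>u. B u y = pr u f))"


section \<open>Extension of the observation along trajectories\<close>

text \<open>
  Vector-valued integrals are taken with \<^const>\<open>integral\<close>, because the library's Bochner integral
  requires a separable space. The predicate \<^const>\<open>measurable_on\<close> is strong measurability (almost
  everywhere a limit of continuous functions); for strongly measurable functions with integrable
  norm both integrals exist and agree.
\<close>

definition oriented_integral :: "real \<Rightarrow> real \<Rightarrow> (real \<Rightarrow> 'x::banach) \<Rightarrow> 'x" where
  "oriented_integral a b f = (if a \<le> b then integral {a..b} f else - integral {b..a} f)"

definition L1_on :: "real set \<Rightarrow> (real \<Rightarrow> 'x::banach) \<Rightarrow> bool" where
  "L1_on I f \<longleftrightarrow> f measurable_on I \<and> (\<lambda>t. norm (f t)) integrable_on I"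

definition L2_on :: "real set \<Rightarrow> (real \<Rightarrow> 'x::banach) \<Rightarrow> bool" where
  "L2_on I f \<longleftrightarrow> f measurable_on I \<and> (\<lambda>t. (norm (f t))\<^sup>2) integrable_on I"

text \<open>
  Integrability with values in the domain \<open>D\<close> of \<open>F\<close>, for the graph norm: the norm of the pair
  \<open>(g t, F (g t))\<close> in the product space is the graph norm of \<open>g t\<close>.
\<close>

definition L1_graph_on ::
  "'x::banach set \<Rightarrow> ('x \<Rightarrow> 'x) \<Rightarrow> real set \<Rightarrow> (real \<Rightarrow> 'x) \<Rightarrow> bool" where
  "L1_graph_on D F I g \<longleftrightarrow> (\<forall>t\<in>I. g t \<in> D) \<and> L1_on I (\<lambda>t. (g t, F (g t)))"

text \<open>For \<open>E t\<close> the group generated by the adjoint \<open>F\<close>, the solution of \<open>y' = - F y + g\<close>.\<close>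

definition traj :: "(real \<Rightarrow> 'x::banach \<Rightarrow> 'x) \<Rightarrow> 'x \<Rightarrow> (real \<Rightarrow> 'x) \<Rightarrow> real \<Rightarrow> 'x" where
  "traj E y0 g t = E (- t) y0 + oriented_integral 0 t (\<lambda>r. E (- (t - r)) (g r))"

text \<open>
  \<open>z\<close> represents the value at \<open>(y0, g)\<close> of the extension by density of
  \<open>(y0, g) \<mapsto> (\<lambda>t. Bd (traj E y0 g t))\<close>, a map into the locally square integrable functions with
  values in the closed subspace \<open>Y\<close>. It is used for locally integrable \<open>g\<close> only.
\<close>

definition is_obs_ext ::
  "'y::banach set \<Rightarrow> 'x::banach set \<Rightarrow> ('x \<Rightarrow> 'x) \<Rightarrow> (real \<Rightarrow> 'x \<Rightarrow> 'x) \<Rightarrow> ('x \<Rightarrow> 'y) \<Rightarrow>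
   'x \<Rightarrow> (real \<Rightarrow> 'x) \<Rightarrow> (real \<Rightarrow> 'y) \<Rightarrow> bool" where
  "is_obs_ext Y D F E Bd y0 g z \<longleftrightarrow>
     (\<forall>t. z t \<in> Y) \<and>
     (\<forall>\<tau>>0. L2_on {-\<tau>..\<tau>} z \<and>
       (\<forall>yn gn.
          (\<forall>n. yn n \<in> D \<and> L1_graph_on D F {-\<tau>..\<tau>} (gn n)) \<and>
          yn \<longlonglongrightarrow> y0 \<and>
          (\<lambda>n. integral {-\<tau>..\<tau>} (\<lambda>t. norm (gn n t - g t))) \<longlonglongrightarrow> 0 \<longrightarrow>
          (\<lambda>n. integral {-\<tau>..\<tau>} (\<lambda>t. (norm (Bd (traj E (yn n) (gn n) t) - z t))\<^sup>2)) \<longlonglongrightarrow> 0))"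

definition obs_ext ::
  "'y::banach set \<Rightarrow> 'x::banach set \<Rightarrow> ('x \<Rightarrow> 'x) \<Rightarrow> (real \<Rightarrow> 'x \<Rightarrow> 'x) \<Rightarrow> ('x \<Rightarrow> 'y) \<Rightarrow>
   'x \<Rightarrow> (real \<Rightarrow> 'x) \<Rightarrow> (real \<Rightarrow> 'y)" where
  "obs_ext Y D F E Bd y0 g = (SOME z. is_obs_ext Y D F E Bd y0 g z)"


section \<open>The weight\<close>

text \<open>
  Only used on \<open>{0..T + 1 / (2 * \<omega>)}\<close>; both formulas are continued, so that the weight is
  continuously differentiable on the whole line.
\<close>

definition weight :: "real \<Rightarrow> real \<Rightarrow> real \<Rightarrow> real" where
  "weight \<omega> T s =
     (if s \<le> T then exp (- 2 * \<omega> * s)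
      else 2 * \<omega> * exp (- 2 * \<omega> * T) * (T + 1 / (2 * \<omega>) - s))"

end

theory Submission
  imports Defs
begin

text \<open>
  Write \<open>E t\<close> for the group generated by the adjoint \<open>A\<^sup>*\<close> and \<open>K\<close> for the bounded operator
  \<open>C\<^sup>* J C \<Lambda>\<close>, so that \<open>V\<close> is generated by \<open>- A\<^sup>* - K\<close>. The weight equals \<open>1\<close> at \<open>0\<close> and vanishes at the
  right end point, and its derivative defines \<open>L = C\<^sup>2\<close>. Integrating the derivative of the weighted
  integrand of the Gramian therefore gives the algebraic Riccati equation
  \<open>\<langle>\<Lambda> A\<^sup>* x, y\<rangle> + \<langle>\<Lambda> x, A\<^sup>* y\<rangle> = \<langle>J B\<^sup>* x, B\<^sup>* y\<rangle> - \<langle>\<Lambda> K x, y\<rangle>\<close>.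
  It says that \<open>r \<mapsto> \<langle>\<Lambda> V(r) x, E(t - r) y\<rangle>\<close> has the derivative
  \<open>- \<langle>J B\<^sup>* V(r) x, B\<^sup>* E(t - r) y\<rangle>\<close>, and integration over \<open>[0, t]\<close> yields the variation of constants
  formula.

  This computation is only formal, since \<open>B\<^sup>*\<close> is defined on the domain of \<open>A\<^sup>*\<close> alone, and the observation
  \<open>B\<^sup>* E(s) x\<close> need not be differentiable in \<open>s\<close> even for \<open>x\<close> in that domain. It becomes rigorous for the averages
  \<open>reg n x = n \<integral> E(s) x ds\<close> over \<open>[0, 1/n]\<close>: they commute with \<open>E\<close>, and \<open>B\<^sup>* \<circ> reg n\<close> is bounded. The Riccati
  equation (\<open>gramian_riccati\<close>) and the differentiated formula
  (\<open>regularised_variation_of_constants\<close>) hold for the averages, the latter up to the commutator of \<open>K\<close> and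
  \<open>reg n\<close>, which tends strongly to \<open>0\<close>. The averaged orbits of \<open>V\<close> and \<open>E\<close> are trajectories with data of
  the kind admitted in the extension of \<open>B\<^sup>*\<close>, so their observations converge in \<open>L\<^sup>2\<close>, and
  \<open>variation_of_constants\<close> is the limit.

  That the extension exists rests on two facts: the admissibility estimate for trajectories with a
  source term (\<open>traj_observation_bound\<close>), which follows from the one for free orbits by a weighted
  Cauchy-Schwarz inequality, and the completeness of \<open>L\<^sup>2\<close> for strongly measurable functions with values in
  a Banach space (\<open>L2_loc_complete\<close>).

  The assertions about \<open>U\<close> follow by similarity from those about \<open>V\<close>, once \<open>\<Lambda>\<close> is known to be invertible:
  the observability inequality makes \<open>\<Lambda>\<close> coercive (\<open>coercive_imp_bij\<close>). Strong continuity of the adjoint group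
  needs the density of the domain of \<open>A\<^sup>*\<close>, which holds because \<open>V\<close> has a generator with this domain
  (\<open>adjoint_generated_group\<close>). Operators on the antidual act on a subset of a type, in general a proper one; for this
  reason the analysis is done on the Hilbert space itself, and the Riesz isometry carries it over
  (\<open>is_obs_ext_riesz\<close>).
\<close>

section \<open>The scalar field\<close>

lemma inner_of_real_one [simp]: "(of_real r :: 'k::rc_field) \<bullet> 1 = r"
proof -
  have "(1::'k) \<bullet> 1 = 1"
    by (simp flip: power2_norm_eq_inner)
  then show ?thesis
    by (simp add: of_real_def)
qed

lemma kconj_add: "kconj (x + y) = kconj x + kconj (y::'k::rc_field)"
  by (simp add: kconj_def inner_add_left algebra_simps)

lemma kconj_scaleR: "kconj (r *\<^sub>R x) = r *\<^sub>R kconj (x::'k::rc_field)"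
  by (simp add: kconj_def scaleR_diff_right) (simp add: scaleR_conv_of_real)

lemma kconj_of_real [simp]: "kconj (of_real r :: 'k::rc_field) = of_real r"
proof -
  have "of_real (2 * r) = (of_real r + of_real r :: 'k)"
    by (simp flip: of_real_add)
  then show ?thesis
    by (simp add: kconj_def)
qed

lemma inner_one_kconj [simp]: "kconj x \<bullet> 1 = (x::'k::rc_field) \<bullet> 1"
  unfolding kconj_def inner_diff_left inner_of_real_one by simp

lemma kconj_kconj [simp]: "kconj (kconj x) = (x::'k::rc_field)"
proof -
  have "kconj (kconj x) = of_real (2 * (kconj x \<bullet> 1)) - kconj x"
    by (rule kconj_def)
  then show ?thesis
    unfolding inner_one_kconj by (simp add: kconj_def)
qed

lemma norm_scalar_mult_inner:
  fixes x :: "'k::rc_field"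
  shows "(x * u) \<bullet> (x * v) = (norm x)\<^sup>2 * (u \<bullet> v)"
proof -
  have "(norm (x * (u + v)))\<^sup>2 = (norm x)\<^sup>2 * (norm (u + v))\<^sup>2"
    "(norm (x * u))\<^sup>2 = (norm x)\<^sup>2 * (norm u)\<^sup>2" "(norm (x * v))\<^sup>2 = (norm x)\<^sup>2 * (norm v)\<^sup>2"
    by (simp_all add: norm_mult power_mult_distrib)
  then show ?thesis
    unfolding power2_norm_eq_inner[of "_ * _"] power2_norm_eq_inner[of u] power2_norm_eq_inner[of v]
      power2_norm_eq_inner[of "u + v"]
    by (simp add: inner_add_left inner_add_right distrib_left inner_commute)
qed

text \<open>
  Polarising \<open>norm ((x + 1) * u) = norm (x + 1) * norm u\<close> in both factors shows that multiplication by
  \<open>kconj x\<close> is the adjoint of multiplication by \<open>x\<close>. Multiplicativity of the norm thus forces \<open>kconj\<close> to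
  behave like complex conjugation.
\<close>

lemma inner_mult_kconj:
  fixes x :: "'k::rc_field"
  shows "(x * u) \<bullet> v = u \<bullet> (kconj x * v)"
proof -
  have 1: "((x + 1) * u) \<bullet> ((x + 1) * v) = (norm (x + 1))\<^sup>2 * (u \<bullet> v)"
    "(x * u) \<bullet> (x * v) = (norm x)\<^sup>2 * (u \<bullet> v)"
    by (rule norm_scalar_mult_inner)+
  have 2: "(norm (x + 1))\<^sup>2 = (norm x)\<^sup>2 + 2 * (x \<bullet> 1) + 1"
    using inner_of_real_one[of 1] unfolding power2_norm_eq_inner
    by (simp add: inner_add_left inner_add_right inner_commute)
  have "(x * u) \<bullet> v + u \<bullet> (x * v) = 2 * (x \<bullet> 1) * (u \<bullet> v)"
    using 1 unfolding 2 by (simp add: inner_add_left inner_add_right distrib_left distrib_right)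
  moreover have "u \<bullet> (kconj x * v) = 2 * (x \<bullet> 1) * (u \<bullet> v) - u \<bullet> (x * v)"
    unfolding kconj_def left_diff_distrib inner_diff_right scaleR_conv_of_real[symmetric] by simp
  ultimately show ?thesis
    by simp
qed

lemma kconj_mult_self:
  fixes x :: "'k::rc_field"
  shows "kconj x * x = of_real ((norm x)\<^sup>2)"
proof -
  have "(kconj x * x) \<bullet> b = of_real ((norm x)\<^sup>2) \<bullet> b" for b :: 'k
  proof -
  have "(kconj x * x) \<bullet> b = x \<bullet> (x * b)"
    using inner_mult_kconj[of "kconj x" x b] by simp
  also have "\<dots> = of_real ((norm x)\<^sup>2) \<bullet> b"
    using norm_scalar_mult_inner[of x 1 b] by (simp add: of_real_def)
  finally show ?thesis .
  qed
  then show ?thesis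
    using vector_eq_rdot[of "kconj x * x" "of_real ((norm x)\<^sup>2)"] by simp
qed

lemma norm_kconj [simp]: "norm (kconj x) = norm (x::'k::rc_field)"
proof (cases "x = 0")
  case True
  then show ?thesis
    by (simp add: kconj_def)
next
  case False
  have "norm (kconj x) * norm x = norm x * norm x"
    using arg_cong[OF kconj_mult_self[of x], of norm] by (simp add: norm_mult power2_eq_square)
  then show ?thesis
    using False by simp
qed

lemma kconj_mult: "kconj (x * y) = kconj x * kconj (y::'k::rc_field)"
proof (cases "x * y = 0")
  case True
  then show ?thesis
    by (auto simp: kconj_def)
next
  case False
  have "kconj (x * y) * (x * y) = (kconj x * kconj y) * (x * y)"
    by (metis (no_types, lifting) kconj_mult_self mult.assoc mult.left_commute norm_mult of_real_mult power_mult_distrib)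
  then show ?thesis
    using False by simp
qed

lemma bounded_linear_kconj: "bounded_linear (kconj :: 'k::rc_field \<Rightarrow> 'k)"
  by (rule bounded_linear_intro[of _ 1]) (simp_all add: kconj_add kconj_scaleR)

section \<open>Riesz representation\<close>

context hilbert
begin

lemma ip_scaleR_left: "ip (r *\<^sub>R x) y = r *\<^sub>R ip x y"
  by (metis ip_scl_left scl_of_real scaleR_conv_of_real)

lemma ip_add_right: "ip z (x + y) = ip z x + ip z y"
  by (metis ip_add_left ip_conj kconj_add)

lemma ip_scl_right: "ip x (scl a y) = kconj a * ip x y"
  by (metis ip_scl_left ip_conj kconj_mult)

lemma ip_scaleR_right: "ip x (r *\<^sub>R y) = r *\<^sub>R ip x y"
  by (metis ip_scaleR_left ip_conj kconj_scaleR)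

lemma inner_one_ip_sym: "ip y x \<bullet> 1 = ip x y \<bullet> 1"
  by (metis ip_conj inner_one_kconj)

lemma inner_one_ip_self: "ip x x \<bullet> 1 = (norm x)\<^sup>2"
  by (simp only: ip_norm inner_of_real_one)

lemma norm_scl: "norm (scl a x) = norm a * norm x"
proof -
  have "ip (scl a x) (scl a x) = (kconj a * a) * ip x x"
    unfolding ip_scl_left ip_scl_right by (simp add: ac_simps)
  then have "(norm (scl a x))\<^sup>2 = (norm a)\<^sup>2 * (norm x)\<^sup>2"
    unfolding ip_norm kconj_mult_self of_real_mult[symmetric] of_real_eq_iff .
  then show ?thesis
    by (metis norm_ge_zero mult_nonneg_nonneg power2_eq_iff_nonneg power_mult_distrib)
qed

lemma norm_add_sq: "(norm (x + y))\<^sup>2 = (norm x)\<^sup>2 + 2 * (ip x y \<bullet> 1) + (norm y)\<^sup>2"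
  unfolding inner_one_ip_self[symmetric] 
  by (simp add: ip_add_left ip_add_right inner_add_left inner_one_ip_sym[of x y])

lemma inner_one_ip_le: "ip x y \<bullet> 1 \<le> norm x * norm y"
proof -
  have "0 \<le> (norm (norm y *\<^sub>R x + (- (norm x)) *\<^sub>R y))\<^sup>2"
    by simp
  also have "\<dots> = 2 * (norm x * norm y) * (norm x * norm y - ip x y \<bullet> 1)"
    unfolding norm_add_sq by (simp add: ip_scaleR_left ip_scaleR_right ip_scaleR_right[of _ "-1", simplified] power2_eq_square algebra_simps)
  finally have *: "0 \<le> (norm x * norm y) * (norm x * norm y - ip x y \<bullet> 1)"
    by simp
  show ?thesis
  proof (cases "norm x * norm y = 0")
    case True
    have "ip 0 v = 0" "ip v 0 = 0" for v
      using ip_scaleR_left[of 0 0 v] ip_scaleR_right[of v 0 0] by auto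
    then show ?thesis
      using True by auto
  next
    case False
    then have "0 < norm x * norm y"
      by simp
    then show ?thesis
      using * by (simp add: zero_le_mult_iff)
  qed
qed

text \<open>
  The real part already satisfies the Cauchy-Schwarz inequality; multiplying \<open>x\<close> by \<open>kconj (ip x y)\<close>
  makes the inner product real.
\<close>

lemma norm_ip_le: "norm (ip x y) \<le> norm x * norm y"
proof -
  let ?a = "ip x y"
  have "ip (scl (kconj ?a) x) y \<bullet> 1 = (norm ?a)\<^sup>2"
    unfolding ip_scl_left kconj_mult_self by (rule inner_of_real_one)
  moreover have "ip (scl (kconj ?a) x) y \<bullet> 1 \<le> norm ?a * norm x * norm y"
    using inner_one_ip_le[of "scl (kconj ?a) x" y] by (simp add: norm_scl)
  ultimately have "norm ?a * norm ?a \<le> norm ?a * (norm x * norm y)"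
    by (simp add: power2_eq_square mult.assoc)
  then show ?thesis
    by (cases "norm ?a = 0") auto
qed

lemma bounded_bilinear_ip: "bounded_bilinear ip"
  by unfold_locales
    (auto simp: ip_add_left ip_add_right ip_scaleR_left ip_scaleR_right intro!: exI[of _ 1] norm_ip_le)

lemma ip_eqI: "(\<And>x. ip x y \<bullet> 1 = ip x z \<bullet> 1) \<Longrightarrow> y = z"
proof -
  assume *: "\<And>x. ip x y \<bullet> 1 = ip x z \<bullet> 1"
  interpret bounded_bilinear ip
    by (rule bounded_bilinear_ip)
  have "(norm (y - z))\<^sup>2 = ip (y - z) y \<bullet> 1 - ip (y - z) z \<bullet> 1"
    unfolding inner_one_ip_self[symmetric] by (simp only: diff_right inner_diff_left)
  then show ?thesis
    using * by simp
qed

lemma parallelogram: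
  fixes x y :: 'h
  shows "(norm (x + y))\<^sup>2 + (norm (x - y))\<^sup>2 = 2 * (norm x)\<^sup>2 + 2 * (norm y)\<^sup>2"
  using norm_add_sq[of x y] norm_add_sq[of x "- y"] ip_scaleR_right[of x "-1" y] by simp

text \<open>
  A bounded real functional \<open>\<phi>\<close> is represented by the minimiser of \<open>\<parallel>x\<parallel>\<^sup>2 - 2 \<phi> x\<close>: minimising
  sequences are Cauchy by the parallelogram law, and the first variation at the minimiser vanishes.
\<close>

lemma real_riesz_representation:
  fixes \<phi> :: "'h \<Rightarrow> real"
  assumes "bounded_linear \<phi>"
  shows "\<exists>y. \<forall>x. \<phi> x = ip x y \<bullet> 1"
proof -
  interpret \<phi>: bounded_linear \<phi>
    by fact
  obtain K where K: "\<And>x. \<bar>\<phi> x\<bar> \<le> norm x * K"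
    using \<phi>.bounded by auto
  define f where "f x = (norm x)\<^sup>2 - 2 * \<phi> x" for x
  have below: "- K\<^sup>2 \<le> f x" for x
  proof -
    have "0 \<le> (norm x - K)\<^sup>2"
      by simp
    then show ?thesis
      using K[of x] unfolding f_def power2_diff by (simp add: abs_le_iff algebra_simps)
  qed
  define m where "m = (INF x. f x)"
  have m_le: "m \<le> f x" for x
    unfolding m_def by (rule cINF_lower) (auto intro!: bdd_belowI2[of _ "- K\<^sup>2"] below)
  have "\<exists>x. f x < m + 1 / real (Suc n)" for n
  proof -
    have "bdd_below (range f)"
      by (auto intro!: bdd_belowI2[of _ "- K\<^sup>2"] below)
    then show ?thesis
      using cINF_less_iff[of UNIV f "m + 1 / real (Suc n)"] unfolding m_def[symmetric] by auto
  qed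
  then obtain X where X: "\<And>n. f (X n) < m + 1 / real (Suc n)"
    by metis
  have dist: "(norm (x - y))\<^sup>2 \<le> 2 * f x + 2 * f y - 4 * m" for x y
  proof -
    have "(norm ((1/2) *\<^sub>R (x + y)))\<^sup>2 = (norm (x + y))\<^sup>2 / 4"
      by (simp add: power_divide)
    then have "4 * f ((1/2) *\<^sub>R (x + y)) = (norm (x + y))\<^sup>2 - 4 * \<phi> x - 4 * \<phi> y"
      unfolding f_def \<phi>.scaleR \<phi>.add by (simp add: power_divide field_simps)
    then show ?thesis
      using parallelogram[of x y] m_le[of "(1/2) *\<^sub>R (x + y)"] unfolding f_def by simp
  qed
  have "Cauchy X"
  proof (rule CauchyI)
    fix e :: real
    assume "0 < e"
    then obtain N where N: "1 / real (Suc N) < e\<^sup>2 / 4"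
      using nat_approx_posE[of "e\<^sup>2 / 4"] by auto
    have "norm (X i - X j) < e" if "N \<le> i" "N \<le> j" for i j
    proof -
      have "1 / real (Suc i) \<le> 1 / real (Suc N)" "1 / real (Suc j) \<le> 1 / real (Suc N)"
        using that by (simp_all add: frac_le)
      then have "(norm (X i - X j))\<^sup>2 < e\<^sup>2"
        using dist[of "X i" "X j"] X[of i] X[of j] N by linarith
      then show ?thesis
        using \<open>0 < e\<close> by (simp add: power2_less_imp_less)
    qed
    then show "\<exists>M. \<forall>m\<ge>M. \<forall>n\<ge>M. norm (X m - X n) < e"
      by blast
  qed
  then obtain y where y: "X \<longlonglongrightarrow> y"
    using Cauchy_convergent convergent_def by blast
  have "(\<lambda>n. f (X n)) \<longlonglongrightarrow> f y"
    unfolding f_def by (intro tendsto_intros y \<phi>.tendsto)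
  moreover have "(\<lambda>n. m + 1 / real (Suc n)) \<longlonglongrightarrow> m + 0"
    by (intro tendsto_intros LIMSEQ_Suc[OF lim_1_over_n])
  ultimately have "f y \<le> m + 0"
    using X by (intro LIMSEQ_le) (auto intro!: less_imp_le)
  then have min: "f y \<le> f x" for x
    using m_le[of x] by simp
  show ?thesis
  proof (intro exI[of _ y] allI)
    fix v
    define d where "d = ip y v \<bullet> 1 - \<phi> v"
    have quad: "0 \<le> 2 * t * d + t\<^sup>2 * (norm v)\<^sup>2" for t
      using min[of "y + t *\<^sub>R v"] unfolding f_def d_def norm_add_sq \<phi>.add \<phi>.scaleR
      by (simp add: ip_scaleR_right power_mult_distrib algebra_simps)
    let ?s = "1 + (norm v)\<^sup>2"
    have s: "0 < ?s"
      by (simp add: add_pos_nonneg)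
    define t where "t = - d / ?s"
    have ts: "t * ?s = - d"
      using s by (simp add: t_def)
    have "0 \<le> ?s\<^sup>2 * (2 * t * d + t\<^sup>2 * (norm v)\<^sup>2)"
      using quad[of t] by simp
    also have "\<dots> = 2 * (t * ?s) * d * ?s + (t * ?s)\<^sup>2 * (norm v)\<^sup>2"
      by (simp add: power2_eq_square algebra_simps)
    also have "\<dots> = - (d\<^sup>2 * (2 + (norm v)\<^sup>2))"
      unfolding ts by (simp add: power2_eq_square algebra_simps)
    finally have "d\<^sup>2 * (2 + (norm v)\<^sup>2) \<le> 0"
      by simp
    then have "d = 0"
      by (smt (verit) mult_pos_pos zero_le_power2 zero_less_power2)
    then show "\<phi> v = ip v y \<bullet> 1"
      using inner_one_ip_sym[of v y] by (simp add: d_def)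
  qed
qed

lemma riesz_apply: "blinfun_apply (riesz ip y) x = ip y x"
proof -
  interpret bounded_bilinear ip
    by (rule bounded_bilinear_ip)
  show ?thesis
    unfolding riesz_def ip_conj[symmetric] by (simp add: bounded_linear_Blinfun_apply bounded_linear_right)
qed

lemma pr_riesz: "pr x (riesz ip y) = ip x y"
  by (simp add: pr_def riesz_apply flip: ip_conj)

lemma riesz_mem: "riesz ip y \<in> antidual scl"
  by (simp add: antidual_def riesz_apply ip_scl_right)

lemma riesz_add: "riesz ip (x + y) = riesz ip x + riesz ip y"
  by (rule blinfun_eqI) (simp add: riesz_apply plus_blinfun.rep_eq ip_add_left)

lemma riesz_scaleR: "riesz ip (r *\<^sub>R x) = r *\<^sub>R riesz ip x"
  by (rule blinfun_eqI) (simp add: riesz_apply scaleR_blinfun.rep_eq ip_scaleR_left)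

lemma norm_riesz [simp]: "norm (riesz ip y) = norm y"
proof (rule antisym)
  show "norm (riesz ip y) \<le> norm y"
    by (rule norm_blinfun_bound) (auto simp: riesz_apply norm_ip_le)
  have "norm (ip y y) \<le> norm (riesz ip y) * norm y"
    using norm_blinfun[of "riesz ip y" y] by (simp add: riesz_apply)
  then show "norm y \<le> norm (riesz ip y)"
    by (cases "y = 0") (auto simp: ip_norm power2_eq_square norm_mult)
qed

lemma bounded_linear_riesz: "bounded_linear (riesz ip)"
  by (rule bounded_linear_intro[of _ 1]) (simp_all add: riesz_add riesz_scaleR)

text \<open>
  The inverse of \<open>riesz ip\<close>, extended to a bounded real-linear map on all of the ambient type: it
  represents the real part of a functional. Composition with it turns operators that live on the
  antidual into operators on a whole type.
\<close>

definition rep :: "('h \<Rightarrow>\<^sub>L 'k) \<Rightarrow> 'h" where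
  "rep f = (SOME y. \<forall>x. blinfun_apply f x \<bullet> 1 = ip x y \<bullet> 1)"

lemma rep_inner: "ip x (rep f) \<bullet> 1 = blinfun_apply f x \<bullet> 1"
proof -
  have "bounded_linear (\<lambda>x. blinfun_apply f x \<bullet> 1)"
    by (rule bounded_linear_compose[OF bounded_linear_inner_left blinfun.bounded_linear_right])
  then show ?thesis
    unfolding rep_def using someI_ex[OF real_riesz_representation] by auto
qed

lemma rep_riesz [simp]: "rep (riesz ip y) = y"
  by (rule ip_eqI) (unfold rep_inner riesz_apply, rule inner_one_ip_sym)

text \<open>
  An antilinear functional that has real part zero vanishes: its value at \<open>scl (f x) x\<close> is
  \<open>\<bar>f x\<bar>\<^sup>2\<close>.
\<close>

lemma riesz_rep:
  assumes "f \<in> antidual scl"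
  shows "riesz ip (rep f) = f"
proof (rule blinfun_eqI)
  fix x
  define a where "a = blinfun_apply (riesz ip (rep f)) x - blinfun_apply f x"
  have *: "blinfun_apply (riesz ip (rep f)) y \<bullet> 1 = blinfun_apply f y \<bullet> 1" for y
    unfolding riesz_apply inner_one_ip_sym[of "rep f" y] by (rule rep_inner)
  have "kconj a * a = blinfun_apply (riesz ip (rep f)) (scl a x) - blinfun_apply f (scl a x)"
    using assms riesz_mem[of "rep f"] by (simp add: antidual_def right_diff_distrib flip: a_def)
      (simp add: a_def right_diff_distrib)
  then have "(kconj a * a) \<bullet> 1 = 0"
    using * by (simp add: inner_diff_left)
  then have "(norm a)\<^sup>2 = 0"
    unfolding kconj_mult_self inner_of_real_one .
  then show "blinfun_apply (riesz ip (rep f)) x = blinfun_apply f x"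
    by (simp add: a_def)
qed

lemma bounded_linear_rep: "bounded_linear rep"
proof (rule bounded_linear_intro[of _ 1])
  show "rep (f + g) = rep f + rep g" for f g
    by (rule ip_eqI) (simp add: rep_inner ip_add_right inner_add_left plus_blinfun.rep_eq)
  show "rep (r *\<^sub>R f) = r *\<^sub>R rep f" for r f
    by (rule ip_eqI) (simp add: rep_inner ip_scaleR_right scaleR_blinfun.rep_eq)
  show "norm (rep f) \<le> norm f * 1" for f
  proof -
    have "(norm (rep f))\<^sup>2 = blinfun_apply f (rep f) \<bullet> 1"
      by (simp only: inner_one_ip_self[symmetric] rep_inner)
    also have "\<dots> \<le> norm (blinfun_apply f (rep f))"
      using Cauchy_Schwarz_ineq2[of "blinfun_apply f (rep f)" 1] by (simp add: abs_le_iff)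
    also have "\<dots> \<le> norm f * norm (rep f)"
      by (rule norm_blinfun)
    finally have "norm (rep f) * norm (rep f) \<le> norm f * norm (rep f)"
      by (simp add: power2_eq_square)
    then show ?thesis
      by (cases "norm (rep f) = 0") auto
  qed
qed

lemma inj_riesz: "inj (riesz ip)"
  by (metis injI rep_riesz)

lemma antidual_eq_range: "antidual scl = range (riesz ip)"
proof (intro equalityI subsetI)
  fix f
  assume "f \<in> antidual scl"
  then show "f \<in> range (riesz ip)"
    by (metis rangeI riesz_rep)
qed (use riesz_mem in blast)

lemma inv_riesz: "f \<in> antidual scl \<Longrightarrow> inv (riesz ip) f = rep f"
  by (metis inj_riesz inv_f_f riesz_rep)

lemma norm_rep: "f \<in> antidual scl \<Longrightarrow> norm (rep f) = norm f"
  by (metis norm_riesz riesz_rep)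

lemma dscl_riesz: "dscl a (riesz ip y) = riesz ip (scl a y)"
proof (rule blinfun_eqI)
  interpret bounded_bilinear ip
    by (rule bounded_bilinear_ip)
  have "bounded_linear (\<lambda>x. a * ip y x)"
    by (rule bounded_linear_compose[OF bounded_linear_mult_right bounded_linear_right])
  then show "blinfun_apply (dscl a (riesz ip y)) x = blinfun_apply (riesz ip (scl a y)) x" for x
    by (simp add: dscl_def riesz_apply bounded_linear_Blinfun_apply ip_scl_left)
qed

end

section \<open>Integrals of vector-valued functions\<close>

text \<open>
  The Riemann sums of \<open>f\<close> and \<open>g\<close> differ at most by a Riemann sum of \<open>h\<close>, so the Cauchy criterion
  passes from \<open>g\<close> to \<open>f\<close>. Integrability of vector-valued functions is obtained in this way throughout,
  since their values need not lie in a separable space.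
\<close>

lemma integrable_on_of_approx:
  fixes f :: "'a::euclidean_space \<Rightarrow> 'b::banach"
  assumes "\<And>e. 0 < e \<Longrightarrow> \<exists>g h. g integrable_on cbox a b \<and> h integrable_on cbox a b \<and>
             (\<forall>x\<in>cbox a b. norm (f x - g x) \<le> h x) \<and> integral (cbox a b) h \<le> e"
  shows "f integrable_on cbox a b"
  unfolding integrable_Cauchy
proof (intro allI impI)
  fix e :: real
  assume "0 < e"
  then obtain g h where g: "g integrable_on cbox a b" and h: "h integrable_on cbox a b"
    and fg: "\<And>x. x \<in> cbox a b \<Longrightarrow> norm (f x - g x) \<le> h x" and he: "integral (cbox a b) h \<le> e / 8"
    using assms[of "e / 8"] by auto
  obtain \<gamma> where \<gamma>: "gauge \<gamma>"
    and \<gamma>g: "\<And>D1 D2. D1 tagged_division_of cbox a b \<Longrightarrow> \<gamma> fine D1 \<Longrightarrow>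
       D2 tagged_division_of cbox a b \<Longrightarrow> \<gamma> fine D2 \<Longrightarrow>
       norm ((\<Sum>(x,K)\<in>D1. measure lborel K *\<^sub>R g x) - (\<Sum>(x,K)\<in>D2. measure lborel K *\<^sub>R g x)) < e / 4"
    using g[unfolded integrable_Cauchy] \<open>0 < e\<close> by (metis zero_less_divide_iff zero_less_numeral)
  obtain \<delta> where \<delta>: "gauge \<delta>"
    and \<delta>h: "\<And>D. D tagged_division_of cbox a b \<Longrightarrow> \<delta> fine D \<Longrightarrow>
       norm ((\<Sum>(x,K)\<in>D. measure lborel K *\<^sub>R h x) - integral (cbox a b) h) < e / 8"
    using integrable_integral[OF h, unfolded has_integral] \<open>0 < e\<close>
    by (metis zero_less_divide_iff zero_less_numeral)
  have sums: "norm ((\<Sum>(x,K)\<in>D. measure lborel K *\<^sub>R f x) - (\<Sum>(x,K)\<in>D. measure lborel K *\<^sub>R g x)) \<le> e / 4"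
    if D: "D tagged_division_of cbox a b" and fine: "\<delta> fine D" for D
  proof -
    have "norm ((\<Sum>(x,K)\<in>D. measure lborel K *\<^sub>R f x) - (\<Sum>(x,K)\<in>D. measure lborel K *\<^sub>R g x))
      = norm (\<Sum>(x,K)\<in>D. measure lborel K *\<^sub>R (f x - g x))"
      by (simp add: sum_subtractf[symmetric] case_prod_unfold scaleR_diff_right)
    also have "\<dots> \<le> (\<Sum>(x,K)\<in>D. measure lborel K *\<^sub>R h x)"
    proof (rule sum_norm_le)
      fix p
      assume p: "p \<in> D"
      then obtain x K where "p = (x, K)" "(x, K) \<in> D"
        by (cases p) auto
      moreover from this have "x \<in> cbox a b"
        using D by (auto dest: tag_in_interval)
      ultimately show "norm (case p of (x, K) \<Rightarrow> measure lborel K *\<^sub>R (f x - g x)) \<le> (case p of (x, K) \<Rightarrow> measure lborel K *\<^sub>R h x)"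
        using fg by (auto intro: mult_left_mono)
    qed
    also have "\<dots> \<le> e / 8 + e / 8"
      using \<delta>h[OF D fine] he unfolding real_norm_def real_scaleR_def by linarith
    finally show ?thesis
      by simp
  qed
  show "\<exists>\<gamma>. gauge \<gamma> \<and> (\<forall>\<D>1 \<D>2. \<D>1 tagged_division_of cbox a b \<and> \<gamma> fine \<D>1 \<and>
            \<D>2 tagged_division_of cbox a b \<and> \<gamma> fine \<D>2 \<longrightarrow>
            norm ((\<Sum>(x,K)\<in>\<D>1. measure lborel K *\<^sub>R f x) - (\<Sum>(x,K)\<in>\<D>2. measure lborel K *\<^sub>R f x)) < e)"
  proof (intro exI conjI allI impI)
    show "gauge (\<lambda>x. \<gamma> x \<inter> \<delta> x)"
      using \<gamma> \<delta> by (rule gauge_Int)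
    fix D1 D2
    assume *: "D1 tagged_division_of cbox a b \<and> (\<lambda>x. \<gamma> x \<inter> \<delta> x) fine D1 \<and>
      D2 tagged_division_of cbox a b \<and> (\<lambda>x. \<gamma> x \<inter> \<delta> x) fine D2"
    then have "\<gamma> fine D1" "\<delta> fine D1" "\<gamma> fine D2" "\<delta> fine D2"
      by (auto simp: fine_Int)
    with * have
      "norm ((\<Sum>(x,K)\<in>D1. measure lborel K *\<^sub>R f x) - (\<Sum>(x,K)\<in>D1. measure lborel K *\<^sub>R g x)) \<le> e / 4"
      "norm ((\<Sum>(x,K)\<in>D2. measure lborel K *\<^sub>R f x) - (\<Sum>(x,K)\<in>D2. measure lborel K *\<^sub>R g x)) \<le> e / 4"
      "norm ((\<Sum>(x,K)\<in>D1. measure lborel K *\<^sub>R g x) - (\<Sum>(x,K)\<in>D2. measure lborel K *\<^sub>R g x)) < e / 4"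
      using sums \<gamma>g by auto
    then show "norm ((\<Sum>(x,K)\<in>D1. measure lborel K *\<^sub>R f x) - (\<Sum>(x,K)\<in>D2. measure lborel K *\<^sub>R f x)) < e"
      using \<open>0 < e\<close> by norm
  qed
qed

lemma integral_tendsto_of_approx:
  fixes f :: "real \<Rightarrow> 'b::banach"
  assumes F: "\<And>n. F n integrable_on {a..b}"
    and approx: "\<And>e. 0 < e \<Longrightarrow> \<forall>\<^sub>F n in sequentially. \<exists>h. h integrable_on {a..b} \<and>
             (\<forall>x\<in>{a..b}. norm (f x - F n x) \<le> h x) \<and> integral {a..b} h \<le> e"
  shows "f integrable_on {a..b}" "(\<lambda>n. integral {a..b} (F n)) \<longlonglongrightarrow> integral {a..b} f"
proof -
  show f: "f integrable_on {a..b}"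
    unfolding cbox_interval[symmetric]
  proof (rule integrable_on_of_approx)
    fix e :: real
    assume "0 < e"
    then obtain n where "\<exists>h. h integrable_on {a..b} \<and> (\<forall>x\<in>{a..b}. norm (f x - F n x) \<le> h x) \<and> integral {a..b} h \<le> e"
      using eventually_happens[OF approx[OF \<open>0 < e\<close>]] by auto
    then show "\<exists>g h. g integrable_on cbox a b \<and> h integrable_on cbox a b \<and>
             (\<forall>x\<in>cbox a b. norm (f x - g x) \<le> h x) \<and> integral (cbox a b) h \<le> e"
      using F[of n] unfolding cbox_interval by blast
  qed
  show "(\<lambda>n. integral {a..b} (F n)) \<longlonglongrightarrow> integral {a..b} f"
  proof (rule tendstoI)
    fix e :: real
    assume "0 < e"
    then have "0 < e / 2"
      by simp
    from approx[OF this] show "\<forall>\<^sub>F n in sequentially. dist (integral {a..b} (F n)) (integral {a..b} f) < e"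
    proof (rule eventually_mono)
      fix n
      assume "\<exists>h. h integrable_on {a..b} \<and> (\<forall>x\<in>{a..b}. norm (f x - F n x) \<le> h x) \<and> integral {a..b} h \<le> e / 2"
      then obtain h where h: "h integrable_on {a..b}" "\<And>x. x \<in> {a..b} \<Longrightarrow> norm (f x - F n x) \<le> h x"
        "integral {a..b} h \<le> e / 2"
        by blast
      have "norm (integral {a..b} (\<lambda>x. f x - F n x)) \<le> integral {a..b} h"
        using f F h by (intro integral_norm_bound_integral integrable_diff) auto
      then show "dist (integral {a..b} (F n)) (integral {a..b} f) < e"
        using h(3) \<open>0 < e\<close> f F by (simp add: dist_norm integral_diff norm_minus_commute)
    qed
  qed
qed

lemma integrable_on_dominated_real:
  fixes f h :: "real \<Rightarrow> real"
  assumes "f measurable_on {a..b}" "h integrable_on {a..b}" "\<And>x. x \<in> {a..b} \<Longrightarrow> \<bar>f x\<bar> \<le> h x"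
  shows "f integrable_on {a..b}"
  using assms by (intro measurable_bounded_by_integrable_imp_integrable_real[of f "{a..b}" h])
    (auto intro: measurable_on_imp_borel_measurable_lebesgue)

lemma dominated_convergence_negligible:
  fixes f :: "nat \<Rightarrow> real \<Rightarrow> real"
  assumes f: "\<And>k. f k integrable_on S" and h: "h integrable_on S"
    and le: "\<And>k x. x \<in> S - N \<Longrightarrow> \<bar>f k x\<bar> \<le> h x" and N: "negligible N"
    and conv: "\<And>x. x \<in> S - N \<Longrightarrow> (\<lambda>k. f k x) \<longlonglongrightarrow> g x"
  shows "g integrable_on S" "(\<lambda>k. integral S (f k)) \<longlonglongrightarrow> integral S g"
proof -
  define c where "c u x = (if x \<in> N then 0 else u x)" for u :: "real \<Rightarrow> real" and x
  have spike: "integral S (c u) = integral S u" "c u integrable_on S \<longleftrightarrow> u integrable_on S" for u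
  proof -
    show "integral S (c u) = integral S u"
      by (rule integral_spike[OF N]) (auto simp: c_def)
    show "c u integrable_on S \<longleftrightarrow> u integrable_on S"
      using integrable_spike[OF _ N, of "c u" S u] integrable_spike[OF _ N, of u S "c u"] by (auto simp: c_def)
  qed
  have *: "c g integrable_on S" "(\<lambda>k. integral S (c (f k))) \<longlonglongrightarrow> integral S (c g)"
    using dominated_convergence[of "\<lambda>k. c (f k)" S "c h" "c g"] f h le conv
    by (auto simp: spike) (auto simp: c_def)
  then show "g integrable_on S" "(\<lambda>k. integral S (f k)) \<longlonglongrightarrow> integral S g"
    by (simp_all add: spike)
qed

text \<open>
  The theorem of Beppo Levi for series.
\<close>

lemma summable_ae_of_integrals:
  fixes h :: "nat \<Rightarrow> real \<Rightarrow> real"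
  assumes int: "\<And>j. h j integrable_on {a..b}" and nonneg: "\<And>j x. 0 \<le> h j x"
    and sum: "summable (\<lambda>j. integral {a..b} (h j))"
  obtains N where "negligible N" "\<And>x. x \<in> {a..b} - N \<Longrightarrow> summable (\<lambda>j. h j x)"
    "(\<lambda>x. \<Sum>j. h j x) integrable_on {a..b}"
proof -
  let ?M = "lebesgue_on {a..b}"
  have L: "integrable ?M (h j)" for j
    using nonnegative_absolutely_integrable_1[OF int nonneg]
    by (simp add: integrable_restrict_space set_integrable_def)
  have eq: "integral\<^sup>L ?M (h j) = integral {a..b} (h j)" for j
    using L by (simp add: lebesgue_integral_eq_integral)
  have nn: "(\<integral>\<^sup>+x. ennreal (h j x) \<partial>?M) = ennreal (integral {a..b} (h j))" for j
    using nn_integral_eq_integral[OF L] nonneg by (simp add: eq)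
  have "(\<integral>\<^sup>+x. (\<Sum>j. ennreal (h j x)) \<partial>?M) = (\<Sum>j. ennreal (integral {a..b} (h j)))"
    using L by (subst nn_integral_suminf) (auto simp: nn)
  also have "\<dots> = ennreal (\<Sum>j. integral {a..b} (h j))"
    by (intro suminf_ennreal2 sum integral_nonneg int) (rule nonneg)
  finally have "(\<integral>\<^sup>+x. (\<Sum>j. ennreal (h j x)) \<partial>?M) \<noteq> \<infinity>"
    by simp
  then have "AE x in ?M. (\<Sum>j. ennreal (h j x)) \<noteq> \<infinity>"
    using L by (intro nn_integral_PInf_AE) auto
  then have ae: "AE x in ?M. summable (\<lambda>j. h j x)"
    by (rule AE_mp) (auto intro!: AE_I2 summable_suminf_not_top nonneg)
  have "integrable ?M (\<lambda>x. \<Sum>j. h j x)"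
    using L ae sum nonneg by (intro integrable_suminf) (simp_all add: eq)
  then have 1: "(\<lambda>x. \<Sum>j. h j x) integrable_on {a..b}"
    by (rule integrable_on_lebesgue_on) auto
  obtain N where "N \<in> null_sets ?M" "{x \<in> space ?M. \<not> summable (\<lambda>j. h j x)} \<subseteq> N"
    using ae unfolding eventually_ae_filter by blast
  moreover from this have "negligible N"
    by (simp add: negligible_iff_null_sets null_sets_restrict_space)
  ultimately show ?thesis
    using 1 by (intro that[of N]) auto
qed

lemma continuous_imp_measurable_on_interval:
  fixes f :: "real \<Rightarrow> 'b::real_normed_vector"
  assumes "continuous_on UNIV f"
  shows "f measurable_on {a..b}"
  using measurable_on_restrict[OF continuous_imp_measurable_on[OF assms], of "{a..b}"]
  unfolding measurable_on_UNIV by simp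

lemma measurable_on_norm: "f measurable_on S \<Longrightarrow> (\<lambda>t. norm (f t)) measurable_on S"
  using measurable_on_compose_continuous_0[of f S norm] by (simp add: o_def continuous_on_norm)

lemma measurable_on_norm_sq: "f measurable_on S \<Longrightarrow> (\<lambda>t. (norm (f t))\<^sup>2) measurable_on S"
  using measurable_on_compose_continuous_0[of f S "\<lambda>v. (norm v)\<^sup>2"] 
  by (simp add: o_def continuous_intros)

lemma norm_sq_add_le: "(norm (x + y))\<^sup>2 \<le> 2 * (norm x)\<^sup>2 + 2 * (norm y)\<^sup>2"
proof -
  have "(norm (x + y))\<^sup>2 \<le> (norm x + norm y)\<^sup>2"
    by (intro power_mono norm_triangle_ineq) simp
  also have "\<dots> \<le> 2 * (norm x)\<^sup>2 + 2 * (norm y)\<^sup>2"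
    using sum_squares_bound[of "norm x" "norm y"] by (simp add: power2_sum)
  finally show ?thesis .
qed

lemma norm_sq_diff_le: "(norm (x - y))\<^sup>2 \<le> 2 * (norm x)\<^sup>2 + 2 * (norm y)\<^sup>2"
  using norm_sq_add_le[of x "- y"] by simp

lemma L1_on_continuous: "continuous_on UNIV f \<Longrightarrow> L1_on {a..b} f"
  unfolding L1_on_def
  by (auto intro!: continuous_imp_measurable_on_interval integrable_continuous_interval
      intro: continuous_on_norm continuous_on_subset)

lemma L1_on_diff:
  assumes "L1_on {a..b} f" "L1_on {a..b} g"
  shows "L1_on {a..b} (\<lambda>t. f t - g t)"
  unfolding L1_on_def
proof
  show m: "(\<lambda>t. f t - g t) measurable_on {a..b}"
    using assms by (auto simp: L1_on_def intro: measurable_on_diff)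
  have "(\<lambda>t. norm (f t) + norm (g t)) integrable_on {a..b}"
    using assms by (auto simp: L1_on_def intro: integrable_add)
  then show "(\<lambda>t. norm (f t - g t)) integrable_on {a..b}"
    by (rule integrable_on_dominated_real[OF measurable_on_norm[OF m]]) (simp add: norm_triangle_ineq4)
qed

lemma L1_on_bounded_linear:
  assumes "bounded_linear T" "L1_on {a..b} f"
  shows "L1_on {a..b} (\<lambda>t. T (f t))"
  unfolding L1_on_def
proof
  interpret T: bounded_linear T
    by fact
  show m: "(\<lambda>t. T (f t)) measurable_on {a..b}"
    using measurable_on_compose_continuous_0[of f "{a..b}" T] assms
    by (simp add: o_def L1_on_def T.zero linear_continuous_on)
  obtain K where "\<And>x. norm (T x) \<le> norm x * K"
    using T.bounded by auto
  moreover have "(\<lambda>t. norm (f t) * K) integrable_on {a..b}"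
    using assms by (auto simp: L1_on_def intro: integrable_on_mult_left)
  ultimately show "(\<lambda>t. norm (T (f t))) integrable_on {a..b}"
    by (intro integrable_on_dominated_real[OF measurable_on_norm[OF m], of "\<lambda>t. norm (f t) * K"]) auto
qed

lemma L1_on_cong: "(\<And>t. t \<in> {a..b} \<Longrightarrow> f t = g t) \<Longrightarrow> L1_on {a..b} f \<Longrightarrow> L1_on {a..b} g"
proof -
  assume *: "\<And>t. t \<in> {a..b} \<Longrightarrow> f t = g t" and f: "L1_on {a..b} f"
  have "g measurable_on {a..b}"
    using measurable_on_spike[of f "{a..b}" "{}" g] f * by (simp add: L1_on_def)
  moreover have "(\<lambda>t. norm (g t)) integrable_on {a..b}"
    using integrable_eq[of "\<lambda>t. norm (f t)" "{a..b}"] f * by (simp add: L1_on_def)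
  ultimately show ?thesis
    by (simp add: L1_on_def)
qed

lemma L1_on_imp_integral_bound:
  assumes "L1_on {-\<tau>..\<tau>} g" "{a..b} \<subseteq> {-\<tau>..\<tau>}"
  shows "(\<lambda>r. norm (g r)) integrable_on {a..b}"
    "integral {a..b} (\<lambda>r. norm (g r)) \<le> integral {-\<tau>..\<tau>} (\<lambda>r. norm (g r))"
proof -
  have *: "(\<lambda>r. norm (g r)) integrable_on {-\<tau>..\<tau>}"
    using assms by (simp add: L1_on_def)
  show sub: "(\<lambda>r. norm (g r)) integrable_on {a..b}"
    by (rule integrable_on_subinterval[OF * assms(2)])
  show "integral {a..b} (\<lambda>r. norm (g r)) \<le> integral {-\<tau>..\<tau>} (\<lambda>r. norm (g r))"
    by (rule integral_subset_le[OF assms(2) sub *]) auto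
qed

text \<open>
  The radial truncation \<open>v \<mapsto> (R / max R \<parallel>v\<parallel>) v\<close> makes an almost everywhere convergent sequence of
  continuous functions dominated.
\<close>

lemma L1_on_approx:
  fixes f :: "real \<Rightarrow> 'b::banach"
  assumes f: "L1_on {a..b} f" and e: "0 < e"
  obtains c where "continuous_on UNIV c" "integral {a..b} (\<lambda>t. norm (f t - c t)) \<le> e"
proof -
  define \<rho> where "\<rho> R v = (R / max R (norm v)) *\<^sub>R v" for R and v :: 'b
  have fm: "f measurable_on {a..b}" and fi: "(\<lambda>t. norm (f t)) integrable_on {a..b}"
    using f by (auto simp: L1_on_def)
  obtain N F where N: "negligible N" and F: "\<And>n. continuous_on UNIV (F n)"
    and lim: "\<And>x. x \<notin> N \<Longrightarrow> (\<lambda>n. F n x) \<longlonglongrightarrow> (if x \<in> {a..b} then f x else 0)"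
    using fm unfolding measurable_on_def by blast
  have \<rho>_cont: "continuous_on UNIV (\<rho> R)" if "0 < R" for R
    using that unfolding \<rho>_def by (intro continuous_intros continuous_on_max) auto
  have \<rho>_norm: "norm (\<rho> R v) \<le> R" if "0 < R" for R v
    using that by (simp add: \<rho>_def max_def field_simps)
  have \<rho>_diff: "norm (v - \<rho> R v) = max 0 (norm v - R)" if "0 < R" for R v
  proof -
    have "v - \<rho> R v = (1 - R / max R (norm v)) *\<^sub>R v"
      by (simp add: \<rho>_def scaleR_diff_left)
    then have "norm (v - \<rho> R v) = \<bar>1 - R / max R (norm v)\<bar> * norm v"
      by simp
    then show ?thesis
      using that by (auto simp: max_def field_simps abs_if)
  qed
  have \<rho>m: "(\<lambda>t. \<rho> R (f t)) measurable_on {a..b}" if "0 < R" for R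
    using measurable_on_compose_continuous_0[OF fm \<rho>_cont[OF that]] by (simp add: o_def \<rho>_def)
  have \<rho>i: "(\<lambda>t. norm (f t - \<rho> R (f t))) integrable_on {a..b}" if "0 < R" for R
    using that
    by (intro integrable_on_dominated_real[OF _ fi] measurable_on_norm measurable_on_diff fm \<rho>m)
      (auto simp: \<rho>_diff)
  have "(\<lambda>k. integral {a..b} (\<lambda>t. norm (f t - \<rho> (real (Suc k)) (f t)))) \<longlonglongrightarrow> integral {a..b} (\<lambda>t. 0)"
  proof (rule dominated_convergence(2)[OF \<rho>i fi])
    fix x
    show "(\<lambda>k. norm (f x - \<rho> (real (Suc k)) (f x))) \<longlonglongrightarrow> 0"
    proof (rule tendsto_eventually)
      obtain k0 where "norm (f x) \<le> real k0"
        using real_arch_simple by blast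
      then have "norm (f x - \<rho> (real (Suc k)) (f x)) = 0" if "k0 \<le> k" for k
        using that unfolding \<rho>_diff[OF of_nat_0_less_iff[THEN iffD2, OF zero_less_Suc]] by simp
      then show "\<forall>\<^sub>F k in sequentially. norm (f x - \<rho> (real (Suc k)) (f x)) = 0"
        by (auto simp: eventually_sequentially)
    qed
  qed (auto simp: \<rho>_diff)
  then have "\<forall>\<^sub>F k in sequentially. integral {a..b} (\<lambda>t. norm (f t - \<rho> (real (Suc k)) (f t))) < e / 2"
    using e by (intro order_tendstoD(2)[where y = 0]) auto
  then obtain k where k: "integral {a..b} (\<lambda>t. norm (f t - \<rho> (real (Suc k)) (f t))) < e / 2"
    by (auto dest: eventually_happens)
  define R where "R = real (Suc k)"
  have R: "0 < R"
    by (simp add: R_def)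
  have cn: "continuous_on UNIV (\<lambda>t. \<rho> R (F n t))" for n
    using continuous_on_compose2[OF \<rho>_cont[OF R] F] by simp
  have di: "(\<lambda>t. norm (\<rho> R (f t) - \<rho> R (F n t))) integrable_on {a..b}" for n
  proof (rule integrable_on_dominated_real)
    show "(\<lambda>t. norm (\<rho> R (f t) - \<rho> R (F n t))) measurable_on {a..b}"
      by (intro measurable_on_norm measurable_on_diff \<rho>m R continuous_imp_measurable_on_interval cn)
    show "(\<lambda>t. 2 * R) integrable_on {a..b}"
      by (rule integrable_const_ivl)
    show "\<bar>norm (\<rho> R (f x) - \<rho> R (F n x))\<bar> \<le> 2 * R" for x
      using norm_triangle_ineq4[of "\<rho> R (f x)" "\<rho> R (F n x)"] \<rho>_norm[OF R, of "f x"] \<rho>_norm[OF R, of "F n x"]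
      by simp
  qed
  have "(\<lambda>n. integral {a..b} (\<lambda>t. norm (\<rho> R (f t) - \<rho> R (F n t)))) \<longlonglongrightarrow> integral {a..b} (\<lambda>t. 0)"
  proof (rule dominated_convergence_negligible(2)[OF di _ _ N])
    show "(\<lambda>t. 2 * R) integrable_on {a..b}"
      by (rule integrable_const_ivl)
    show "\<bar>norm (\<rho> R (f x) - \<rho> R (F n x))\<bar> \<le> 2 * R" for x n
      using norm_triangle_ineq4[of "\<rho> R (f x)" "\<rho> R (F n x)"] \<rho>_norm[OF R, of "f x"] \<rho>_norm[OF R, of "F n x"]
      by simp
    fix x
    assume "x \<in> {a..b} - N"
    then have "(\<lambda>n. F n x) \<longlonglongrightarrow> f x"
      using lim[of x] by simp
    then have "(\<lambda>n. \<rho> R (F n x)) \<longlonglongrightarrow> \<rho> R (f x)"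
      using \<rho>_cont[OF R] by (intro isCont_tendsto_compose[of "f x" "\<rho> R"]) (auto simp: continuous_on_eq_continuous_at)
    then have "(\<lambda>n. norm (\<rho> R (f x) - \<rho> R (F n x))) \<longlonglongrightarrow> norm (\<rho> R (f x) - \<rho> R (f x))"
      by (intro tendsto_intros)
    then show "(\<lambda>n. norm (\<rho> R (f x) - \<rho> R (F n x))) \<longlonglongrightarrow> 0"
      by simp
  qed
  then have "\<forall>\<^sub>F n in sequentially. integral {a..b} (\<lambda>t. norm (\<rho> R (f t) - \<rho> R (F n t))) < e / 2"
    using e by (intro order_tendstoD(2)[where y = 0]) auto
  then obtain n where n: "integral {a..b} (\<lambda>t. norm (\<rho> R (f t) - \<rho> R (F n t))) < e / 2"
    by (auto dest: eventually_happens)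
  have "integral {a..b} (\<lambda>t. norm (f t - \<rho> R (F n t)))
    \<le> integral {a..b} (\<lambda>t. norm (f t - \<rho> R (f t)) + norm (\<rho> R (f t) - \<rho> R (F n t)))"
  proof (rule integral_le)
    show "(\<lambda>t. norm (f t - \<rho> R (F n t))) integrable_on {a..b}"
      using L1_on_diff[OF f L1_on_continuous[OF cn]] by (simp add: L1_on_def)
    show "norm (f t - \<rho> R (F n t)) \<le> norm (f t - \<rho> R (f t)) + norm (\<rho> R (f t) - \<rho> R (F n t))" for t
      by norm
  qed (intro integrable_add \<rho>i R di)
  also have "\<dots> \<le> e"
    using k[folded R_def] n integral_add[OF \<rho>i[OF R] di[of n]] by linarith
  finally show ?thesis
    using that[OF cn] by blast
qed

lemma L2_on_continuous: "continuous_on UNIV f \<Longrightarrow> L2_on {a..b} f"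
  unfolding L2_on_def
  by (auto intro!: continuous_imp_measurable_on_interval integrable_continuous_interval
      intro: continuous_on_subset intro!: continuous_intros)

lemma L2_on_diff:
  assumes "L2_on {a..b} f" "L2_on {a..b} g"
  shows "L2_on {a..b} (\<lambda>t. f t - g t)"
  unfolding L2_on_def
proof
  show m: "(\<lambda>t. f t - g t) measurable_on {a..b}"
    using assms by (auto simp: L2_on_def intro: measurable_on_diff)
  have "(\<lambda>t. 2 * (norm (f t))\<^sup>2 + 2 * (norm (g t))\<^sup>2) integrable_on {a..b}"
    using assms by (auto simp: L2_on_def intro!: integrable_add integrable_on_mult_right)
  then show "(\<lambda>t. (norm (f t - g t))\<^sup>2) integrable_on {a..b}"
    by (rule integrable_on_dominated_real[OF measurable_on_norm_sq[OF m]]) (simp add: norm_sq_diff_le)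
qed

text \<open>
  A subsequence \<open>g\<close> with increments \<open>d j\<close> whose squared norms have integrals at most \<open>8\<^sup>-\<^sup>j\<close> converges
  almost everywhere, and by the Cauchy-Schwarz inequality \<open>\<Sum>j. 2\<^sup>j \<parallel>d j\<parallel>\<^sup>2\<close> dominates all squared
  distances from \<open>g 0\<close>. One limit serves all intervals, since the increments are measured on
  intervals that exhaust the line.
\<close>

lemma L2_loc_complete:
  fixes f :: "nat \<Rightarrow> real \<Rightarrow> 'y::banach"
  assumes cont: "\<And>n. continuous_on UNIV (f n)"
    and cauchy: "\<And>\<tau> e. 0 < \<tau> \<Longrightarrow> 0 < e \<Longrightarrow>
      \<exists>N. \<forall>m\<ge>N. \<forall>n\<ge>N. integral {-\<tau>..\<tau>} (\<lambda>t. (norm (f m t - f n t))\<^sup>2) \<le> e"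
    and Y: "closed Y" "\<And>n t. f n t \<in> Y"
  obtains z where "\<And>t. z t \<in> Y"
    "\<And>\<tau>. 0 < \<tau> \<Longrightarrow> L2_on {-\<tau>..\<tau>} z"
    "\<And>\<tau>. 0 < \<tau> \<Longrightarrow> (\<lambda>n. integral {-\<tau>..\<tau>} (\<lambda>t. (norm (f n t - z t))\<^sup>2)) \<longlonglongrightarrow> 0"
proof -
  have "\<exists>N. \<forall>m\<ge>N. \<forall>n\<ge>N. integral {-real (Suc j)..real (Suc j)} (\<lambda>t. (norm (f m t - f n t))\<^sup>2) \<le> (1 / 8) ^ j" for j
    by (rule cauchy) auto
  then obtain K where K: "\<And>j m n. K j \<le> m \<Longrightarrow> K j \<le> n \<Longrightarrow>
      integral {-real (Suc j)..real (Suc j)} (\<lambda>t. (norm (f m t - f n t))\<^sup>2) \<le> (1 / 8) ^ j"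
    by metis
  \<comment> \<open>The sum makes \<open>k\<close> monotone, and the summand \<open>j\<close> makes it unbounded.\<close>
  define k where "k j = j + (\<Sum>i\<le>j. K i)" for j
  have k_ge: "K j \<le> k j" "j \<le> k j" for j
    unfolding k_def by (auto intro: trans_le_add2 member_le_sum)
  have k_mono: "k j \<le> k (Suc j)" for j
    by (simp add: k_def)
  define g where "g j = f (k j)" for j
  define d where "d j t = g (Suc j) t - g j t" for j t
  define h where "h j t = 2 ^ j * (norm (d j t))\<^sup>2" for j t
  have g_cont: "continuous_on UNIV (g j)" and d_cont: "continuous_on UNIV (d j)" for j
    unfolding d_def[abs_def] g_def by (intro continuous_intros cont)+
  have h_cont: "continuous_on A (h j)" for A j
    unfolding h_def by (intro continuous_intros continuous_on_subset[OF d_cont]) auto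
  have h_int: "h j integrable_on {a..b}" for j a b
    by (intro integrable_continuous_interval h_cont)
  have h_nonneg: "0 \<le> h j t" for j t
    by (simp add: h_def)
  have g_sum: "g m t = g 0 t + (\<Sum>i<m. d i t)" for m t
    by (induction m) (simp_all add: d_def)
  have sq_le: "(norm (g m t - g 0 t))\<^sup>2 \<le> 2 * (\<Sum>j. h j t)" if "summable (\<lambda>j. h j t)" for m t
  proof -
    have "norm (g m t - g 0 t) \<le> (\<Sum>i<m. norm (d i t))"
      unfolding g_sum[of m] by (simp add: norm_sum)
    also have "\<dots> = (\<Sum>i<m. sqrt ((1 / 2) ^ i) * (sqrt (2 ^ i) * norm (d i t)))"
      by (intro sum.cong) (simp_all flip: mult.assoc real_sqrt_mult power_mult_distrib)
    finally have "(norm (g m t - g 0 t))\<^sup>2 \<le> (\<Sum>i<m. sqrt ((1 / 2) ^ i) * (sqrt (2 ^ i) * norm (d i t)))\<^sup>2"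
      by (intro power_mono) auto
    also have "\<dots> \<le> (\<Sum>i<m. (sqrt ((1 / 2) ^ i))\<^sup>2) * (\<Sum>i<m. (sqrt (2 ^ i) * norm (d i t))\<^sup>2)"
      by (rule Cauchy_Schwarz_ineq_sum)
    also have "\<dots> = (\<Sum>i<m. (1 / 2) ^ i) * (\<Sum>i<m. h i t)"
      by (simp add: h_def power_mult_distrib)
    also have "\<dots> \<le> 2 * (\<Sum>j. h j t)"
    proof (rule mult_mono)
      show "(\<Sum>i<m. (1 / 2) ^ i) \<le> (2::real)"
        using sum_le_suminf[OF summable_geometric, of "1 / 2 :: real" "{..<m}"] suminf_geometric[of "1 / 2 :: real"]
        by simp
      show "(\<Sum>i<m. h i t) \<le> (\<Sum>j. h j t)"
        by (rule sum_le_suminf[OF that]) (auto simp: h_nonneg)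
    qed (auto simp: h_nonneg intro!: sum_nonneg)
    finally show ?thesis .
  qed
  have ae: "\<exists>N. negligible N \<and> (\<forall>x\<in>{-real M..real M} - N. summable (\<lambda>j. h j x)) \<and>
    (\<lambda>x. \<Sum>j. h j x) integrable_on {-real M..real M}" for M
  proof -
    have "summable (\<lambda>j. integral {-real M..real M} (h j))"
    proof (rule summable_comparison_test_ev)
      show "summable (\<lambda>j. (1 / 4) ^ j :: real)"
        by (rule summable_geometric) simp
      show "\<forall>\<^sub>F j in sequentially. norm (integral {-real M..real M} (h j)) \<le> (1 / 4) ^ j"
        using eventually_ge_at_top[of M]
      proof eventually_elim
        fix j
        assume "M \<le> j"
        then have "integral {-real M..real M} (h j) \<le> integral {-real (Suc j)..real (Suc j)} (h j)"
          by (intro integral_subset_le h_int) (auto simp: h_nonneg)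
        also have "\<dots> = 2 ^ j * integral {-real (Suc j)..real (Suc j)} (\<lambda>t. (norm (f (k (Suc j)) t - f (k j) t))\<^sup>2)"
          unfolding h_def[abs_def] d_def g_def by (rule integral_mult_right)
        also have "\<dots> \<le> 2 ^ j * (1 / 8) ^ j"
          using k_ge(1)[of j] k_mono[of j] by (intro mult_left_mono K) auto
        also have "\<dots> = (1 / 4) ^ j"
          by (simp flip: power_mult_distrib)
        finally show "norm (integral {-real M..real M} (h j)) \<le> (1 / 4) ^ j"
          by (simp add: integral_nonneg h_int h_nonneg)
      qed
    qed
    from summable_ae_of_integrals[OF h_int h_nonneg this] show ?thesis
      by metis
  qed
  then obtain N where N: "\<And>M. negligible (N M)"
    "\<And>M x. x \<in> {-real M..real M} - N M \<Longrightarrow> summable (\<lambda>j. h j x)"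
    and Hint: "\<And>M. (\<lambda>x. \<Sum>j. h j x) integrable_on {-real M..real M}"
    by metis
  define NN where "NN = (\<Union>M. N M)"
  have NN: "negligible NN"
    unfolding NN_def by (rule negligible_countable_Union) (use N(1) in auto)
  have summ: "summable (\<lambda>j. h j x)" if "x \<notin> NN" for x
  proof -
    obtain M where "\<bar>x\<bar> \<le> real M"
      using real_arch_simple by blast
    then show ?thesis
      using N(2)[of x M] that by (auto simp: NN_def abs_le_iff)
  qed
  have conv: "convergent (\<lambda>j. g j x)" if "x \<notin> NN" for x
  proof -
    \<comment> \<open>If the increment exceeds \<open>2\<^sup>-\<^sup>j\<close>, then it is at most \<open>2\<^sup>j\<close> times its square.\<close>
    have "norm (d j x) \<le> (1 / 2) ^ j + h j x" for j
    proof (cases "norm (d j x) \<le> (1 / 2) ^ j")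
      case True
      then show ?thesis
        using h_nonneg[of j x] by simp
    next
      case False
      then have "1 * norm (d j x) \<le> (2 ^ j * norm (d j x)) * norm (d j x)"
        by (intro mult_right_mono) (simp_all add: power_one_over field_simps)
      then show ?thesis
        by (simp add: h_def power2_eq_square mult.assoc add_increasing)
    qed
    moreover have "summable (\<lambda>j. (1 / 2) ^ j + h j x)"
      using summable_add[OF summable_geometric[of "1 / 2 :: real"] summ[OF that]] by simp
    ultimately have "summable (\<lambda>j. norm (d j x))"
      using summable_comparison_test'[of "\<lambda>j. (1 / 2) ^ j + h j x" 0 "\<lambda>j. norm (d j x)"] by simp
    then have "convergent (\<lambda>m. \<Sum>i<m. d i x)"
      by (simp add: summable_norm_cancel flip: summable_iff_convergent)
    moreover have "(\<lambda>j. g j x) = (\<lambda>j. g 0 x + (\<Sum>i<j. d i x))"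
      by (rule ext, rule g_sum)
    ultimately show ?thesis
      by (simp only: convergent_add convergent_const)
  qed
  define z where "z x = (if x \<in> NN then g 0 x else lim (\<lambda>j. g j x))" for x
  have lim: "(\<lambda>j. g j x) \<longlonglongrightarrow> z x" if "x \<notin> NN" for x
    using conv[OF that] that by (simp add: z_def convergent_LIMSEQ_iff)
  have zY: "z t \<in> Y" for t
  proof (cases "t \<in> NN")
    case True
    then show ?thesis
      using Y by (simp add: z_def g_def)
  next
    case False
    then show ?thesis
      using closed_sequentially[OF Y(1) _ lim[OF False]] Y(2) by (simp add: g_def)
  qed
  have "z measurable_on UNIV"
    unfolding measurable_on_def by (intro exI[of _ NN] exI[of _ g]) (simp add: NN g_cont lim)
  then have zm: "z measurable_on {-\<tau>..\<tau>}" for \<tau>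
    using measurable_on_restrict[of z "{-\<tau>..\<tau>}"] unfolding measurable_on_UNIV by simp
  have H: "(\<lambda>x. \<Sum>j. h j x) integrable_on {-\<tau>..\<tau>}" for \<tau>
  proof -
    obtain M where "\<tau> \<le> real M"
      using real_arch_simple by blast
    then show ?thesis
      by (intro integrable_subinterval_real[OF Hint[of M]]) auto
  qed
  have zL2: "L2_on {-\<tau>..\<tau>} z" for \<tau>
    unfolding L2_on_def
  proof
    show "(\<lambda>t. (norm (z t))\<^sup>2) integrable_on {-\<tau>..\<tau>}"
    proof (rule dominated_convergence_negligible(1)[OF _ _ _ NN])
      show "(\<lambda>t. (norm (g j t))\<^sup>2) integrable_on {-\<tau>..\<tau>}" for j
        using L2_on_continuous[OF g_cont] by (simp add: L2_on_def)
      then show "(\<lambda>t. 2 * (2 * (\<Sum>j. h j t)) + 2 * (norm (g 0 t))\<^sup>2) integrable_on {-\<tau>..\<tau>}"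
        by (intro integrable_add integrable_on_mult_right H)
      fix x
      assume x: "x \<in> {-\<tau>..\<tau>} - NN"
      show "\<bar>(norm (g j x))\<^sup>2\<bar> \<le> 2 * (2 * (\<Sum>j. h j x)) + 2 * (norm (g 0 x))\<^sup>2" for j
        using norm_sq_add_le[of "g j x - g 0 x" "g 0 x"] sq_le[OF summ, of x j] x by simp
      show "(\<lambda>k. (norm (g k x))\<^sup>2) \<longlonglongrightarrow> (norm (z x))\<^sup>2"
        using lim x by (intro tendsto_intros) auto
    qed
  qed (rule zm)
  have int: "(\<lambda>t. (norm (f n t - z t))\<^sup>2) integrable_on {-\<tau>..\<tau>}" for n \<tau>
    using L2_on_diff[OF L2_on_continuous[OF cont] zL2] by (simp add: L2_on_def)
  have glim: "(\<lambda>j. integral {-\<tau>..\<tau>} (\<lambda>t. (norm (g j t - z t))\<^sup>2)) \<longlonglongrightarrow> integral {-\<tau>..\<tau>} (\<lambda>t. 0)" for \<tau>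
  proof (rule dominated_convergence_negligible(2)[OF _ _ _ NN])
    show "(\<lambda>t. (norm (g j t - z t))\<^sup>2) integrable_on {-\<tau>..\<tau>}" for j
      unfolding g_def by (rule int)
    show "(\<lambda>t. 8 * (\<Sum>j. h j t)) integrable_on {-\<tau>..\<tau>}"
      by (intro integrable_on_mult_right H)
    fix x
    assume x: "x \<in> {-\<tau>..\<tau>} - NN"
    then have "x \<notin> NN"
      by simp
    show "\<bar>(norm (g j x - z x))\<^sup>2\<bar> \<le> 8 * (\<Sum>j. h j x)" for j
    proof -
      have "(\<lambda>m. (norm (g m x - g 0 x))\<^sup>2) \<longlonglongrightarrow> (norm (z x - g 0 x))\<^sup>2"
        using lim[OF \<open>x \<notin> NN\<close>] by (intro tendsto_intros)
      then have "(norm (z x - g 0 x))\<^sup>2 \<le> 2 * (\<Sum>j. h j x)"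
        by (rule LIMSEQ_le_const2) (auto intro: sq_le summ[OF \<open>x \<notin> NN\<close>])
      then show ?thesis
        using norm_sq_diff_le[of "g j x - g 0 x" "z x - g 0 x"] sq_le[OF summ[OF \<open>x \<notin> NN\<close>], of j] by simp
    qed
    have "(\<lambda>j. (norm (g j x - z x))\<^sup>2) \<longlonglongrightarrow> (norm (z x - z x))\<^sup>2"
      using lim[OF \<open>x \<notin> NN\<close>] by (intro tendsto_intros)
    then show "(\<lambda>j. (norm (g j x - z x))\<^sup>2) \<longlonglongrightarrow> 0"
      by simp
  qed
  have "(\<lambda>n. integral {-\<tau>..\<tau>} (\<lambda>t. (norm (f n t - z t))\<^sup>2)) \<longlonglongrightarrow> 0" if \<tau>: "0 < \<tau>" for \<tau>
  proof (rule LIMSEQ_I)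
    fix e :: real
    assume "0 < e"
    then obtain N0 where N0: "\<And>m n. N0 \<le> m \<Longrightarrow> N0 \<le> n \<Longrightarrow>
        integral {-\<tau>..\<tau>} (\<lambda>t. (norm (f m t - f n t))\<^sup>2) \<le> e / 8"
      using cauchy[OF \<tau>, of "e / 8"] by auto
    have "\<forall>\<^sub>F j in sequentially. integral {-\<tau>..\<tau>} (\<lambda>t. (norm (g j t - z t))\<^sup>2) < e / 8"
      using glim[of \<tau>] \<open>0 < e\<close> by (intro order_tendstoD(2)[where y = 0]) auto
    then have "\<forall>\<^sub>F j in sequentially. N0 \<le> j \<and> integral {-\<tau>..\<tau>} (\<lambda>t. (norm (g j t - z t))\<^sup>2) < e / 8"
      by (intro eventually_conj eventually_ge_at_top)
    then obtain j where j: "N0 \<le> j" "integral {-\<tau>..\<tau>} (\<lambda>t. (norm (g j t - z t))\<^sup>2) < e / 8"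
      by (auto dest: eventually_happens)
    have "norm (integral {-\<tau>..\<tau>} (\<lambda>t. (norm (f n t - z t))\<^sup>2) - 0) < e" if "N0 \<le> n" for n
    proof -
      have i1: "(\<lambda>t. 2 * (norm (f n t - g j t))\<^sup>2) integrable_on {-\<tau>..\<tau>}"
        using L2_on_diff[OF L2_on_continuous[OF cont] L2_on_continuous[OF g_cont], of "-\<tau>" \<tau> n j]
        by (intro integrable_on_mult_right) (simp add: L2_on_def)
      have i2: "(\<lambda>t. 2 * (norm (g j t - z t))\<^sup>2) integrable_on {-\<tau>..\<tau>}"
        unfolding g_def by (intro integrable_on_mult_right int)
      have "integral {-\<tau>..\<tau>} (\<lambda>t. (norm (f n t - z t))\<^sup>2)
        \<le> integral {-\<tau>..\<tau>} (\<lambda>t. 2 * (norm (f n t - g j t))\<^sup>2 + 2 * (norm (g j t - z t))\<^sup>2)"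
      proof (rule integral_le[OF int integrable_add[OF i1 i2]])
        show "(norm (f n t - z t))\<^sup>2 \<le> 2 * (norm (f n t - g j t))\<^sup>2 + 2 * (norm (g j t - z t))\<^sup>2" for t
          using norm_sq_add_le[of "f n t - g j t" "g j t - z t"] by simp
      qed
      also have "\<dots> = 2 * integral {-\<tau>..\<tau>} (\<lambda>t. (norm (f n t - g j t))\<^sup>2)
        + 2 * integral {-\<tau>..\<tau>} (\<lambda>t. (norm (g j t - z t))\<^sup>2)"
        by (simp add: integral_add[OF i1 i2])
      also have "\<dots> < e"
        using N0[OF that, of "k j"] k_ge(2)[of j] j \<open>0 < e\<close> by (simp add: g_def)
      finally show ?thesis
        using integral_nonneg[OF int, of \<tau> n] by simp
    qed
    then show "\<exists>no. \<forall>n\<ge>no. norm (integral {-\<tau>..\<tau>} (\<lambda>t. (norm (f n t - z t))\<^sup>2) - 0) < e"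
      by blast
  qed
  then show ?thesis
    by (intro that[of z] zY zL2)
qed

text \<open>
  By Young's inequality the error is dominated by multiples of squared norms whose integrals are known
  to exist, so that the product inherits its integrability from the continuous approximations.
\<close>

lemma integral_bilinear_tendsto:
  fixes \<beta> :: "'y1::banach \<Rightarrow> 'y2::banach \<Rightarrow> 'c::banach" and a b :: real
  assumes "bounded_bilinear \<beta>"
    and w: "continuous_on {a..b} w"
    and F: "\<And>n. continuous_on {a..b} (F n)" and G: "\<And>n. continuous_on {a..b} (G n)"
    and z1: "(\<lambda>t. (norm (z1 t))\<^sup>2) integrable_on {a..b}" and z2: "(\<lambda>t. (norm (z2 t))\<^sup>2) integrable_on {a..b}"
    and Fi: "\<And>n. (\<lambda>t. (norm (F n t - z1 t))\<^sup>2) integrable_on {a..b}"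
    and Gi: "\<And>n. (\<lambda>t. (norm (G n t - z2 t))\<^sup>2) integrable_on {a..b}"
    and Fl: "(\<lambda>n. integral {a..b} (\<lambda>t. (norm (F n t - z1 t))\<^sup>2)) \<longlonglongrightarrow> 0"
    and Gl: "(\<lambda>n. integral {a..b} (\<lambda>t. (norm (G n t - z2 t))\<^sup>2)) \<longlonglongrightarrow> 0"
  shows "(\<lambda>t. w t *\<^sub>R \<beta> (z1 t) (z2 t)) integrable_on {a..b}"
    "(\<lambda>n. integral {a..b} (\<lambda>t. w t *\<^sub>R \<beta> (F n t) (G n t))) \<longlonglongrightarrow> integral {a..b} (\<lambda>t. w t *\<^sub>R \<beta> (z1 t) (z2 t))"
proof -
  interpret \<beta>: bounded_bilinear \<beta>
    by fact
  obtain K where K: "0 < K" "\<And>u v. norm (\<beta> u v) \<le> norm u * norm v * K"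
    using \<beta>.pos_bounded by blast
  obtain W where W: "0 < W" "\<And>t. t \<in> {a..b} \<Longrightarrow> \<bar>w t\<bar> \<le> W"
    using compact_imp_bounded[OF compact_continuous_image[OF w]]
    by (auto simp: bounded_pos)
  define Q where "Q = W * K"
  have Q: "0 < Q"
    using W K by (simp add: Q_def)
  define p where "p n = integral {a..b} (\<lambda>t. (norm (F n t - z1 t))\<^sup>2) + integral {a..b} (\<lambda>t. (norm (G n t - z2 t))\<^sup>2)" for n
  define Z where "Z = integral {a..b} (\<lambda>t. (norm (z1 t))\<^sup>2) + integral {a..b} (\<lambda>t. (norm (z2 t))\<^sup>2)"
  have Z: "0 \<le> Z"
    unfolding Z_def by (intro add_nonneg_nonneg integral_nonneg z1 z2) auto
  have young: "u * v \<le> u\<^sup>2 / \<delta> + \<delta> * v\<^sup>2" if "0 < \<delta>" for u v \<delta> :: real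
  proof -
    have "0 \<le> (u - \<delta> * v)\<^sup>2 / \<delta>"
      using that by simp
    also have "\<dots> = u\<^sup>2 / \<delta> - 2 * (u * v) + \<delta> * v\<^sup>2"
      using that by (simp add: power2_eq_square field_simps)
    finally have "2 * (u * v) \<le> u\<^sup>2 / \<delta> + \<delta> * v\<^sup>2"
      by simp
    moreover have "0 \<le> u\<^sup>2 / \<delta> + \<delta> * v\<^sup>2"
      using that by simp
    ultimately show ?thesis
      by linarith
  qed
  have approx: "\<forall>\<^sub>F n in sequentially. \<exists>h. h integrable_on {a..b} \<and>
     (\<forall>t\<in>{a..b}. norm (w t *\<^sub>R \<beta> (z1 t) (z2 t) - w t *\<^sub>R \<beta> (F n t) (G n t)) \<le> h t) \<and> integral {a..b} h \<le> e"
    if e: "0 < e" for e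
  proof -
    define \<delta> where "\<delta> = e / (2 * Q * (Z + 1))"
    have \<delta>: "0 < \<delta>"
      using e Q Z by (simp add: \<delta>_def)
    have \<delta>Z: "Q * (\<delta> * Z) \<le> e / 2"
    proof -
      have "Q * (\<delta> * Z) = e / 2 * (Z / (Z + 1))"
        using Q by (simp add: \<delta>_def)
      also have "\<dots> \<le> e / 2 * 1"
        using Z e by (intro mult_left_mono) auto
      finally show ?thesis
        by simp
    qed
    have "(\<lambda>n. Q * ((1 / \<delta> + 1) * p n)) \<longlonglongrightarrow> Q * ((1 / \<delta> + 1) * (0 + 0))"
      unfolding p_def by (intro tendsto_intros Fl Gl)
    then have "\<forall>\<^sub>F n in sequentially. Q * ((1 / \<delta> + 1) * p n) < e / 2"
      using e by (intro order_tendstoD(2)) auto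
    then show ?thesis
    proof eventually_elim
      fix n
      assume n: "Q * ((1 / \<delta> + 1) * p n) < e / 2"
      define h where "h t = Q * ((1 / \<delta> + 1) * ((norm (F n t - z1 t))\<^sup>2 + (norm (G n t - z2 t))\<^sup>2)
        + \<delta> * ((norm (z1 t))\<^sup>2 + (norm (z2 t))\<^sup>2))" for t
      have "(h has_integral Q * ((1 / \<delta> + 1) * p n + \<delta> * Z)) {a..b}"
        unfolding h_def p_def Z_def
        by (intro has_integral_mult_right has_integral_add integrable_integral z1 z2 Fi Gi)
      then have "h integrable_on {a..b}" "integral {a..b} h = Q * ((1 / \<delta> + 1) * p n + \<delta> * Z)"
        by (auto simp: has_integral_integrable_integral)
      moreover have "Q * ((1 / \<delta> + 1) * p n + \<delta> * Z) \<le> e"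
        using n \<delta>Z unfolding distrib_left[of Q] by linarith
      moreover have "norm (w t *\<^sub>R \<beta> (z1 t) (z2 t) - w t *\<^sub>R \<beta> (F n t) (G n t)) \<le> h t" if t: "t \<in> {a..b}" for t
      proof -
        let ?u = "F n t - z1 t" and ?v = "G n t - z2 t"
        have "\<beta> (z1 t) (z2 t) - \<beta> (F n t) (G n t) = - (\<beta> ?u (z2 t) + \<beta> (z1 t) ?v + \<beta> ?u ?v)"
          by (simp add: \<beta>.diff_left \<beta>.diff_right)
        then have "norm (\<beta> (z1 t) (z2 t) - \<beta> (F n t) (G n t))
          \<le> norm (\<beta> ?u (z2 t)) + norm (\<beta> (z1 t) ?v) + norm (\<beta> ?u ?v)"
          by (simp only: norm_minus_cancel) (rule norm_triangle_le, rule add_right_mono, rule norm_triangle_ineq)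
        also have "\<dots> \<le> norm ?u * norm (z2 t) * K + norm (z1 t) * norm ?v * K + norm ?u * norm ?v * K"
          by (intro add_mono K)
        also have "\<dots> = K * (norm ?u * norm (z2 t) + norm ?v * norm (z1 t) + norm ?u * norm ?v)"
          by (simp add: algebra_simps)
        also have "\<dots> \<le> K * ((1 / \<delta> + 1) * ((norm ?u)\<^sup>2 + (norm ?v)\<^sup>2) + \<delta> * ((norm (z1 t))\<^sup>2 + (norm (z2 t))\<^sup>2))"
          using young[OF \<delta>, of "norm ?u" "norm (z2 t)"] young[OF \<delta>, of "norm ?v" "norm (z1 t)"]
            young[of 1 "norm ?u" "norm ?v"] K(1)
          by (intro mult_left_mono) (simp_all add: algebra_simps)
        finally have *: "norm (\<beta> (z1 t) (z2 t) - \<beta> (F n t) (G n t)) \<le> K * ((1 / \<delta> + 1) * ((norm ?u)\<^sup>2 + (norm ?v)\<^sup>2) + \<delta> * ((norm (z1 t))\<^sup>2 + (norm (z2 t))\<^sup>2))" .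
        have "norm (w t *\<^sub>R \<beta> (z1 t) (z2 t) - w t *\<^sub>R \<beta> (F n t) (G n t))
          = \<bar>w t\<bar> * norm (\<beta> (z1 t) (z2 t) - \<beta> (F n t) (G n t))"
          by (simp flip: scaleR_diff_right)
        also have "\<dots> \<le> W * (K * ((1 / \<delta> + 1) * ((norm ?u)\<^sup>2 + (norm ?v)\<^sup>2) + \<delta> * ((norm (z1 t))\<^sup>2 + (norm (z2 t))\<^sup>2)))"
          using W t * by (intro mult_mono) auto
        finally show ?thesis
          by (simp add: h_def Q_def mult.assoc)
      qed
      ultimately show "\<exists>h. h integrable_on {a..b} \<and>
         (\<forall>t\<in>{a..b}. norm (w t *\<^sub>R \<beta> (z1 t) (z2 t) - w t *\<^sub>R \<beta> (F n t) (G n t)) \<le> h t) \<and> integral {a..b} h \<le> e"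
        by auto
    qed
  qed
  have int: "(\<lambda>t. w t *\<^sub>R \<beta> (F n t) (G n t)) integrable_on {a..b}" for n
    by (intro integrable_continuous_interval continuous_on_scaleR w \<beta>.continuous_on F G)
  show "(\<lambda>t. w t *\<^sub>R \<beta> (z1 t) (z2 t)) integrable_on {a..b}"
    "(\<lambda>n. integral {a..b} (\<lambda>t. w t *\<^sub>R \<beta> (F n t) (G n t))) \<longlonglongrightarrow> integral {a..b} (\<lambda>t. w t *\<^sub>R \<beta> (z1 t) (z2 t))"
    using integral_tendsto_of_approx[OF int approx] by blast+
qed

lemma L2_tendsto_subinterval:
  fixes f :: "nat \<Rightarrow> real \<Rightarrow> 'z::banach"
  assumes f: "\<And>n. continuous_on UNIV (f n)" and z: "L2_on {-\<tau>..\<tau>} z"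
    and lim: "(\<lambda>n. integral {-\<tau>..\<tau>} (\<lambda>t. (norm (f n t - z t))\<^sup>2)) \<longlonglongrightarrow> 0"
    and sub: "{u + s..v + s} \<subseteq> {-\<tau>..\<tau>}"
  shows "(\<lambda>t. (norm (z (s + t)))\<^sup>2) integrable_on {u..v}"
    "\<And>n. (\<lambda>t. (norm (f n (s + t) - z (s + t)))\<^sup>2) integrable_on {u..v}"
    "(\<lambda>n. integral {u..v} (\<lambda>t. (norm (f n (s + t) - z (s + t)))\<^sup>2)) \<longlonglongrightarrow> 0"
proof -
  have shift: "(\<lambda>t. h (s + t)) integrable_on {u..v} \<longleftrightarrow> h integrable_on {u + s..v + s}"
    "integral {u..v} (\<lambda>t. h (s + t)) = integral {u + s..v + s} h" for h :: "real \<Rightarrow> real"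
    using integrable_on_shift_Icc_real[of h s u v] integral_shift_Icc_real[of u v h s] by (simp_all add: o_def)
  have i: "(\<lambda>t. (norm (f n t - z t))\<^sup>2) integrable_on {-\<tau>..\<tau>}" for n
    using L2_on_diff[OF L2_on_continuous[OF f] z] by (simp add: L2_on_def)
  show "(\<lambda>t. (norm (z (s + t)))\<^sup>2) integrable_on {u..v}"
    using integrable_on_subinterval[OF conjunct2[OF z[unfolded L2_on_def]] sub]
    by (simp add: shift(1)[of "\<lambda>t. (norm (z t))\<^sup>2"])
  show i': "(\<lambda>t. (norm (f n (s + t) - z (s + t)))\<^sup>2) integrable_on {u..v}" for n
    using integrable_on_subinterval[OF i sub] by (simp add: shift(1)[of "\<lambda>t. (norm (f n t - z t))\<^sup>2"])
  show "(\<lambda>n. integral {u..v} (\<lambda>t. (norm (f n (s + t) - z (s + t)))\<^sup>2)) \<longlonglongrightarrow> 0"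
  proof (rule Lim_null_comparison[OF _ lim], rule always_eventually, rule allI)
    fix n
    have "integral {u + s..v + s} (\<lambda>t. (norm (f n t - z t))\<^sup>2) \<le> integral {-\<tau>..\<tau>} (\<lambda>t. (norm (f n t - z t))\<^sup>2)"
      by (intro integral_subset_le sub i integrable_on_subinterval[OF i sub]) auto
    then show "norm (integral {u..v} (\<lambda>t. (norm (f n (s + t) - z (s + t)))\<^sup>2)) \<le> integral {-\<tau>..\<tau>} (\<lambda>t. (norm (f n t - z t))\<^sup>2)"
      using integral_nonneg[OF i'[of n]] by (simp add: shift(2)[of "\<lambda>t. (norm (f n t - z t))\<^sup>2"])
  qed
qed

section \<open>Oriented integrals\<close>

lemma has_vector_derivative_iff_quotient:
  "(f has_vector_derivative d) (at t) \<longleftrightarrow> ((\<lambda>h. (f (t + h) - f t) /\<^sub>R h) \<longlongrightarrow> d) (at 0)"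
proof -
  have "((\<lambda>h. (f (t + h) - f t) /\<^sub>R h) \<longlongrightarrow> d) (at 0) \<longleftrightarrow>
    ((\<lambda>h. norm ((f (t + h) - f t) /\<^sub>R h - d)) \<longlongrightarrow> 0) (at 0)"
    using LIM_zero_iff[of "\<lambda>h. (f (t + h) - f t) /\<^sub>R h" d "at 0"] by (simp add: tendsto_norm_zero_iff)
  also have "\<dots> \<longleftrightarrow> ((\<lambda>h. norm (f (t + h) - f t - h *\<^sub>R d) / norm h) \<longlongrightarrow> 0) (at 0)"
  proof (rule filterlim_cong)
    show "\<forall>\<^sub>F h in at 0. norm ((f (t + h) - f t) /\<^sub>R h - d) = norm (f (t + h) - f t - h *\<^sub>R d) / norm h"
      unfolding eventually_at_filter
    proof (intro always_eventually allI impI)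
      fix h :: real
      assume "h \<noteq> 0"
      then have "(f (t + h) - f t) /\<^sub>R h - d = (f (t + h) - f t - h *\<^sub>R d) /\<^sub>R h"
        by (simp add: scaleR_diff_right)
      then show "norm ((f (t + h) - f t) /\<^sub>R h - d) = norm (f (t + h) - f t - h *\<^sub>R d) / norm h"
        by (simp add: divide_inverse_commute)
    qed
  qed simp_all
  also have "\<dots> \<longleftrightarrow> (f has_vector_derivative d) (at t)"
    by (simp add: has_vector_derivative_def has_derivative_at bounded_linear_scaleR_left)
  finally show ?thesis ..
qed

lemma has_vector_derivative_shift:
  assumes "(P has_vector_derivative d) (at (s + t))"
  shows "((\<lambda>s. P (s + t)) has_vector_derivative d) (at s)"
  using assms unfolding has_vector_derivative_iff_quotient by (simp add: ac_simps)

lemma has_vector_derivative_reflect: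
  assumes "(P has_vector_derivative d) (at (c - s))"
  shows "((\<lambda>s. P (c - s)) has_vector_derivative - d) (at s)"
proof -
  have "((\<lambda>s. c - s) has_vector_derivative 0 - 1) (at s)"
    by (intro has_vector_derivative_diff has_vector_derivative_const has_vector_derivative_id)
  then show ?thesis
    using vector_diff_chain_at[of "\<lambda>s. c - s" "0 - 1" s P d] assms by (simp add: o_def)
qed

lemma min_max_subset: "t \<in> {-\<tau>..\<tau>} \<Longrightarrow> {min 0 t..max 0 t} \<subseteq> {-\<tau>..\<tau>::real}"
  by (auto simp: min_def max_def split: if_splits)

lemma integral_interval_ftc:
  fixes P :: "real \<Rightarrow> 'x::banach"
  assumes P: "\<And>t. (P has_vector_derivative f t) (at t)" and "a \<le> b"
  shows "integral {a..b} f = P b - P a"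
  using fundamental_theorem_of_calculus[of a b P f] assms
  by (auto intro: integral_unique has_vector_derivative_at_within)

lemma oriented_integral_ftc:
  fixes P :: "real \<Rightarrow> 'x::banach"
  assumes P: "\<And>t. (P has_vector_derivative f t) (at t)"
  shows "oriented_integral a b f = P b - P a"
  using integral_interval_ftc[OF P, of a b] integral_interval_ftc[OF P, of b a]
  by (simp add: oriented_integral_def)

lemma oriented_integral_has_vector_derivative:
  fixes f :: "real \<Rightarrow> 'x::banach"
  assumes f: "continuous_on UNIV f"
  shows "((\<lambda>t. oriented_integral 0 t f) has_vector_derivative f t) (at t)"
proof -
  define c where "c = min 0 t - 1"
  define J where "J s = integral {c..s} f" for s
  have int: "f integrable_on {u..v}" for u v
    by (intro integrable_continuous_interval continuous_on_subset[OF f]) auto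
  have eq: "oriented_integral 0 s f = J s - J 0" if "c \<le> s" for s
  proof (cases "0 \<le> s")
    case True
    have "J s = J 0 + integral {0..s} f"
      unfolding J_def by (rule Henstock_Kurzweil_Integration.integral_combine[symmetric]) (use True c_def int in auto)
    then show ?thesis
      using True by (simp add: oriented_integral_def)
  next
    case False
    have "J 0 = J s + integral {s..0} f"
      unfolding J_def by (rule Henstock_Kurzweil_Integration.integral_combine[symmetric]) (use False that int in auto)
    then show ?thesis
      using False by (simp add: oriented_integral_def)
  qed
  have "(J has_vector_derivative f t) (at t within {c..t + 1})"
    unfolding J_def
    by (rule integral_has_vector_derivative) (auto intro: continuous_on_subset[OF f] simp: c_def)
  then have "(J has_vector_derivative f t) (at t)"
    using at_within_interior[of t "{c..t+1}"] by (simp add: c_def)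
  then have "((\<lambda>s. J s - J 0) has_vector_derivative f t - 0) (at t)"
    by (intro has_vector_derivative_diff has_vector_derivative_const)
  then have "((\<lambda>s. J s - J 0) has_vector_derivative f t) (at t)"
    by simp
  then show ?thesis
    by (rule has_vector_derivative_transform_within_open[of _ _ _ "{c<..}"]) (auto simp: eq c_def)
qed

lemma oriented_integral_cong:
  "(\<And>t. t \<in> {min a b..max a b} \<Longrightarrow> f t = g t) \<Longrightarrow> oriented_integral a b f = oriented_integral a b g"
  unfolding oriented_integral_def by (auto intro!: integral_cong)

lemma oriented_integral_linear:
  assumes "bounded_linear T" "f integrable_on {min a b..max a b}"
  shows "oriented_integral a b (\<lambda>t. T (f t)) = T (oriented_integral a b f)"
  using integral_linear[OF assms(2,1)] linear_neg[OF bounded_linear.linear[OF assms(1)]]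
  by (auto simp: oriented_integral_def o_def min_def max_def split: if_splits)

lemma norm_oriented_integral_le:
  assumes "f integrable_on {min a b..max a b}" "h integrable_on {min a b..max a b}"
    "\<And>t. t \<in> {min a b..max a b} \<Longrightarrow> norm (f t) \<le> h t"
  shows "norm (oriented_integral a b f) \<le> integral {min a b..max a b} h"
  using integral_norm_bound_integral[OF assms]
  by (auto simp: oriented_integral_def min_def max_def split: if_splits)

lemma oriented_integral_diff:
  assumes "f integrable_on {min a b..max a b}" "g integrable_on {min a b..max a b}"
  shows "oriented_integral a b (\<lambda>t. f t - g t) = oriented_integral a b f - oriented_integral a b g"
  using integral_diff[OF assms]
  by (auto simp: oriented_integral_def min_def max_def split: if_splits)

lemma oriented_integral_add:
  assumes "f integrable_on {min a b..max a b}" "g integrable_on {min a b..max a b}"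
  shows "oriented_integral a b (\<lambda>t. f t + g t) = oriented_integral a b f + oriented_integral a b g"
  using integral_add[OF assms]
  by (auto simp: oriented_integral_def min_def max_def split: if_splits)

section \<open>Strongly continuous groups on a Banach space\<close>

text \<open>
  The Banach-Steinhaus theorem: by Baire's theorem one of the closed sets \<open>S n\<close> contains a ball.
\<close>

lemma uniform_boundedness:
  fixes T :: "'i \<Rightarrow> 'x::banach \<Rightarrow> 'y::real_normed_vector"
  assumes lin: "\<And>i. i \<in> I \<Longrightarrow> bounded_linear (T i)"
    and pointwise: "\<And>x. \<exists>c. \<forall>i\<in>I. norm (T i x) \<le> c"
  shows "\<exists>M>0. \<forall>i\<in>I. \<forall>x. norm (T i x) \<le> M * norm x"
proof -
  define S where "S n = {x. \<forall>i\<in>I. norm (T i x) \<le> real n}" for n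
  have clo: "closed (S n)" for n
  proof -
    have "S n = (\<Inter>i\<in>I. {x. norm (T i x) \<le> real n})"
      by (auto simp: S_def)
    moreover have "closed {x. norm (T i x) \<le> real n}" if "i \<in> I" for i
      by (rule closed_Collect_le[OF continuous_on_norm[OF linear_continuous_on[OF lin[OF that]]] continuous_on_const])
    ultimately show ?thesis
      by auto
  qed
  have cover: "(\<Union>n. S n) = UNIV"
  proof -
    have "\<exists>n. x \<in> S n" for x
    proof -
      obtain c where c: "\<forall>i\<in>I. norm (T i x) \<le> c"
        using pointwise by blast
      obtain n where "c \<le> real n"
        using real_arch_simple by blast
      then show ?thesis
        using c by (auto simp: S_def intro!: exI[of _ n] intro: order_trans)
    qed
    then show ?thesis
      by blast
  qed
  have "\<exists>n. interior (S n) \<noteq> {}"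
  proof (rule ccontr)
    assume "\<not> ?thesis"
    then have "euclidean interior_of \<Union> (range S) = ({} :: 'x set)"
      by (intro Baire_category_alt) (auto simp: completely_metrizable_space_euclidean clo)
    then show False
      using cover by simp
  qed
  then obtain n x0 where "x0 \<in> interior (S n)"
    by blast
  then obtain e where e: "0 < e" "cball x0 e \<subseteq> S n"
    unfolding mem_interior_cball by blast
  define M where "M = 2 * real (Suc n) / e"
  have "norm (T i x) \<le> M * norm x" if i: "i \<in> I" for i x
  proof (cases "x = 0")
    case True
    then show ?thesis
      using lin[OF i] by (simp add: linear_simps(3))
  next
    case False
    interpret T: bounded_linear "T i"
      by (rule lin[OF i])
    define v where "v = (e / norm x) *\<^sub>R x"
    have "norm v = e"
      using False e by (simp add: v_def)
    then have "x0 + v \<in> S n" "x0 \<in> S n"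
      using e by (auto simp: dist_norm subset_iff)
    then have "norm (T i (x0 + v)) \<le> real n" "norm (T i x0) \<le> real n"
      using i by (auto simp: S_def)
    then have "norm (T i v) \<le> 2 * real n"
      unfolding T.add by norm
    then have "(e / norm x) * norm (T i x) \<le> 2 * real n"
      using e by (simp add: v_def T.scaleR)
    then have "norm (T i x) \<le> 2 * real n / e * norm x"
      using False e by (simp add: field_simps)
    also have "\<dots> \<le> M * norm x"
      using e by (intro mult_right_mono) (simp_all add: M_def field_simps)
    finally show ?thesis .
  qed
  moreover have "0 < M"
    using e by (simp add: M_def)
  ultimately show ?thesis
    by blast
qed

locale banach_group =
  fixes E :: "real \<Rightarrow> 'x::banach \<Rightarrow> 'x"
  assumes lin: "bounded_linear (E t)"
    and zero [simp]: "E 0 x = x"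
    and add: "E (s + t) x = E s (E t x)"
    and cont: "continuous_on UNIV (\<lambda>t. E t x)"
begin

lemma locally_bounded:
  obtains M where "0 < M" "\<And>t x. t \<in> {-\<tau>..\<tau>} \<Longrightarrow> norm (E t x) \<le> M * norm x"
proof -
  have "\<exists>M>0. \<forall>t\<in>{-\<tau>..\<tau>}. \<forall>x. norm (E t x) \<le> M * norm x"
  proof (rule uniform_boundedness[OF lin])
    fix x
    have "bounded ((\<lambda>t. E t x) ` {-\<tau>..\<tau>})"
      by (intro compact_imp_bounded compact_continuous_image continuous_on_subset[OF cont]) auto
    then show "\<exists>c. \<forall>t\<in>{-\<tau>..\<tau>}. norm (E t x) \<le> c"
      by (auto simp: bounded_iff)
  qed
  then show ?thesis
    using that by blast
qed

lemma jointly_tendsto: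
  assumes u: "(u \<longlongrightarrow> s) \<F>" and c: "(c \<longlongrightarrow> x) \<F>"
  shows "((\<lambda>r. E (u r) (c r)) \<longlongrightarrow> E s x) \<F>"
proof -
  obtain M where M: "0 < M" "\<And>t x. t \<in> {-(\<bar>s\<bar> + 1)..\<bar>s\<bar> + 1} \<Longrightarrow> norm (E t x) \<le> M * norm x"
    using locally_bounded by blast
  have "((\<lambda>r. E (u r) (c r - x)) \<longlongrightarrow> 0) \<F>"
  proof (rule Lim_null_comparison)
    have "((\<lambda>r. \<bar>u r\<bar>) \<longlongrightarrow> \<bar>s\<bar>) \<F>"
      by (intro tendsto_intros u)
    then have "\<forall>\<^sub>F r in \<F>. \<bar>u r\<bar> < \<bar>s\<bar> + 1"
      by (rule order_tendstoD) simp
    then show "\<forall>\<^sub>F r in \<F>. norm (E (u r) (c r - x)) \<le> M * norm (c r - x)"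
      by (rule eventually_mono) (auto intro!: M(2))
    have "((\<lambda>r. M * norm (c r - x)) \<longlongrightarrow> M * norm (x - x)) \<F>"
      by (intro tendsto_intros c)
    then show "((\<lambda>r. M * norm (c r - x)) \<longlongrightarrow> 0) \<F>"
      by simp
  qed
  moreover have "((\<lambda>r. E (u r) x) \<longlongrightarrow> E s x) \<F>"
    using cont[of x] u by (intro isCont_tendsto_compose[of s "\<lambda>t. E t x"]) (auto simp: continuous_on_eq_continuous_at)
  ultimately have "((\<lambda>r. E (u r) (c r - x) + E (u r) x) \<longlongrightarrow> 0 + E s x) \<F>"
    by (rule tendsto_add)
  then show ?thesis
    by (simp add: linear_simps(2)[OF lin])
qed

lemma jointly_continuous_on:
  "continuous_on A u \<Longrightarrow> continuous_on A c \<Longrightarrow> continuous_on A (\<lambda>r. E (u r) (c r))"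
  unfolding continuous_on_def by (blast intro: jointly_tendsto)

lemma E_diff: "E t (x - y) = E t x - E t y"
  by (rule linear_simps(2)[OF lin])

lemma E_minus_inverse: "E (- t) (E t x) = x" "E t (E (- t) x) = x"
  using add[of "- t" t x] add[of t "- t" x] by auto

lemma E_commute: "E s (E t x) = E t (E s x)"
  using add[of s t x] add[of t s x] by (simp add: add.commute)

definition mean :: "real \<Rightarrow> 'x \<Rightarrow> 'x" where
  "mean h x = oriented_integral 0 h (\<lambda>s. E s x) /\<^sub>R h"

lemma orbit_integrable: "(\<lambda>s. E s x) integrable_on {a..b}"
  by (intro integrable_continuous_interval continuous_on_subset[OF cont]) auto

lemma bounded_linear_orbit_integral: "bounded_linear (\<lambda>x. oriented_integral 0 h (\<lambda>s. E s x))"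
proof -
  obtain M where M: "0 < M" "\<And>t x. t \<in> {-\<bar>h\<bar>..\<bar>h\<bar>} \<Longrightarrow> norm (E t x) \<le> M * norm x"
    using locally_bounded by blast
  show ?thesis
  proof (rule bounded_linear_intro)
    show "oriented_integral 0 h (\<lambda>s. E s (x + y)) =
      oriented_integral 0 h (\<lambda>s. E s x) + oriented_integral 0 h (\<lambda>s. E s y)" for x y
      by (simp add: linear_simps(1)[OF lin] oriented_integral_add orbit_integrable)
    show "oriented_integral 0 h (\<lambda>s. E s (r *\<^sub>R x)) = r *\<^sub>R oriented_integral 0 h (\<lambda>s. E s x)" for r x
      by (simp add: linear_simps(5)[OF lin] oriented_integral_linear[OF bounded_linear_scaleR_right] orbit_integrable)
    show "norm (oriented_integral 0 h (\<lambda>s. E s x)) \<le> norm x * (M * \<bar>h\<bar>)" for x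
    proof -
      have "norm (oriented_integral 0 h (\<lambda>s. E s x)) \<le> integral {min 0 h..max 0 h} (\<lambda>s. M * norm x)"
        by (rule norm_oriented_integral_le[OF orbit_integrable])
          (auto intro!: M(2) simp: min_def max_def split: if_splits)
      also have "\<dots> = norm x * (M * \<bar>h\<bar>)"
        by (simp add: min_def max_def)
      finally show ?thesis .
    qed
  qed
qed

lemma bounded_linear_mean: "bounded_linear (mean h)"
  unfolding mean_def by (rule bounded_linear_compose[OF bounded_linear_scaleR_right bounded_linear_orbit_integral])

lemma E_mean: "E t (mean h x) = mean h (E t x)"
proof -
  have "E t (oriented_integral 0 h (\<lambda>s. E s x)) = oriented_integral 0 h (\<lambda>s. E t (E s x))"
    by (rule oriented_integral_linear[OF lin orbit_integrable, symmetric])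
  then show ?thesis
    by (simp add: mean_def linear_simps(5)[OF lin] E_commute[of t])
qed

lemma mean_tendsto_point: "((\<lambda>h. mean h x) \<longlongrightarrow> x) (at 0)"
proof -
  have "((\<lambda>t. oriented_integral 0 t (\<lambda>s. E s x)) has_vector_derivative E 0 x) (at 0)"
    by (rule oriented_integral_has_vector_derivative[OF cont])
  moreover have "oriented_integral 0 0 (\<lambda>s. E s x) = 0"
    by (simp add: oriented_integral_def)
  ultimately show ?thesis
    unfolding has_vector_derivative_iff_quotient mean_def by simp
qed

lemma mean_bounded:
  obtains M where "0 < M" "\<And>h x. 0 < \<bar>h\<bar> \<Longrightarrow> \<bar>h\<bar> \<le> 1 \<Longrightarrow> norm (mean h x) \<le> M * norm x"
proof -
  obtain M where M: "0 < M" "\<And>t x. t \<in> {-1..1} \<Longrightarrow> norm (E t x) \<le> M * norm x"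
    using locally_bounded by blast
  have "norm (mean h x) \<le> M * norm x" if h: "0 < \<bar>h\<bar>" "\<bar>h\<bar> \<le> 1" for h x
  proof -
    have "norm (oriented_integral 0 h (\<lambda>s. E s x)) \<le> integral {min 0 h..max 0 h} (\<lambda>s. M * norm x)"
      using h by (intro norm_oriented_integral_le[OF orbit_integrable])
        (auto intro!: M(2) simp: min_def max_def split: if_splits)
    also have "\<dots> = \<bar>h\<bar> * (M * norm x)"
      by (simp add: min_def max_def)
    finally show ?thesis
      using h by (simp add: mean_def field_simps)
  qed
  then show ?thesis
    using that M(1) by blast
qed

text \<open>
  Averages over short pieces of orbits. They commute with the group, tend strongly to the identity and,
  as shown below, map the whole space boundedly into the domain of the generator with its graph norm.
\<close>

definition reg :: "nat \<Rightarrow> 'x \<Rightarrow> 'x" where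
  "reg n = mean (1 / real (Suc n))"

lemma bounded_linear_reg: "bounded_linear (reg n)"
  unfolding reg_def by (rule bounded_linear_mean)

lemma E_reg: "E t (reg n x) = reg n (E t x)"
  unfolding reg_def by (rule E_mean)

lemma reg_bounded:
  obtains M where "0 < M" "\<And>n x. norm (reg n x) \<le> M * norm x"
proof -
  obtain M where "0 < M" "\<And>h x. 0 < \<bar>h\<bar> \<Longrightarrow> \<bar>h\<bar> \<le> 1 \<Longrightarrow> norm (mean h x) \<le> M * norm x"
    using mean_bounded by blast
  then show ?thesis
    using that[of M] by (simp add: reg_def)
qed

lemma reg_tendsto:
  assumes "x \<longlonglongrightarrow> y"
  shows "(\<lambda>n. reg n (x n)) \<longlonglongrightarrow> y"
proof -
  obtain M where M: "0 < M" "\<And>n x. norm (reg n x) \<le> M * norm x"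
    using reg_bounded by blast
  have "(\<lambda>n. reg n (x n - y)) \<longlonglongrightarrow> 0"
  proof (rule Lim_null_comparison)
    show "\<forall>\<^sub>F n in sequentially. norm (reg n (x n - y)) \<le> M * norm (x n - y)"
      using M by simp
    have "(\<lambda>n. M * norm (x n - y)) \<longlonglongrightarrow> M * norm (y - y)"
      by (intro tendsto_intros assms)
    then show "(\<lambda>n. M * norm (x n - y)) \<longlonglongrightarrow> 0"
      by simp
  qed
  moreover have "(\<lambda>n. reg n y) \<longlonglongrightarrow> y"
  proof -
    have "filterlim (\<lambda>n. 1 / real (Suc n)) (at 0) sequentially"
      unfolding filterlim_at using LIMSEQ_Suc[OF lim_1_over_n] by simp
    then show ?thesis
      unfolding reg_def by (rule filterlim_compose[OF mean_tendsto_point])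
  qed
  ultimately have "(\<lambda>n. reg n (x n - y) + reg n y) \<longlonglongrightarrow> 0 + y"
    by (rule tendsto_add)
  then show ?thesis
    by (simp add: linear_simps(2)[OF bounded_linear_reg])
qed

lemma reg_integral_tendsto:
  fixes u v :: real
  assumes g: "continuous_on UNIV g"
  shows "(\<lambda>n. integral {u..v} (\<lambda>r. norm (reg n (g r) - g r))) \<longlonglongrightarrow> 0"
proof -
  obtain M where M: "0 < M" "\<And>n x. norm (reg n x) \<le> M * norm x"
    using reg_bounded by blast
  have "(\<lambda>n. integral {u..v} (\<lambda>r. norm (reg n (g r) - g r))) \<longlonglongrightarrow> integral {u..v} (\<lambda>r. 0)"
  proof (rule dominated_convergence(2))
    show "(\<lambda>r. norm (reg n (g r) - g r)) integrable_on {u..v}" for n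
      by (intro integrable_continuous_interval continuous_intros bounded_linear.continuous_on[OF bounded_linear_reg]
          continuous_on_subset[OF g subset_UNIV])
    show "(\<lambda>r. (M + 1) * norm (g r)) integrable_on {u..v}"
      by (intro integrable_continuous_interval continuous_intros continuous_on_subset[OF g subset_UNIV])
    show "norm (norm (reg n (g r) - g r)) \<le> (M + 1) * norm (g r)" for n r
      using M(2)[of n "g r"] norm_triangle_ineq4[of "reg n (g r)" "g r"] by (simp add: algebra_simps)
    fix r
    have "(\<lambda>n. norm (reg n (g r) - g r)) \<longlonglongrightarrow> norm (g r - g r)"
      by (intro tendsto_intros reg_tendsto)
    then show "(\<lambda>n. norm (reg n (g r) - g r)) \<longlonglongrightarrow> 0"
      by simp
  qed
  then show ?thesis
    by simp
qed

end

locale generated_group = banach_group E for E :: "real \<Rightarrow> 'x::banach \<Rightarrow> 'x" +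
  fixes D :: "'x set" and F :: "'x \<Rightarrow> 'x"
  assumes gen: "has_generator UNIV E D F"
begin

lemma generator_iff: "((\<lambda>h. (E h x - x) /\<^sub>R h) \<longlongrightarrow> y) (at 0) \<longleftrightarrow> x \<in> D \<and> y = F x"
  using gen by (simp add: has_generator_def)

lemma generator_lim: "x \<in> D \<Longrightarrow> ((\<lambda>h. (E h x - x) /\<^sub>R h) \<longlongrightarrow> F x) (at 0)"
  using generator_iff by blast

lemma generator_linear_image:
  assumes T: "bounded_linear T" and commute: "\<And>h. E h (T x) = T (E h x)" and x: "x \<in> D"
  shows "T x \<in> D" "F (T x) = T (F x)"
proof -
  have "((\<lambda>h. T ((E h x - x) /\<^sub>R h)) \<longlongrightarrow> T (F x)) (at 0)"
    by (rule bounded_linear.tendsto[OF T generator_lim[OF x]])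
  then have "((\<lambda>h. (E h (T x) - T x) /\<^sub>R h) \<longlongrightarrow> T (F x)) (at 0)"
    by (simp add: linear_simps(2)[OF T] linear_simps(5)[OF T] commute)
  then show "T x \<in> D" "F (T x) = T (F x)"
    unfolding generator_iff by auto
qed

lemma E_mem: "x \<in> D \<Longrightarrow> E t x \<in> D"
  and F_E: "x \<in> D \<Longrightarrow> F (E t x) = E t (F x)"
  using generator_linear_image[OF lin E_commute] by blast+

lemma F_reg: "x \<in> D \<Longrightarrow> F (reg n x) = reg n (F x)"
  using generator_linear_image(2)[OF bounded_linear_reg E_reg] by blast

lemma D_diff: "x \<in> D \<Longrightarrow> y \<in> D \<Longrightarrow> x - y \<in> D"
  and F_diff: "x \<in> D \<Longrightarrow> y \<in> D \<Longrightarrow> F (x - y) = F x - F y"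
proof -
  assume "x \<in> D" "y \<in> D"
  then have "((\<lambda>h. (E h x - x) /\<^sub>R h - (E h y - y) /\<^sub>R h) \<longlongrightarrow> F x - F y) (at 0)"
    by (intro tendsto_diff generator_lim)
  moreover have "(E h x - x) /\<^sub>R h - (E h y - y) /\<^sub>R h = (E h (x - y) - (x - y)) /\<^sub>R h" for h
    by (simp add: E_diff scaleR_diff_right)
  ultimately have "x - y \<in> D \<and> F x - F y = F (x - y)"
    unfolding generator_iff[symmetric] by simp
  then show "x - y \<in> D" "F (x - y) = F x - F y"
    by auto
qed

lemma zero_mem: "0 \<in> D" and F_zero: "F 0 = 0"
proof -
  have "((\<lambda>h. (E h 0 - 0) /\<^sub>R h) \<longlongrightarrow> 0) (at 0)"
    using linear_simps(3)[OF lin] by simp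
  then show "0 \<in> D" "F 0 = 0"
    unfolding generator_iff by auto
qed

lemma orbit_deriv:
  assumes "x \<in> D"
  shows "((\<lambda>t. E t x) has_vector_derivative E t (F x)) (at t)"
proof -
  have "((\<lambda>h. E t ((E h x - x) /\<^sub>R h)) \<longlongrightarrow> E t (F x)) (at 0)"
    by (rule bounded_linear.tendsto[OF lin generator_lim[OF assms]])
  then show ?thesis
    unfolding has_vector_derivative_iff_quotient
    by (simp add: linear_simps(2)[OF lin] linear_simps(5)[OF lin] add)
qed

text \<open>
  The integral equation characterises the domain and, in contrast to the difference quotient, passes to
  limits; this gives the closedness of the generator.
\<close>

lemma generatorI:
  assumes "\<And>t. E t x - x = oriented_integral 0 t (\<lambda>s. E s y)"
  shows "x \<in> D" "F x = y"
proof -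
  have "((\<lambda>h. (E h x - x) /\<^sub>R h) \<longlongrightarrow> y) (at 0)"
    using mean_tendsto_point[of y] unfolding mean_def assms .
  then show "x \<in> D" "F x = y"
    unfolding generator_iff by auto
qed

lemma orbit_integral: "x \<in> D \<Longrightarrow> E t x - x = oriented_integral 0 t (\<lambda>s. E s (F x))"
  using oriented_integral_ftc[OF orbit_deriv, of x 0 t] by simp

lemma generator_closed:
  assumes D: "\<And>n. y n \<in> D" and y: "y \<longlonglongrightarrow> x" and Fy: "(\<lambda>n. F (y n)) \<longlonglongrightarrow> w"
  shows "x \<in> D" "F x = w"
proof -
  have "E t x - x = oriented_integral 0 t (\<lambda>s. E s w)" for t
  proof (rule LIMSEQ_unique)
    show "(\<lambda>n. E t (y n) - y n) \<longlonglongrightarrow> E t x - x"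
      by (intro tendsto_diff bounded_linear.tendsto[OF lin] y)
    show "(\<lambda>n. E t (y n) - y n) \<longlonglongrightarrow> oriented_integral 0 t (\<lambda>s. E s w)"
      unfolding orbit_integral[OF D]
      by (rule bounded_linear.tendsto[OF bounded_linear_orbit_integral Fy])
  qed
  then show "x \<in> D" "F x = w"
    by (rule generatorI)+
qed

lemma mean_mem: "mean h x \<in> D" and F_mean: "h \<noteq> 0 \<Longrightarrow> F (mean h x) = (E h x - x) /\<^sub>R h"
proof -
  define P where "P t = oriented_integral 0 t (\<lambda>s. E s x)" for t
  have P: "(P has_vector_derivative E t x) (at t)" for t
    unfolding P_def by (rule oriented_integral_has_vector_derivative[OF cont])
  have shift: "E t (P h) = P (h + t) - P t" for t
  proof -
    have deriv: "((\<lambda>s. P (s + t)) has_vector_derivative E (s + t) x) (at s)" for s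
      by (rule has_vector_derivative_shift[OF P])
    have "E t (P h) = oriented_integral 0 h (\<lambda>s. E (s + t) x)"
      unfolding P_def add E_commute[of _ t] by (rule oriented_integral_linear[OF lin orbit_integrable, symmetric])
    also have "\<dots> = P (h + t) - P (0 + t)"
      by (rule oriented_integral_ftc[OF deriv])
    finally show ?thesis
      by simp
  qed
  have "((\<lambda>t. P (t + h) - P t) has_vector_derivative E (0 + h) x - E 0 x) (at 0)"
  proof (intro has_vector_derivative_diff P)
    show "((\<lambda>t. P (t + h)) has_vector_derivative E (0 + h) x) (at 0)"
      by (rule has_vector_derivative_shift[OF P])
  qed
  then have "((\<lambda>t. (E t (P h) - P h) /\<^sub>R t) \<longlongrightarrow> E h x - x) (at 0)"
    unfolding has_vector_derivative_iff_quotient shift by (simp add: P_def add.commute oriented_integral_def)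
  then have P_gen: "P h \<in> D" "F (P h) = E h x - x"
    unfolding generator_iff by auto
  have mean: "mean h x = P h /\<^sub>R h"
    by (simp add: mean_def P_def)
  show "mean h x \<in> D" "h \<noteq> 0 \<Longrightarrow> F (mean h x) = (E h x - x) /\<^sub>R h"
    using generator_linear_image[OF bounded_linear_scaleR_right, of "inverse h" "P h"] P_gen
    unfolding mean by (simp_all add: linear_simps(5)[OF lin])
qed

lemma reg_mem: "reg n x \<in> D"
  unfolding reg_def by (rule mean_mem)

lemma bounded_linear_F_reg: "bounded_linear (\<lambda>x. F (reg n x))"
proof -
  have "F (reg n x) = (E (1 / real (Suc n)) x - x) /\<^sub>R (1 / real (Suc n))" for x
    unfolding reg_def by (rule F_mean) simp
  then show ?thesis
    by (simp only:) (intro bounded_linear_compose[OF bounded_linear_scaleR_right] bounded_linear_sub lin bounded_linear_ident)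
qed

lemma closure_domain: "closure D = UNIV"
proof -
  have "x \<in> closure D" for x
    unfolding closure_sequential using reg_mem reg_tendsto[OF tendsto_const, of x]
    by (intro exI[of _ "\<lambda>n. reg n x"]) simp
  then show ?thesis
    by blast
qed

lemma D_scaleR: "x \<in> D \<Longrightarrow> r *\<^sub>R x \<in> D"
  using generator_linear_image(1)[OF bounded_linear_scaleR_right, of r x] by (simp add: linear_simps(5)[OF lin])

lemma D_add: "x \<in> D \<Longrightarrow> y \<in> D \<Longrightarrow> x + y \<in> D"
  using D_diff[of x "0 - y"] D_diff[of 0 y] zero_mem by simp

end

section \<open>Admissible observations along trajectories\<close>

context generated_group
begin

lemma E_traj_continuous: "continuous_on A c \<Longrightarrow> continuous_on A u \<Longrightarrow> continuous_on A (\<lambda>r. E (- (u r)) (c r))"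
  by (intro jointly_continuous_on continuous_on_minus)

lemma convolution_eq:
  assumes "continuous_on UNIV g"
  shows "oriented_integral 0 t (\<lambda>r. E (- (t - r)) (g r)) = E (- t) (oriented_integral 0 t (\<lambda>r. E r (g r)))"
proof -
  have "continuous_on UNIV (\<lambda>r. E r (g r))"
    by (intro jointly_continuous_on assms continuous_on_id)
  then have "(\<lambda>r. E r (g r)) integrable_on {min 0 t..max 0 t}"
    by (rule integrable_continuous_interval[OF continuous_on_subset]) auto
  moreover have "E (- (t - r)) (g r) = E (- t) (E r (g r))" for r
    using add[of "- t" r "g r"] by simp
  ultimately show ?thesis
    by (simp only: oriented_integral_linear[OF lin])
qed

lemma traj_continuous:
  assumes g: "continuous_on UNIV g"
  shows "continuous_on A (traj E y g)"
proof -
  have c: "continuous_on UNIV (\<lambda>r. E r (g r))"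
    by (intro jointly_continuous_on g continuous_on_id)
  have "continuous_on UNIV (\<lambda>t. oriented_integral 0 t (\<lambda>r. E r (g r)))"
    using oriented_integral_has_vector_derivative[OF c]
    by (intro continuous_at_imp_continuous_on) (auto intro: has_vector_derivative_continuous)
  then have "continuous_on UNIV (\<lambda>t. E (- t) y + E (- t) (oriented_integral 0 t (\<lambda>r. E r (g r))))"
    by (intro continuous_on_add E_traj_continuous continuous_on_id continuous_on_const)
  then show ?thesis
    unfolding traj_def[abs_def] convolution_eq[OF g] by (rule continuous_on_subset) simp
qed

text \<open>
  The integrand need not be continuous, and its values need not lie in a separable space, so its
  integrability is inherited from the continuous approximations of \<open>g\<close>.
\<close>

lemma convolution_integrable:
  assumes g: "L1_on {-\<tau>..\<tau>} g" and t: "t \<in> {-\<tau>..\<tau>}"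
  shows "(\<lambda>r. E (- (t - r)) (g r)) integrable_on {min 0 t..max 0 t}"
proof -
  obtain M where M: "0 < M" "\<And>s x. s \<in> {-(2*\<tau>)..2*\<tau>} \<Longrightarrow> norm (E s x) \<le> M * norm x"
    using locally_bounded by blast
  have sub: "{min 0 t..max 0 t} \<subseteq> {-\<tau>..\<tau>}"
    by (rule min_max_subset[OF t])
  show ?thesis
    unfolding cbox_interval[symmetric]
  proof (rule integrable_on_of_approx)
    fix e :: real
    assume "0 < e"
    then have "0 < e / M"
      using M by simp
    then obtain c where c: "continuous_on UNIV c" "integral {-\<tau>..\<tau>} (\<lambda>t. norm (g t - c t)) \<le> e / M"
      using L1_on_approx[OF g] by blast
    have gc: "L1_on {-\<tau>..\<tau>} (\<lambda>t. g t - c t)"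
      by (intro L1_on_diff g L1_on_continuous c)
    show "\<exists>ga h. ga integrable_on cbox (min 0 t) (max 0 t) \<and> h integrable_on cbox (min 0 t) (max 0 t) \<and>
      (\<forall>r\<in>cbox (min 0 t) (max 0 t). norm (E (- (t - r)) (g r) - ga r) \<le> h r) \<and> integral (cbox (min 0 t) (max 0 t)) h \<le> e"
      unfolding cbox_interval
    proof (intro exI conjI ballI)
      show "(\<lambda>r. E (- (t - r)) (c r)) integrable_on {min 0 t..max 0 t}"
        by (intro integrable_continuous_interval E_traj_continuous continuous_on_subset[OF c(1)] continuous_intros) auto
      show "(\<lambda>r. M * norm (g r - c r)) integrable_on {min 0 t..max 0 t}"
        by (intro integrable_on_mult_right L1_on_imp_integral_bound(1)[OF gc sub])
      fix r
      assume "r \<in> {min 0 t..max 0 t}"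
      then have "- (t - r) \<in> {-(2*\<tau>)..2*\<tau>}"
        using sub t by auto
      then show "norm (E (- (t - r)) (g r) - E (- (t - r)) (c r)) \<le> M * norm (g r - c r)"
        unfolding E_diff[symmetric] by (rule M(2))
    next
      have "integral {min 0 t..max 0 t} (\<lambda>r. norm (g r - c r)) \<le> e / M"
        using L1_on_imp_integral_bound(2)[OF gc sub] c(2) by simp
      then show "integral {min 0 t..max 0 t} (\<lambda>r. M * norm (g r - c r)) \<le> e"
        using M(1) by (simp add: field_simps)
    qed
  qed
qed

lemma convolution_bound:
  obtains M where "0 < M" "\<And>g t. L1_on {-\<tau>..\<tau>} g \<Longrightarrow> t \<in> {-\<tau>..\<tau>} \<Longrightarrow>
    norm (oriented_integral 0 t (\<lambda>r. E (- (t - r)) (g r))) \<le> M * integral {-\<tau>..\<tau>} (\<lambda>r. norm (g r))"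
proof -
  obtain M where M: "0 < M" "\<And>s x. s \<in> {-(2*\<tau>)..2*\<tau>} \<Longrightarrow> norm (E s x) \<le> M * norm x"
    using locally_bounded by blast
  have "norm (oriented_integral 0 t (\<lambda>r. E (- (t - r)) (g r))) \<le> M * integral {-\<tau>..\<tau>} (\<lambda>r. norm (g r))"
    if g: "L1_on {-\<tau>..\<tau>} g" and t: "t \<in> {-\<tau>..\<tau>}" for g t
  proof -
    have sub: "{min 0 t..max 0 t} \<subseteq> {-\<tau>..\<tau>}"
      by (rule min_max_subset[OF t])
    have "norm (oriented_integral 0 t (\<lambda>r. E (- (t - r)) (g r))) \<le> integral {min 0 t..max 0 t} (\<lambda>r. M * norm (g r))"
    proof (rule norm_oriented_integral_le[OF convolution_integrable[OF g t]])
      show "(\<lambda>r. M * norm (g r)) integrable_on {min 0 t..max 0 t}"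
        by (intro integrable_on_mult_right L1_on_imp_integral_bound(1)[OF g sub])
      fix r
      assume "r \<in> {min 0 t..max 0 t}"
      then have "- (t - r) \<in> {-(2*\<tau>)..2*\<tau>}"
        using sub t by auto
      then show "norm (E (- (t - r)) (g r)) \<le> M * norm (g r)"
        by (rule M(2))
    qed
    also have "\<dots> \<le> M * integral {-\<tau>..\<tau>} (\<lambda>r. norm (g r))"
      using L1_on_imp_integral_bound(2)[OF g sub] M(1) by simp
    finally show ?thesis .
  qed
  then show ?thesis
    using that M(1) by blast
qed

lemma traj_diff:
  assumes "L1_on {-\<tau>..\<tau>} g1" "L1_on {-\<tau>..\<tau>} g2" "t \<in> {-\<tau>..\<tau>}"
  shows "traj E y1 g1 t - traj E y2 g2 t = traj E (y1 - y2) (\<lambda>r. g1 r - g2 r) t"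
  unfolding traj_def E_diff
    oriented_integral_diff[OF convolution_integrable[OF assms(1,3)] convolution_integrable[OF assms(2,3)]]
  by simp

lemma traj_linear_image:
  assumes T: "bounded_linear T" and "L1_on {-\<tau>..\<tau>} g" "t \<in> {-\<tau>..\<tau>}" and commute: "\<And>s x. T (E s x) = E s (T x)"
  shows "T (traj E y g t) = traj E (T y) (\<lambda>r. T (g r)) t"
  unfolding traj_def linear_simps(1)[OF T] oriented_integral_linear[OF T convolution_integrable[OF assms(2,3)], symmetric]
    commute ..

lemma L1_graph_on_imp:
  assumes "L1_graph_on D F {-\<tau>..\<tau>} g"
  shows "L1_on {-\<tau>..\<tau>} g" "L1_on {-\<tau>..\<tau>} (\<lambda>t. F (g t))"
  using assms L1_on_bounded_linear[OF bounded_linear_fst, of "-\<tau>" \<tau> "\<lambda>t. (g t, F (g t))"]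
    L1_on_bounded_linear[OF bounded_linear_snd, of "-\<tau>" \<tau> "\<lambda>t. (g t, F (g t))"]
  by (simp_all add: L1_graph_on_def)

lemma L1_graph_on_diff:
  assumes "L1_graph_on D F {-\<tau>..\<tau>} g1" "L1_graph_on D F {-\<tau>..\<tau>} g2"
  shows "L1_graph_on D F {-\<tau>..\<tau>} (\<lambda>t. g1 t - g2 t)"
  unfolding L1_graph_on_def
proof
  have "L1_on {-\<tau>..\<tau>} (\<lambda>t. (g1 t, F (g1 t)) - (g2 t, F (g2 t)))"
    using assms by (intro L1_on_diff) (auto simp: L1_graph_on_def)
  then show "L1_on {-\<tau>..\<tau>} (\<lambda>t. (g1 t - g2 t, F (g1 t - g2 t)))"
    by (rule L1_on_cong[rotated]) (use assms in \<open>auto simp: L1_graph_on_def F_diff\<close>)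
qed (use assms in \<open>auto simp: L1_graph_on_def intro: D_diff\<close>)

lemma L1_graph_on_reg:
  assumes "continuous_on UNIV g"
  shows "L1_graph_on D F {-\<tau>..\<tau>} (\<lambda>t. reg n (g t))"
  unfolding L1_graph_on_def
  by (auto intro!: reg_mem L1_on_continuous continuous_on_Pair
      bounded_linear.continuous_on[OF bounded_linear_reg] bounded_linear.continuous_on[OF bounded_linear_F_reg] assms)

lemma reg_traj:
  assumes "L1_on {-\<tau>..\<tau>} g" "t \<in> {-\<tau>..\<tau>}"
  shows "reg n (traj E y g t) = traj E (reg n y) (\<lambda>r. reg n (g r)) t"
  by (rule traj_linear_image[OF bounded_linear_reg assms E_reg[symmetric]])

text \<open>
  The regularised trajectory lies in the domain and its image under the generator is the regularised
  trajectory of the images of the data; closedness removes the regularisation.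
\<close>

lemma traj_graph:
  assumes y: "y \<in> D" and g: "L1_graph_on D F {-\<tau>..\<tau>} g" and t: "t \<in> {-\<tau>..\<tau>}"
  shows "traj E y g t \<in> D" "F (traj E y g t) = traj E (F y) (\<lambda>r. F (g r)) t"
proof -
  let ?u = "traj E y g t" and ?v = "traj E (F y) (\<lambda>r. F (g r)) t"
  note L1 = L1_graph_on_imp[OF g]
  have gD: "g r \<in> D" if "r \<in> {min 0 t..max 0 t}" for r
    using g subsetD[OF min_max_subset[OF t] that] by (simp add: L1_graph_on_def)
  have eq: "F (reg n ?u) = reg n ?v" for n
  proof -
    have "F (reg n ?u) = traj E (F (reg n y)) (\<lambda>r. F (reg n (g r))) t"
      by (rule traj_linear_image[OF bounded_linear_F_reg L1(1) t]) (simp add: F_E reg_mem flip: E_reg)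
    also have "\<dots> = traj E (reg n (F y)) (\<lambda>r. reg n (F (g r))) t"
      unfolding traj_def by (intro arg_cong2[where f = "(+)"] oriented_integral_cong) (simp_all add: F_reg y gD)
    also have "\<dots> = reg n ?v"
      by (rule reg_traj[OF L1(2) t, symmetric])
    finally show ?thesis .
  qed
  have "(\<lambda>n. reg n ?u) \<longlonglongrightarrow> ?u" "(\<lambda>n. F (reg n ?u)) \<longlonglongrightarrow> ?v"
    unfolding eq by (intro reg_tendsto tendsto_const)+
  from generator_closed[OF reg_mem this] show "?u \<in> D" "F ?u = ?v"
    by auto
qed

end

text \<open>
  An observation \<open>b\<close> is defined on the domain of the generator only and is bounded there for the graph
  norm, with values in a closed set \<open>Y\<close>. Admissibility is assumed forward in time; the group property
  extends it to symmetric intervals.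
\<close>

locale admissible_observation = generated_group E D F
  for E :: "real \<Rightarrow> 'x::banach \<Rightarrow> 'x" and D F +
  fixes b :: "'x \<Rightarrow> 'y::banach" and Y :: "'y set"
  assumes b_add: "x \<in> D \<Longrightarrow> y \<in> D \<Longrightarrow> b (x + y) = b x + b y"
    and b_scaleR: "x \<in> D \<Longrightarrow> b (r *\<^sub>R x) = r *\<^sub>R b x"
    and b_graph_bounded: "\<exists>c. \<forall>x\<in>D. norm (b x) \<le> c * graph_norm F x"
    and b_mem: "x \<in> D \<Longrightarrow> b x \<in> Y"
    and Y_closed: "closed Y"
    and admissible: "0 < \<tau> \<Longrightarrow> \<exists>c. \<forall>x\<in>D. integral {0..\<tau>} (\<lambda>t. (norm (b (E (- t) x)))\<^sup>2) \<le> c * (norm x)\<^sup>2"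
begin

lemma b_diff: "x \<in> D \<Longrightarrow> y \<in> D \<Longrightarrow> b (x - y) = b x - b y"
  using b_add[of x "(-1) *\<^sub>R y"] b_scaleR[of y "-1"] D_scaleR[of y "-1"] by simp

lemma b_bound:
  obtains c where "0 < c" "\<And>x. x \<in> D \<Longrightarrow> norm (b x) \<le> c * (norm x + norm (F x))"
proof -
  obtain c where c: "\<And>x. x \<in> D \<Longrightarrow> norm (b x) \<le> c * graph_norm F x"
    using b_graph_bounded by blast
  have "norm (b x) \<le> (\<bar>c\<bar> + 1) * (norm x + norm (F x))" if "x \<in> D" for x
  proof -
    have "norm (b x) \<le> c * graph_norm F x"
      by (rule c[OF that])
    also have "\<dots> \<le> (\<bar>c\<bar> + 1) * (norm x + norm (F x))"
      by (intro mult_mono) (auto simp: graph_norm_def sqrt_sum_squares_le_sum)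
    finally show ?thesis .
  qed
  then show ?thesis
    using that[of "\<bar>c\<bar> + 1"] by simp
qed

lemma b_tendsto:
  assumes "\<And>r. c r \<in> D" "x \<in> D" "(c \<longlongrightarrow> x) \<F>" "((\<lambda>r. F (c r)) \<longlongrightarrow> F x) \<F>"
  shows "((\<lambda>r. b (c r)) \<longlongrightarrow> b x) \<F>"
proof -
  obtain K where K: "0 < K" "\<And>x. x \<in> D \<Longrightarrow> norm (b x) \<le> K * (norm x + norm (F x))"
    using b_bound by blast
  have "((\<lambda>r. b (c r) - b x) \<longlongrightarrow> 0) \<F>"
  proof (rule Lim_null_comparison)
    show "\<forall>\<^sub>F r in \<F>. norm (b (c r) - b x) \<le> K * (norm (c r - x) + norm (F (c r) - F x))"
      using K(2)[OF D_diff[OF assms(1,2)]] assms(1,2) by (simp add: b_diff F_diff)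
    have "((\<lambda>r. K * (norm (c r - x) + norm (F (c r) - F x))) \<longlongrightarrow> K * (norm (x - x) + norm (F x - F x))) \<F>"
      by (intro tendsto_intros assms)
    then show "((\<lambda>r. K * (norm (c r - x) + norm (F (c r) - F x))) \<longlongrightarrow> 0) \<F>"
      by simp
  qed
  then show ?thesis
    by (rule Lim_null[THEN iffD2])
qed

lemma b_orbit_continuous:
  assumes "x \<in> D" "continuous_on A u"
  shows "continuous_on A (\<lambda>r. b (E (u r) x))"
  unfolding continuous_on_def
proof
  fix s
  assume "s \<in> A"
  then have "(u \<longlongrightarrow> u s) (at s within A)"
    using assms by (auto simp: continuous_on_def)
  then show "((\<lambda>r. b (E (u r) x)) \<longlongrightarrow> b (E (u s) x)) (at s within A)"
    using assms by (intro b_tendsto) (auto intro: jointly_tendsto E_mem simp: F_E)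
qed

lemma bounded_linear_b_reg: "bounded_linear (\<lambda>x. b (reg n x))"
proof -
  obtain K where K: "0 < K" "\<And>x. x \<in> D \<Longrightarrow> norm (b x) \<le> K * (norm x + norm (F x))"
    using b_bound by blast
  obtain K1 where K1: "\<And>x. norm (reg n x) \<le> norm x * K1"
    using bounded_linear.bounded[OF bounded_linear_reg] by blast
  obtain K2 where K2: "\<And>x. norm (F (reg n x)) \<le> norm x * K2"
    using bounded_linear.bounded[OF bounded_linear_F_reg] by blast
  show ?thesis
  proof (rule bounded_linear_intro)
    show "b (reg n (x + y)) = b (reg n x) + b (reg n y)" for x y
      by (simp add: linear_simps(1)[OF bounded_linear_reg] b_add reg_mem)
    show "b (reg n (r *\<^sub>R x)) = r *\<^sub>R b (reg n x)" for r x
      by (simp add: linear_simps(5)[OF bounded_linear_reg] b_scaleR reg_mem)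
    show "norm (b (reg n x)) \<le> norm x * (K * (K1 + K2))" for x
    proof -
      have "norm (b (reg n x)) \<le> K * (norm x * K1 + norm x * K2)"
        using K(2)[OF reg_mem, of n x] K(1) K1[of x] K2[of x]
        by (smt (verit) mult_left_mono)
      then show ?thesis
        by (simp add: algebra_simps)
    qed
  qed
qed

lemma admissible_symmetric:
  assumes "0 < \<tau>"
  obtains c where "0 \<le> c" "\<And>x. x \<in> D \<Longrightarrow> integral {-\<tau>..\<tau>} (\<lambda>t. (norm (b (E (- t) x)))\<^sup>2) \<le> c * (norm x)\<^sup>2"
proof -
  obtain c where c: "\<And>x. x \<in> D \<Longrightarrow> integral {0..2*\<tau>} (\<lambda>t. (norm (b (E (- t) x)))\<^sup>2) \<le> c * (norm x)\<^sup>2"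
    using admissible[of "2 * \<tau>"] assms by auto
  obtain M where M: "0 < M" "\<And>s x. s \<in> {-\<tau>..\<tau>} \<Longrightarrow> norm (E s x) \<le> M * norm x"
    using locally_bounded by blast
  have "integral {-\<tau>..\<tau>} (\<lambda>t. (norm (b (E (- t) x)))\<^sup>2) \<le> (\<bar>c\<bar> * M\<^sup>2) * (norm x)\<^sup>2" if x: "x \<in> D" for x
  proof -
    have "integral {-\<tau>..\<tau>} (\<lambda>t. (norm (b (E (- t) x)))\<^sup>2) = integral {0..2*\<tau>} (\<lambda>t. (norm (b (E (- (- \<tau> + t)) x)))\<^sup>2)"
      using integral_shift_Icc_real[of 0 "2 * \<tau>" "\<lambda>t. (norm (b (E (- t) x)))\<^sup>2" "- \<tau>"] by (simp add: o_def)
    also have "\<dots> = integral {0..2*\<tau>} (\<lambda>t. (norm (b (E (- t) (E \<tau> x))))\<^sup>2)"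
      by (simp flip: add)
    also have "\<dots> \<le> c * (norm (E \<tau> x))\<^sup>2"
      by (rule c[OF E_mem[OF x]])
    also have "\<dots> \<le> \<bar>c\<bar> * (M * norm x)\<^sup>2"
      using M(2)[of \<tau> x] assms by (intro mult_mono power_mono) auto
    finally show ?thesis
      by (simp add: power_mult_distrib mult.assoc)
  qed
  then show ?thesis
    using that[of "\<bar>c\<bar> * M\<^sup>2"] by simp
qed

lemma admissible_reg:
  assumes "0 < \<tau>"
  obtains c where "0 \<le> c" "\<And>n x. integral {-\<tau>..\<tau>} (\<lambda>t. (norm (b (reg n (E (- t) x))))\<^sup>2) \<le> c * (norm x)\<^sup>2"
proof -
  obtain c where c: "0 \<le> c" "\<And>x. x \<in> D \<Longrightarrow> integral {-\<tau>..\<tau>} (\<lambda>t. (norm (b (E (- t) x)))\<^sup>2) \<le> c * (norm x)\<^sup>2"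
    using admissible_symmetric[OF assms] by blast
  obtain M where M: "0 < M" "\<And>n x. norm (reg n x) \<le> M * norm x"
    using reg_bounded by blast
  have "integral {-\<tau>..\<tau>} (\<lambda>t. (norm (b (reg n (E (- t) x))))\<^sup>2) \<le> (c * M\<^sup>2) * (norm x)\<^sup>2" for n x
  proof -
    have "integral {-\<tau>..\<tau>} (\<lambda>t. (norm (b (reg n (E (- t) x))))\<^sup>2) \<le> c * (norm (reg n x))\<^sup>2"
      using c(2)[OF reg_mem[of n x]] by (simp add: E_reg)
    also have "\<dots> \<le> c * (M * norm x)\<^sup>2"
      using M c(1) by (intro mult_left_mono power_mono) auto
    finally show ?thesis
      by (simp add: power_mult_distrib mult.assoc)
  qed
  then show ?thesis
    using that[of "c * M\<^sup>2"] c(1) by simp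
qed

lemma reg_observation_jointly_continuous:
  assumes "continuous_on A u" "continuous_on A c"
  shows "continuous_on A (\<lambda>r. b (reg n (E (u r) (c r))))"
  by (rule bounded_linear.continuous_on[OF bounded_linear_b_reg jointly_continuous_on[OF assms]])

text \<open>
  By the Cauchy-Schwarz inequality with weight \<open>w = \<parallel>g\<parallel> + \<epsilon>\<close>, the square of
  \<open>\<integral> \<parallel>\<Phi>(t - r) g(r)\<parallel> dr\<close> is at most \<open>\<integral> w\<close> times \<open>\<integral> \<parallel>\<Phi>(t - r) g(r)\<parallel>\<^sup>2 / w(r) dr\<close>; after
  integration in \<open>t\<close> and exchange of the integrals, admissibility bounds the second factor by a multiple of
  \<open>\<integral> \<parallel>g\<parallel>\<^sup>2 / w \<le> \<integral> \<parallel>g\<parallel>\<close>. The positive \<open>\<epsilon>\<close> only keeps the weight away from zero.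
\<close>

lemma convolution_observation_bound:
  assumes \<tau>: "0 < \<tau>"
  obtains c where "0 \<le> c" "\<And>n g. continuous_on UNIV g \<Longrightarrow>
    integral {-\<tau>..\<tau>} (\<lambda>t. (norm (b (reg n (traj E 0 g t))))\<^sup>2) \<le> c * (integral {-\<tau>..\<tau>} (\<lambda>r. norm (g r)))\<^sup>2"
proof -
  obtain c where c: "0 \<le> c" "\<And>n x. integral {-(2*\<tau>)..2*\<tau>} (\<lambda>t. (norm (b (reg n (E (- t) x))))\<^sup>2) \<le> c * (norm x)\<^sup>2"
    using admissible_reg[of "2 * \<tau>"] \<tau> by auto
  have "integral {-\<tau>..\<tau>} (\<lambda>t. (norm (b (reg n (traj E 0 g t))))\<^sup>2) \<le> c * (integral {-\<tau>..\<tau>} (\<lambda>r. norm (g r)))\<^sup>2"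
    if g: "continuous_on UNIV g" for n g
  proof -
    note g' = continuous_on_subset[OF g subset_UNIV]
    define \<phi> where "\<phi> t r = norm (b (reg n (E (- (t - r)) (g r))))" for t r
    define P where "P t = integral {-\<tau>..\<tau>} (\<phi> t)" for t
    define G where "G = integral {-\<tau>..\<tau>} (\<lambda>r. norm (g r))"
    have G: "0 \<le> G"
      unfolding G_def by (rule integral_nonneg) (auto intro!: integrable_continuous_interval continuous_on_norm g')
    have \<phi>2: "continuous_on S (\<lambda>p. \<phi> (fst p) (snd p))" for S
      unfolding \<phi>_def
      by (intro continuous_on_norm bounded_linear.continuous_on[OF bounded_linear_b_reg])
        (auto intro!: jointly_continuous_on continuous_intros continuous_on_compose2[OF g])
    have \<phi>_r: "continuous_on S (\<phi> t)" for S t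
      using continuous_on_compose2[OF \<phi>2[of UNIV], of S "\<lambda>r. (t, r)"] by (simp add: continuous_intros)
    have P_cont: "continuous_on {-\<tau>..\<tau>} P"
      unfolding P_def using integral_continuous_on_param[of "{-\<tau>..\<tau>}" "-\<tau>" \<tau> \<phi>] \<phi>2
      by (simp add: case_prod_unfold)
    have f_le: "norm (b (reg n (traj E 0 g t))) \<le> P t" if t: "t \<in> {-\<tau>..\<tau>}" for t
    proof -
      have sub: "{min 0 t..max 0 t} \<subseteq> {-\<tau>..\<tau>}"
        by (rule min_max_subset[OF t])
      have "b (reg n (traj E 0 g t)) = oriented_integral 0 t (\<lambda>r. b (reg n (E (- (t - r)) (g r))))"
        unfolding traj_def linear_simps(3)[OF lin] add_0_left
        by (rule oriented_integral_linear[OF bounded_linear_b_reg convolution_integrable[OF L1_on_continuous[OF g] t], symmetric])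
      also have "norm \<dots> \<le> integral {min 0 t..max 0 t} (\<phi> t)"
        unfolding \<phi>_def
        by (intro norm_oriented_integral_le integrable_continuous_interval reg_observation_jointly_continuous
            continuous_intros g' order_refl)
      also have "\<dots> \<le> P t"
        unfolding P_def by (rule integral_subset_le[OF sub]) (auto intro!: integrable_continuous_interval \<phi>_r simp: \<phi>_def)
      finally show ?thesis .
    qed
    have bound: "integral {-\<tau>..\<tau>} (\<lambda>t. (P t)\<^sup>2) \<le> c * (G + 2 * \<tau> * \<epsilon>)\<^sup>2" if \<epsilon>: "0 < \<epsilon>" for \<epsilon>
    proof -
      define w where "w r = norm (g r) + \<epsilon>" for r
      have w_pos: "0 < w r" for r
        using \<epsilon> by (simp add: w_def add_nonneg_pos)
      have w_cont: "continuous_on S w" for S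
        unfolding w_def by (intro continuous_intros g')
      have w_ne: "w r \<noteq> 0" for r
        using w_pos[of r] by simp
      define W where "W = integral {-\<tau>..\<tau>} w"
      have W_eq: "W = G + 2 * \<tau> * \<epsilon>"
        unfolding W_def w_def G_def
        by (subst integral_add) (use \<tau> in \<open>auto intro!: integrable_continuous_interval continuous_on_norm g'\<close>)
      then have W_pos: "0 < W"
        using G \<tau> \<epsilon> by (simp add: add_nonneg_pos)
      have cs: "(P t)\<^sup>2 \<le> W * integral {-\<tau>..\<tau>} (\<lambda>r. (\<phi> t r)\<^sup>2 / w r)" for t
      proof -
        define k where "k = P t / W"
        have "((\<lambda>r. (\<phi> t r)\<^sup>2 / w r - 2 * k * \<phi> t r + k\<^sup>2 * w r) has_integral
            (integral {-\<tau>..\<tau>} (\<lambda>r. (\<phi> t r)\<^sup>2 / w r) - 2 * k * P t + k\<^sup>2 * W)) {-\<tau>..\<tau>}"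
          unfolding P_def W_def
          by (intro has_integral_add has_integral_diff has_integral_mult_right integrable_integral
              integrable_continuous_interval \<phi>_r w_cont continuous_on_divide continuous_on_power) (simp add: w_ne)
        moreover have "0 \<le> (\<phi> t r)\<^sup>2 / w r - 2 * k * \<phi> t r + k\<^sup>2 * w r" for r
        proof -
          have "(\<phi> t r)\<^sup>2 / w r - 2 * k * \<phi> t r + k\<^sup>2 * w r = (\<phi> t r - k * w r)\<^sup>2 / w r"
            using w_ne[of r] by (simp add: power2_eq_square field_simps)
          then show ?thesis
            using w_pos[of r] by simp
        qed
        ultimately have "0 \<le> integral {-\<tau>..\<tau>} (\<lambda>r. (\<phi> t r)\<^sup>2 / w r) - 2 * k * P t + k\<^sup>2 * W"
          by (rule has_integral_nonneg)
        moreover have "2 * k * P t - k\<^sup>2 * W = (P t)\<^sup>2 / W"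
          using W_pos by (simp add: k_def power2_eq_square)
        ultimately have "(P t)\<^sup>2 / W \<le> integral {-\<tau>..\<tau>} (\<lambda>r. (\<phi> t r)\<^sup>2 / w r)"
          by simp
        then show ?thesis
          using W_pos by (simp add: field_simps)
      qed
      have q2: "continuous_on S (\<lambda>p. (\<phi> (fst p) (snd p))\<^sup>2 / w (snd p))" for S
        by (intro continuous_on_divide continuous_on_power \<phi>2)
          (auto intro!: continuous_on_compose2[OF w_cont[of UNIV]] continuous_intros simp: w_ne)
      have "integral {-\<tau>..\<tau>} (\<lambda>t. (P t)\<^sup>2) \<le> integral {-\<tau>..\<tau>} (\<lambda>t. W * integral {-\<tau>..\<tau>} (\<lambda>r. (\<phi> t r)\<^sup>2 / w r))"
      proof (rule integral_le)
        show "(\<lambda>t. (P t)\<^sup>2) integrable_on {-\<tau>..\<tau>}"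
          by (intro integrable_continuous_interval continuous_on_power P_cont)
        show "(\<lambda>t. W * integral {-\<tau>..\<tau>} (\<lambda>r. (\<phi> t r)\<^sup>2 / w r)) integrable_on {-\<tau>..\<tau>}"
          using integral_continuous_on_param[of "{-\<tau>..\<tau>}" "-\<tau>" \<tau> "\<lambda>t r. (\<phi> t r)\<^sup>2 / w r"] q2
          by (intro integrable_on_mult_right integrable_continuous_interval) (simp add: case_prod_unfold)
      qed (rule cs)
      also have "\<dots> = W * integral {-\<tau>..\<tau>} (\<lambda>t. integral {-\<tau>..\<tau>} (\<lambda>r. (\<phi> t r)\<^sup>2 / w r))"
        by (rule integral_mult_right)
      also have "\<dots> = W * integral {-\<tau>..\<tau>} (\<lambda>r. integral {-\<tau>..\<tau>} (\<lambda>t. (\<phi> t r)\<^sup>2 / w r))"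
        using integral_swap_continuous[of "-\<tau>" "-\<tau>" \<tau> \<tau> "\<lambda>t r. (\<phi> t r)\<^sup>2 / w r"] q2
        by (simp add: case_prod_unfold)
      also have "\<dots> \<le> W * integral {-\<tau>..\<tau>} (\<lambda>r. c * norm (g r))"
      proof (intro mult_left_mono integral_le)
        show "(\<lambda>r. integral {-\<tau>..\<tau>} (\<lambda>t. (\<phi> t r)\<^sup>2 / w r)) integrable_on {-\<tau>..\<tau>}"
        proof (rule integrable_continuous_interval)
          have "continuous_on S (\<lambda>p. (\<phi> (snd p) (fst p))\<^sup>2 / w (fst p))" for S
            using continuous_on_compose2[OF q2[of UNIV], of S "\<lambda>p. (snd p, fst p)"] by (simp add: continuous_intros)
          then show "continuous_on {-\<tau>..\<tau>} (\<lambda>r. integral {-\<tau>..\<tau>} (\<lambda>t. (\<phi> t r)\<^sup>2 / w r))"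
            using integral_continuous_on_param[of "{-\<tau>..\<tau>}" "-\<tau>" \<tau> "\<lambda>r t. (\<phi> t r)\<^sup>2 / w r"]
            by (simp add: case_prod_unfold)
        qed
        show "(\<lambda>r. c * norm (g r)) integrable_on {-\<tau>..\<tau>}"
          by (intro integrable_continuous_interval continuous_intros g')
        show "0 \<le> W"
          using W_pos by simp
        fix r
        assume r: "r \<in> {-\<tau>..\<tau>}"
        have "integral {-\<tau>..\<tau>} (\<lambda>t. (\<phi> t r)\<^sup>2) = integral {-\<tau> - r..\<tau> - r} (\<lambda>s. (norm (b (reg n (E (- s) (g r)))))\<^sup>2)"
          using integral_shift_Icc_real[of "-\<tau>" \<tau> "\<lambda>s. (norm (b (reg n (E (- s) (g r)))))\<^sup>2" "- r"]
          by (simp add: \<phi>_def o_def add.commute)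
        also have "\<dots> \<le> integral {-(2*\<tau>)..2*\<tau>} (\<lambda>s. (norm (b (reg n (E (- s) (g r)))))\<^sup>2)"
          using r by (intro integral_subset_le integrable_continuous_interval continuous_on_power continuous_on_norm
              reg_observation_jointly_continuous continuous_intros) auto
        also have "\<dots> \<le> c * (norm (g r))\<^sup>2"
          by (rule c)
        also have "\<dots> \<le> c * (norm (g r) * w r)"
          using \<epsilon> c(1) by (intro mult_left_mono) (simp_all add: w_def power2_eq_square distrib_left)
        finally have "integral {-\<tau>..\<tau>} (\<lambda>t. (\<phi> t r)\<^sup>2) / w r \<le> c * norm (g r)"
          using w_pos[of r] by (simp add: pos_divide_le_eq mult.assoc)
        then show "integral {-\<tau>..\<tau>} (\<lambda>t. (\<phi> t r)\<^sup>2 / w r) \<le> c * norm (g r)"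
          by simp
      qed
      also have "\<dots> = W * (c * G)"
        by (simp add: G_def)
      also have "\<dots> \<le> W * (c * W)"
        using W_pos c(1) \<tau> \<epsilon> unfolding W_eq by (intro mult_left_mono) auto
      finally show ?thesis
        by (simp add: W_eq power2_eq_square mult.left_commute)
    qed
    have "integral {-\<tau>..\<tau>} (\<lambda>t. (norm (b (reg n (traj E 0 g t))))\<^sup>2) \<le> integral {-\<tau>..\<tau>} (\<lambda>t. (P t)\<^sup>2)"
      by (intro integral_le integrable_continuous_interval continuous_on_power continuous_on_norm P_cont
          bounded_linear.continuous_on[OF bounded_linear_b_reg] traj_continuous g power_mono f_le) auto
    also have "\<dots> \<le> c * G\<^sup>2"
    proof (rule LIMSEQ_le_const)
      have "(\<lambda>k. c * (G + 2 * \<tau> * (1 / real (Suc k)))\<^sup>2) \<longlonglongrightarrow> c * (G + 2 * \<tau> * 0)\<^sup>2"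
        by (intro tendsto_intros LIMSEQ_Suc[OF lim_1_over_n])
      then show "(\<lambda>k. c * (G + 2 * \<tau> * (1 / real (Suc k)))\<^sup>2) \<longlonglongrightarrow> c * G\<^sup>2"
        by simp
      show "\<exists>N. \<forall>k\<ge>N. integral {-\<tau>..\<tau>} (\<lambda>t. (P t)\<^sup>2) \<le> c * (G + 2 * \<tau> * (1 / real (Suc k)))\<^sup>2"
        by (intro exI allI impI bound) simp
    qed
    finally show ?thesis
      by (simp add: G_def)
  qed
  then show ?thesis
    using that c(1) by blast
qed

lemma reg_traj_observation_bound:
  assumes \<tau>: "0 < \<tau>"
  obtains c where "0 \<le> c" "\<And>n y g. continuous_on UNIV g \<Longrightarrow>
    integral {-\<tau>..\<tau>} (\<lambda>t. (norm (b (reg n (traj E y g t))))\<^sup>2) \<le> c * (norm y + integral {-\<tau>..\<tau>} (\<lambda>r. norm (g r)))\<^sup>2"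
proof -
  obtain c1 where c1: "0 \<le> c1" "\<And>n x. integral {-\<tau>..\<tau>} (\<lambda>t. (norm (b (reg n (E (- t) x))))\<^sup>2) \<le> c1 * (norm x)\<^sup>2"
    using admissible_reg[OF \<tau>] by blast
  obtain c2 where c2: "0 \<le> c2" "\<And>n g. continuous_on UNIV g \<Longrightarrow>
    integral {-\<tau>..\<tau>} (\<lambda>t. (norm (b (reg n (traj E 0 g t))))\<^sup>2) \<le> c2 * (integral {-\<tau>..\<tau>} (\<lambda>r. norm (g r)))\<^sup>2"
    using convolution_observation_bound[OF \<tau>] by blast
  have "integral {-\<tau>..\<tau>} (\<lambda>t. (norm (b (reg n (traj E y g t))))\<^sup>2)
      \<le> (2 * c1 + 2 * c2) * (norm y + integral {-\<tau>..\<tau>} (\<lambda>r. norm (g r)))\<^sup>2"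
    if g: "continuous_on UNIV g" for n y g
  proof -
    define G where "G = integral {-\<tau>..\<tau>} (\<lambda>r. norm (g r))"
    have G: "0 \<le> G"
      unfolding G_def by (rule integral_nonneg)
        (auto intro!: integrable_continuous_interval continuous_on_norm continuous_on_subset[OF g])
    have i1: "(\<lambda>t. (norm (b (reg n (traj E y g t))))\<^sup>2) integrable_on {-\<tau>..\<tau>}" for y
      by (intro integrable_continuous_interval continuous_on_power continuous_on_norm
          bounded_linear.continuous_on[OF bounded_linear_b_reg] traj_continuous g)
    have i2: "(\<lambda>t. (norm (b (reg n (E (- t) y))))\<^sup>2) integrable_on {-\<tau>..\<tau>}"
      by (intro integrable_continuous_interval continuous_on_power continuous_on_norm
          reg_observation_jointly_continuous continuous_intros)
    have split: "b (reg n (traj E y g t)) = b (reg n (E (- t) y)) + b (reg n (traj E 0 g t))" for t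
      by (simp add: traj_def linear_simps(3)[OF lin] linear_simps(1)[OF bounded_linear_b_reg])
    have "integral {-\<tau>..\<tau>} (\<lambda>t. (norm (b (reg n (traj E y g t))))\<^sup>2)
      \<le> integral {-\<tau>..\<tau>} (\<lambda>t. 2 * (norm (b (reg n (E (- t) y))))\<^sup>2 + 2 * (norm (b (reg n (traj E 0 g t))))\<^sup>2)"
      using i1[of 0] i2 by (intro integral_le i1 integrable_add integrable_on_mult_right) (auto simp: split norm_sq_add_le)
    also have "\<dots> = 2 * integral {-\<tau>..\<tau>} (\<lambda>t. (norm (b (reg n (E (- t) y))))\<^sup>2)
      + 2 * integral {-\<tau>..\<tau>} (\<lambda>t. (norm (b (reg n (traj E 0 g t))))\<^sup>2)"
      by (subst integral_add) (auto intro!: integrable_on_mult_right i1 i2)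
    also have "\<dots> \<le> 2 * (c1 * (norm y)\<^sup>2) + 2 * (c2 * G\<^sup>2)"
      using c1(2)[of n y] c2(2)[OF g, of n] by (simp add: G_def)
    also have "\<dots> \<le> 2 * (c1 * (norm y + G)\<^sup>2) + 2 * (c2 * (norm y + G)\<^sup>2)"
      using c1 c2 G by (intro add_mono mult_left_mono power_mono) auto
    finally show ?thesis
      by (simp add: G_def algebra_simps)
  qed
  then show ?thesis
    using that[of "2 * c1 + 2 * c2"] c1(1) c2(1) by simp
qed

text \<open>
  The estimate that makes the extension by density possible. The data are approximated by continuous
  ones and regularised, so that the previous bound applies; both approximations are removed by
  dominated convergence, since they converge pointwise on the interval.
\<close>

lemma traj_observation_bound:
  assumes \<tau>: "0 < \<tau>"
  obtains c where "0 \<le> c" "\<And>y g. y \<in> D \<Longrightarrow> L1_graph_on D F {-\<tau>..\<tau>} g \<Longrightarrow>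
    (\<lambda>t. (norm (b (traj E y g t)))\<^sup>2) integrable_on {-\<tau>..\<tau>} \<and>
    integral {-\<tau>..\<tau>} (\<lambda>t. (norm (b (traj E y g t)))\<^sup>2) \<le> c * (norm y + integral {-\<tau>..\<tau>} (\<lambda>r. norm (g r)))\<^sup>2"
proof -
  obtain c where c: "0 \<le> c" "\<And>n y g. continuous_on UNIV g \<Longrightarrow>
    integral {-\<tau>..\<tau>} (\<lambda>t. (norm (b (reg n (traj E y g t))))\<^sup>2) \<le> c * (norm y + integral {-\<tau>..\<tau>} (\<lambda>r. norm (g r)))\<^sup>2"
    using reg_traj_observation_bound[OF \<tau>] by blast
  obtain M0 where M0: "0 < M0" "\<And>t x. t \<in> {-\<tau>..\<tau>} \<Longrightarrow> norm (E t x) \<le> M0 * norm x"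
    using locally_bounded by blast
  obtain M1 where M1: "0 < M1" "\<And>g t. L1_on {-\<tau>..\<tau>} g \<Longrightarrow> t \<in> {-\<tau>..\<tau>} \<Longrightarrow>
    norm (oriented_integral 0 t (\<lambda>r. E (- (t - r)) (g r))) \<le> M1 * integral {-\<tau>..\<tau>} (\<lambda>r. norm (g r))"
    using convolution_bound by blast
  have traj_bound: "norm (traj E y g t) \<le> M0 * norm y + M1 * integral {-\<tau>..\<tau>} (\<lambda>r. norm (g r))"
    if "L1_on {-\<tau>..\<tau>} g" "t \<in> {-\<tau>..\<tau>}" for y g t
    unfolding traj_def using that by (intro norm_triangle_le add_mono M0 M1) auto
  obtain M2 where M2: "0 < M2" "\<And>n x. norm (reg n x) \<le> M2 * norm x"
    using reg_bounded by blast
  obtain K where K: "0 < K" "\<And>x. x \<in> D \<Longrightarrow> norm (b x) \<le> K * (norm x + norm (F x))"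
    using b_bound by blast
  have "(\<lambda>t. (norm (b (traj E y g t)))\<^sup>2) integrable_on {-\<tau>..\<tau>} \<and>
    integral {-\<tau>..\<tau>} (\<lambda>t. (norm (b (traj E y g t)))\<^sup>2) \<le> c * (norm y + integral {-\<tau>..\<tau>} (\<lambda>r. norm (g r)))\<^sup>2"
    if y: "y \<in> D" and g: "L1_graph_on D F {-\<tau>..\<tau>} g" for y g
  proof -
    define \<G> where "\<G> = integral {-\<tau>..\<tau>} (\<lambda>r. norm (g r))"
    note L1 = L1_graph_on_imp[OF g]
    have "\<exists>ck. continuous_on UNIV ck \<and> integral {-\<tau>..\<tau>} (\<lambda>t. norm (g t - ck t)) \<le> 1 / real (Suc k)" for k
      using L1_on_approx[OF L1(1), of "1 / real (Suc k)"] by auto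
    then obtain C where C: "\<And>k. continuous_on UNIV (C k)"
      and C_int: "\<And>k. integral {-\<tau>..\<tau>} (\<lambda>t. norm (g t - C k t)) \<le> 1 / real (Suc k)"
      by metis
    have gC: "L1_on {-\<tau>..\<tau>} (\<lambda>t. g t - C k t)" for k
      by (intro L1_on_diff L1 L1_on_continuous C)
    have C_norm: "integral {-\<tau>..\<tau>} (\<lambda>t. norm (C k t)) \<le> \<G> + 1 / real (Suc k)" for k
    proof -
      have i: "(\<lambda>t. norm (g t)) integrable_on {-\<tau>..\<tau>}" "(\<lambda>t. norm (g t - C k t)) integrable_on {-\<tau>..\<tau>}"
        "(\<lambda>t. norm (C k t)) integrable_on {-\<tau>..\<tau>}"
        using L1(1) gC[of k] L1_on_continuous[OF C] by (simp_all add: L1_on_def)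
      have "integral {-\<tau>..\<tau>} (\<lambda>t. norm (C k t)) \<le> integral {-\<tau>..\<tau>} (\<lambda>t. norm (g t) + norm (g t - C k t))"
        by (intro integral_le i integrable_add) (metis norm_minus_commute norm_triangle_sub)
      also have "\<dots> = \<G> + integral {-\<tau>..\<tau>} (\<lambda>t. norm (g t - C k t))"
        unfolding \<G>_def by (intro integral_add i)
      finally show ?thesis
        using C_int[of k] by simp
    qed
    have C_lim: "(\<lambda>k. traj E y (C k) t) \<longlonglongrightarrow> traj E y g t" if t: "t \<in> {-\<tau>..\<tau>}" for t
    proof -
      have "norm (traj E y (C k) t - traj E y g t) \<le> M1 * (1 / real (Suc k))" for k
      proof -
        have "norm (traj E y (C k) t - traj E y g t) = norm (traj E (y - y) (\<lambda>r. g r - C k r) t)"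
          by (subst traj_diff[OF L1(1) L1_on_continuous[OF C] t, symmetric]) (rule norm_minus_commute)
        also have "\<dots> \<le> M0 * norm (y - y) + M1 * integral {-\<tau>..\<tau>} (\<lambda>r. norm (g r - C k r))"
          by (rule traj_bound[OF gC t])
        also have "\<dots> \<le> M1 * (1 / real (Suc k))"
          using mult_left_mono[OF C_int[of k], of M1] M1(1) by simp
        finally show ?thesis .
      qed
      moreover have "(\<lambda>k. M1 * (1 / real (Suc k))) \<longlonglongrightarrow> M1 * 0"
        by (intro tendsto_intros LIMSEQ_Suc[OF lim_1_over_n])
      ultimately have "(\<lambda>k. traj E y (C k) t - traj E y g t) \<longlonglongrightarrow> 0"
        by (intro Lim_null_comparison[of "\<lambda>k. traj E y (C k) t - traj E y g t"]) auto
      then show ?thesis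
        by (rule Lim_null[THEN iffD2])
    qed
    have step1: "(\<lambda>t. (norm (b (reg n (traj E y g t))))\<^sup>2) integrable_on {-\<tau>..\<tau>} \<and>
      integral {-\<tau>..\<tau>} (\<lambda>t. (norm (b (reg n (traj E y g t))))\<^sup>2) \<le> c * (norm y + \<G>)\<^sup>2" for n
    proof -
      obtain B where B: "\<And>x. norm (b (reg n x)) \<le> norm x * B" "0 < B"
        using bounded_linear.pos_bounded[OF bounded_linear_b_reg] by blast
      have int: "(\<lambda>t. (norm (b (reg n (traj E y (C k) t))))\<^sup>2) integrable_on {-\<tau>..\<tau>}" for k
        by (intro integrable_continuous_interval continuous_on_power continuous_on_norm
            bounded_linear.continuous_on[OF bounded_linear_b_reg] traj_continuous C)
      have dom: "norm ((norm (b (reg n (traj E y (C k) t))))\<^sup>2) \<le> ((M0 * norm y + M1 * (\<G> + 1)) * B)\<^sup>2"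
        if t: "t \<in> {-\<tau>..\<tau>}" for k t
      proof -
        have "integral {-\<tau>..\<tau>} (\<lambda>t. norm (C k t)) \<le> \<G> + 1"
          using C_norm[of k] by (rule order_trans) simp
        then have "norm (traj E y (C k) t) \<le> M0 * norm y + M1 * (\<G> + 1)"
          using traj_bound[OF L1_on_continuous[OF C] t, of y k] M1(1)
          by (smt (verit) mult_left_mono)
        then have "norm (b (reg n (traj E y (C k) t))) \<le> (M0 * norm y + M1 * (\<G> + 1)) * B"
          using B(1)[of "traj E y (C k) t"] B(2) by (smt (verit) mult_right_mono)
        then show ?thesis
          by (simp add: power_mono)
      qed
      have lim: "(\<lambda>k. (norm (b (reg n (traj E y (C k) t))))\<^sup>2) \<longlonglongrightarrow> (norm (b (reg n (traj E y g t))))\<^sup>2"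
        if t: "t \<in> {-\<tau>..\<tau>}" for t
        by (intro tendsto_intros bounded_linear.tendsto[OF bounded_linear_b_reg] C_lim t)
      note dc = dominated_convergence[OF int integrable_const_ivl dom lim]
      have "integral {-\<tau>..\<tau>} (\<lambda>t. (norm (b (reg n (traj E y g t))))\<^sup>2) \<le> c * (norm y + (\<G> + 0))\<^sup>2"
      proof (rule LIMSEQ_le[OF dc(2)])
        show "(\<lambda>k. c * (norm y + (\<G> + 1 / real (Suc k)))\<^sup>2) \<longlonglongrightarrow> c * (norm y + (\<G> + 0))\<^sup>2"
          by (intro tendsto_intros LIMSEQ_Suc[OF lim_1_over_n])
        have "integral {-\<tau>..\<tau>} (\<lambda>t. (norm (b (reg n (traj E y (C k) t))))\<^sup>2) \<le> c * (norm y + (\<G> + 1 / real (Suc k)))\<^sup>2" for k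
        proof (rule order_trans[OF c(2)[OF C]])
          have "0 \<le> integral {-\<tau>..\<tau>} (\<lambda>t. norm (C k t))"
            using L1_on_continuous[OF C] by (intro integral_nonneg) (simp_all add: L1_on_def)
          then show "c * (norm y + integral {-\<tau>..\<tau>} (\<lambda>r. norm (C k r)))\<^sup>2 \<le> c * (norm y + (\<G> + 1 / real (Suc k)))\<^sup>2"
            using C_norm[of k] c(1) by (intro mult_left_mono power_mono) auto
        qed
        then show "\<exists>N. \<forall>k\<ge>N. integral {-\<tau>..\<tau>} (\<lambda>t. (norm (b (reg n (traj E y (C k) t))))\<^sup>2) \<le> c * (norm y + (\<G> + 1 / real (Suc k)))\<^sup>2"
          by blast
      qed
      then show ?thesis
        using dc(1) by simp
    qed
    define Q where "Q = M0 * norm y + M1 * \<G> + (M0 * norm (F y) + M1 * integral {-\<tau>..\<tau>} (\<lambda>r. norm (F (g r))))"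
    have F_reg_traj: "F (reg n (traj E y g t)) = reg n (traj E (F y) (\<lambda>r. F (g r)) t)" if t: "t \<in> {-\<tau>..\<tau>}" for n t
      using traj_graph[OF y g t] by (simp add: F_reg)
    have dom: "norm ((norm (b (reg n (traj E y g t))))\<^sup>2) \<le> (K * (M2 * Q))\<^sup>2" if t: "t \<in> {-\<tau>..\<tau>}" for n t
    proof -
      let ?u = "traj E y g t" and ?v = "traj E (F y) (\<lambda>r. F (g r)) t"
      have "norm (b (reg n ?u)) \<le> K * (norm (reg n ?u) + norm (reg n ?v))"
        using K(2)[OF reg_mem, of n ?u] by (simp add: F_reg_traj[OF t])
      also have "\<dots> \<le> K * (M2 * norm ?u + M2 * norm ?v)"
        using K(1) by (intro mult_left_mono add_mono M2) auto
      also have "\<dots> \<le> K * (M2 * Q)"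
        using K(1) M2(1) traj_bound[OF L1(1) t, of y] traj_bound[OF L1(2) t, of "F y"]
        unfolding Q_def \<G>_def distrib_left[of M2, symmetric] by (intro mult_left_mono add_mono) auto
      finally show ?thesis
        by (simp add: power_mono)
    qed
    have lim: "(\<lambda>n. (norm (b (reg n (traj E y g t))))\<^sup>2) \<longlonglongrightarrow> (norm (b (traj E y g t)))\<^sup>2" if t: "t \<in> {-\<tau>..\<tau>}" for t
      using traj_graph[OF y g t] F_reg_traj[OF t]
      by (intro tendsto_intros b_tendsto reg_mem) (simp_all add: reg_tendsto)
    note dc = dominated_convergence[OF conjunct1[OF step1] integrable_const_ivl dom lim]
    have "integral {-\<tau>..\<tau>} (\<lambda>t. (norm (b (traj E y g t)))\<^sup>2) \<le> c * (norm y + \<G>)\<^sup>2"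
      using step1 by (intro LIMSEQ_le_const2[OF dc(2)]) auto
    then show ?thesis
      using dc(1) by (simp add: \<G>_def)
  qed
  then show ?thesis
    using that c(1) by blast
qed

lemma observation_traj_diff:
  assumes "y1 \<in> D" "L1_graph_on D F {-\<tau>..\<tau>} g1" "y2 \<in> D" "L1_graph_on D F {-\<tau>..\<tau>} g2" "t \<in> {-\<tau>..\<tau>}"
  shows "b (traj E y1 g1 t) - b (traj E y2 g2 t) = b (traj E (y1 - y2) (\<lambda>r. g1 r - g2 r) t)"
  using traj_diff[OF L1_graph_on_imp(1)[OF assms(2)] L1_graph_on_imp(1)[OF assms(4)] assms(5)]
    b_diff[OF traj_graph(1)[OF assms(1,2,5)] traj_graph(1)[OF assms(3,4,5)]] by simp

text \<open>
  Regularised data are admissible and give continuous observations, which are Cauchy in \<open>L\<^sup>2\<close> on every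
  bounded interval by the bound above. Their limit is also the limit for any other approximating
  sequence, because that sequence is compared with the regularised one by the same bound. The integral
  of a function that is not integrable is \<open>0\<close>, which makes that case of the comparison trivial.
\<close>

lemma obs_ext_exists:
  assumes g: "continuous_on UNIV g"
  shows "\<exists>z. is_obs_ext Y D F E b y0 g z"
proof -
  define f where "f n t = b (reg n (traj E y0 g t))" for n t
  define \<delta> where "\<delta> \<tau> n = norm (reg n y0 - y0) + integral {-\<tau>..\<tau>} (\<lambda>r. norm (reg n (g r) - g r))" for \<tau> n
  have \<delta>_lim: "\<delta> \<tau> \<longlonglongrightarrow> 0" for \<tau>
  proof -
    have "\<delta> \<tau> \<longlonglongrightarrow> norm (y0 - y0) + 0"
      unfolding \<delta>_def by (intro tendsto_intros reg_tendsto reg_integral_tendsto g)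
    then show ?thesis
      by simp
  qed
  have f_cont: "continuous_on UNIV (f n)" for n
    unfolding f_def by (intro bounded_linear.continuous_on[OF bounded_linear_b_reg] traj_continuous g)
  have f_eq: "f n t = b (traj E (reg n y0) (\<lambda>r. reg n (g r)) t)" if "t \<in> {-\<tau>..\<tau>}" for n t \<tau>
    unfolding f_def by (simp add: reg_traj[OF L1_on_continuous[OF g] that])
  have reg_L1: "L1_on {-\<tau>..\<tau>} (\<lambda>r. reg n (g r) - g r)" for n \<tau>
    by (intro L1_on_continuous continuous_intros bounded_linear.continuous_on[OF bounded_linear_reg] g)
  have \<delta>_int: "integral {-\<tau>..\<tau>} (\<lambda>r. norm (u r - reg n (g r))) \<le>
      integral {-\<tau>..\<tau>} (\<lambda>r. norm (u r - g r)) + integral {-\<tau>..\<tau>} (\<lambda>r. norm (reg n (g r) - g r))"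
    if u: "L1_on {-\<tau>..\<tau>} u" for u n \<tau>
  proof -
    have i: "(\<lambda>r. norm (u r - g r)) integrable_on {-\<tau>..\<tau>}" "(\<lambda>r. norm (reg n (g r) - g r)) integrable_on {-\<tau>..\<tau>}"
      "(\<lambda>r. norm (u r - reg n (g r))) integrable_on {-\<tau>..\<tau>}"
      using L1_on_diff[OF u L1_on_continuous[OF g]] reg_L1[of \<tau> n]
        L1_on_diff[OF u L1_graph_on_imp(1)[OF L1_graph_on_reg[OF g, of \<tau> n]]] by (simp_all add: L1_on_def)
    have "integral {-\<tau>..\<tau>} (\<lambda>r. norm (u r - reg n (g r))) \<le>
      integral {-\<tau>..\<tau>} (\<lambda>r. norm (u r - g r) + norm (reg n (g r) - g r))"
    proof (intro integral_le i integrable_add)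
      show "norm (u r - reg n (g r)) \<le> norm (u r - g r) + norm (reg n (g r) - g r)" for r
        using norm_triangle_ineq4[of "u r - g r" "reg n (g r) - g r"] by simp
    qed
    then show ?thesis
      by (simp add: integral_add i)
  qed
  have cauchy: "\<exists>N. \<forall>m\<ge>N. \<forall>n\<ge>N. integral {-\<tau>..\<tau>} (\<lambda>t. (norm (f m t - f n t))\<^sup>2) \<le> e"
    if \<tau>: "0 < \<tau>" and e: "0 < e" for \<tau> e
  proof -
    obtain c where c: "0 \<le> c" "\<And>y g. y \<in> D \<Longrightarrow> L1_graph_on D F {-\<tau>..\<tau>} g \<Longrightarrow>
      (\<lambda>t. (norm (b (traj E y g t)))\<^sup>2) integrable_on {-\<tau>..\<tau>} \<and>
      integral {-\<tau>..\<tau>} (\<lambda>t. (norm (b (traj E y g t)))\<^sup>2) \<le> c * (norm y + integral {-\<tau>..\<tau>} (\<lambda>r. norm (g r)))\<^sup>2"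
      using traj_observation_bound[OF \<tau>] by blast
    have "(\<lambda>n. 2 * (c * (\<delta> \<tau> n)\<^sup>2)) \<longlonglongrightarrow> 2 * (c * 0\<^sup>2)"
      by (intro tendsto_intros \<delta>_lim)
    then have "\<forall>\<^sub>F n in sequentially. 2 * (c * (\<delta> \<tau> n)\<^sup>2) < e / 2"
      by (rule order_tendstoD(2)) (use e in simp)
    then obtain N where N: "\<And>n. N \<le> n \<Longrightarrow> 2 * (c * (\<delta> \<tau> n)\<^sup>2) < e / 2"
      by (auto simp: eventually_sequentially)
    have "integral {-\<tau>..\<tau>} (\<lambda>t. (norm (f m t - f n t))\<^sup>2) \<le> e" if mn: "N \<le> m" "N \<le> n" for m n
    proof -
      let ?d = "\<lambda>r. reg m (g r) - reg n (g r)"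
      have "integral {-\<tau>..\<tau>} (\<lambda>t. (norm (f m t - f n t))\<^sup>2)
        = integral {-\<tau>..\<tau>} (\<lambda>t. (norm (b (traj E (reg m y0 - reg n y0) ?d t)))\<^sup>2)"
        by (intro integral_cong)
          (simp add: f_eq observation_traj_diff[OF reg_mem L1_graph_on_reg[OF g] reg_mem L1_graph_on_reg[OF g]])
      also have "\<dots> \<le> c * (norm (reg m y0 - reg n y0) + integral {-\<tau>..\<tau>} (\<lambda>r. norm (?d r)))\<^sup>2"
        by (intro conjunct2[OF c(2)] D_diff reg_mem L1_graph_on_diff L1_graph_on_reg g)
      also have "\<dots> \<le> c * (\<delta> \<tau> m + \<delta> \<tau> n)\<^sup>2"
      proof (intro mult_left_mono power_mono c(1))
        have "norm (reg m y0 - reg n y0) \<le> norm (reg m y0 - y0) + norm (reg n y0 - y0)"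
          using norm_triangle_ineq4[of "reg m y0 - y0" "reg n y0 - y0"] by simp
        then show "norm (reg m y0 - reg n y0) + integral {-\<tau>..\<tau>} (\<lambda>r. norm (?d r)) \<le> \<delta> \<tau> m + \<delta> \<tau> n"
          using \<delta>_int[OF L1_graph_on_imp(1)[OF L1_graph_on_reg[OF g]], of \<tau> m n] by (simp add: \<delta>_def)
        have "(\<lambda>r. norm (?d r)) integrable_on {-\<tau>..\<tau>}"
          using L1_on_diff[OF L1_graph_on_imp(1)[OF L1_graph_on_reg[OF g]] L1_graph_on_imp(1)[OF L1_graph_on_reg[OF g]]]
          by (simp add: L1_on_def)
        then show "0 \<le> norm (reg m y0 - reg n y0) + integral {-\<tau>..\<tau>} (\<lambda>r. norm (?d r))"
          by (simp add: integral_nonneg)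
      qed
      also have "\<dots> \<le> 2 * (c * (\<delta> \<tau> m)\<^sup>2) + 2 * (c * (\<delta> \<tau> n)\<^sup>2)"
      proof -
        have "(\<delta> \<tau> m + \<delta> \<tau> n)\<^sup>2 \<le> 2 * (\<delta> \<tau> m)\<^sup>2 + 2 * (\<delta> \<tau> n)\<^sup>2"
          using norm_sq_add_le[of "\<delta> \<tau> m" "\<delta> \<tau> n"] by simp
        from mult_left_mono[OF this c(1)] show ?thesis
          by (simp add: algebra_simps)
      qed
      also have "\<dots> \<le> e"
        using N[OF mn(1)] N[OF mn(2)] by simp
      finally show ?thesis .
    qed
    then show ?thesis
      by blast
  qed
  have f_mem: "f n t \<in> Y" for n t
    unfolding f_def by (intro b_mem reg_mem)
  obtain z where z: "\<And>t. z t \<in> Y" "\<And>\<tau>. 0 < \<tau> \<Longrightarrow> L2_on {-\<tau>..\<tau>} z"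
    "\<And>\<tau>. 0 < \<tau> \<Longrightarrow> (\<lambda>n. integral {-\<tau>..\<tau>} (\<lambda>t. (norm (f n t - z t))\<^sup>2)) \<longlonglongrightarrow> 0"
    using L2_loc_complete[OF f_cont cauchy Y_closed f_mem] by blast
  have "is_obs_ext Y D F E b y0 g z"
    unfolding is_obs_ext_def
  proof (intro conjI allI impI z)
    fix \<tau> :: real and yn gn
    assume \<tau>: "0 < \<tau>" and "(\<forall>n. yn n \<in> D \<and> L1_graph_on D F {-\<tau>..\<tau>} (gn n)) \<and> yn \<longlonglongrightarrow> y0 \<and>
      (\<lambda>n. integral {-\<tau>..\<tau>} (\<lambda>t. norm (gn n t - g t))) \<longlonglongrightarrow> 0"
    then have yn: "\<And>n. yn n \<in> D" "yn \<longlonglongrightarrow> y0" and gn: "\<And>n. L1_graph_on D F {-\<tau>..\<tau>} (gn n)"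
      "(\<lambda>n. integral {-\<tau>..\<tau>} (\<lambda>t. norm (gn n t - g t))) \<longlonglongrightarrow> 0"
      by auto
    obtain c where c: "0 \<le> c" "\<And>y g. y \<in> D \<Longrightarrow> L1_graph_on D F {-\<tau>..\<tau>} g \<Longrightarrow>
      (\<lambda>t. (norm (b (traj E y g t)))\<^sup>2) integrable_on {-\<tau>..\<tau>} \<and>
      integral {-\<tau>..\<tau>} (\<lambda>t. (norm (b (traj E y g t)))\<^sup>2) \<le> c * (norm y + integral {-\<tau>..\<tau>} (\<lambda>r. norm (g r)))\<^sup>2"
      using traj_observation_bound[OF \<tau>] by blast
    define I where "I n = integral {-\<tau>..\<tau>} (\<lambda>t. (norm (b (traj E (yn n) (gn n) t) - z t))\<^sup>2)" for n
    define R where "R n = 2 * (c * (norm (yn n - reg n y0) + (integral {-\<tau>..\<tau>} (\<lambda>r. norm (gn n r - g r)) +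
        integral {-\<tau>..\<tau>} (\<lambda>r. norm (reg n (g r) - g r))))\<^sup>2) + 2 * integral {-\<tau>..\<tau>} (\<lambda>t. (norm (f n t - z t))\<^sup>2)" for n
    have R_lim: "R \<longlonglongrightarrow> 2 * (c * (norm (y0 - y0) + (0 + 0))\<^sup>2) + 2 * 0"
      unfolding R_def by (intro tendsto_intros yn gn reg_tendsto reg_integral_tendsto g z \<tau>)
    have I_le: "norm (I n) \<le> R n" for n
    proof -
      let ?d = "\<lambda>r. gn n r - reg n (g r)"
      let ?D = "\<lambda>t. b (traj E (yn n - reg n y0) ?d t)"
      have D_int: "(\<lambda>t. (norm (?D t))\<^sup>2) integrable_on {-\<tau>..\<tau>} \<and>
          integral {-\<tau>..\<tau>} (\<lambda>t. (norm (?D t))\<^sup>2) \<le> c * (norm (yn n - reg n y0) + integral {-\<tau>..\<tau>} (\<lambda>r. norm (?d r)))\<^sup>2"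
        by (intro c(2) D_diff yn reg_mem L1_graph_on_diff gn L1_graph_on_reg g)
      have fz_int: "(\<lambda>t. (norm (f n t - z t))\<^sup>2) integrable_on {-\<tau>..\<tau>}"
        using L2_on_diff[OF L2_on_continuous[OF f_cont] z(2)[OF \<tau>]] by (simp add: L2_on_def)
      have "c * (norm (yn n - reg n y0) + integral {-\<tau>..\<tau>} (\<lambda>r. norm (?d r)))\<^sup>2
        \<le> c * (norm (yn n - reg n y0) + (integral {-\<tau>..\<tau>} (\<lambda>r. norm (gn n r - g r)) +
            integral {-\<tau>..\<tau>} (\<lambda>r. norm (reg n (g r) - g r))))\<^sup>2"
      proof (intro mult_left_mono power_mono c(1) add_left_mono \<delta>_int L1_graph_on_imp(1)[OF gn(1)])
        have "(\<lambda>r. norm (?d r)) integrable_on {-\<tau>..\<tau>}"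
          using L1_on_diff[OF L1_graph_on_imp(1)[OF gn(1)] L1_graph_on_imp(1)[OF L1_graph_on_reg[OF g]]]
          by (simp add: L1_on_def)
        then show "0 \<le> norm (yn n - reg n y0) + integral {-\<tau>..\<tau>} (\<lambda>r. norm (?d r))"
          by (simp add: integral_nonneg)
      qed
      then have sum_le: "2 * integral {-\<tau>..\<tau>} (\<lambda>t. (norm (?D t))\<^sup>2) + 2 * integral {-\<tau>..\<tau>} (\<lambda>t. (norm (f n t - z t))\<^sup>2) \<le> R n"
        using D_int by (simp add: R_def)
      have nonneg: "0 \<le> integral {-\<tau>..\<tau>} (\<lambda>t. (norm (?D t))\<^sup>2)" "0 \<le> integral {-\<tau>..\<tau>} (\<lambda>t. (norm (f n t - z t))\<^sup>2)"
        using D_int fz_int by (auto intro!: integral_nonneg)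
      show ?thesis
      proof (cases "(\<lambda>t. (norm (b (traj E (yn n) (gn n) t) - z t))\<^sup>2) integrable_on {-\<tau>..\<tau>}")
        case True
        have "I n \<le> integral {-\<tau>..\<tau>} (\<lambda>t. 2 * (norm (?D t))\<^sup>2 + 2 * (norm (f n t - z t))\<^sup>2)"
          unfolding I_def
        proof (rule integral_le[OF True])
          show "(\<lambda>t. 2 * (norm (?D t))\<^sup>2 + 2 * (norm (f n t - z t))\<^sup>2) integrable_on {-\<tau>..\<tau>}"
            using D_int fz_int by (intro integrable_add integrable_on_mult_right) auto
          fix t
          assume t: "t \<in> {-\<tau>..\<tau>}"
          have "?D t = b (traj E (yn n) (gn n) t) - f n t"
            unfolding f_eq[OF t] by (rule observation_traj_diff[OF yn(1) gn(1) reg_mem L1_graph_on_reg[OF g] t, symmetric])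
          then show "(norm (b (traj E (yn n) (gn n) t) - z t))\<^sup>2 \<le> 2 * (norm (?D t))\<^sup>2 + 2 * (norm (f n t - z t))\<^sup>2"
            using norm_sq_add_le[of "?D t" "f n t - z t"] by simp
        qed
        also have "\<dots> = 2 * integral {-\<tau>..\<tau>} (\<lambda>t. (norm (?D t))\<^sup>2) + 2 * integral {-\<tau>..\<tau>} (\<lambda>t. (norm (f n t - z t))\<^sup>2)"
          using D_int fz_int by (subst integral_add) (auto intro: integrable_on_mult_right)
        also have "\<dots> \<le> R n"
          by (rule sum_le)
        finally show ?thesis
          using integral_nonneg[OF True] by (simp add: I_def)
      next
        case False
        then show ?thesis
          using sum_le nonneg by (simp add: I_def not_integrable_integral)
      qed
    qed
    have "I \<longlonglongrightarrow> 0"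
      using R_lim I_le by (intro Lim_null_comparison[of I R]) simp_all
    then show "(\<lambda>n. integral {-\<tau>..\<tau>} (\<lambda>t. (norm (b (traj E (yn n) (gn n) t) - z t))\<^sup>2)) \<longlonglongrightarrow> 0"
      by (simp add: I_def[abs_def])
  qed
  then show ?thesis
    by blast
qed

lemma obs_ext_homogeneous_tendsto:
  assumes z: "is_obs_ext Y D F E b y (\<lambda>_. 0) z" and \<tau>: "0 < \<tau>" and yn: "\<And>n. yn n \<in> D" "yn \<longlonglongrightarrow> y"
  shows "(\<lambda>n. integral {-\<tau>..\<tau>} (\<lambda>t. (norm (b (E (- t) (yn n)) - z t))\<^sup>2)) \<longlonglongrightarrow> 0"
proof -
  have "L1_graph_on D F {-\<tau>..\<tau>} (\<lambda>_. 0)"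
    by (auto simp: L1_graph_on_def zero_mem F_zero intro!: L1_on_continuous)
  then have "(\<lambda>n. integral {-\<tau>..\<tau>} (\<lambda>t. (norm (b (traj E (yn n) (\<lambda>_. 0) t) - z t))\<^sup>2)) \<longlonglongrightarrow> 0"
    using z \<tau> yn unfolding is_obs_ext_def
    by (elim conjE allE[of _ \<tau>] allE[of _ yn] allE[of _ "\<lambda>_ _. 0"] impE) auto
  moreover have "traj E (yn n) (\<lambda>_. 0) t = E (- t) (yn n)" for n t
    by (simp add: traj_def linear_simps(3)[OF lin] oriented_integral_def)
  ultimately show ?thesis
    by simp
qed

lemma is_obs_ext_L2: "is_obs_ext Y D F E b y g z \<Longrightarrow> 0 < \<tau> \<Longrightarrow> L2_on {-\<tau>..\<tau>} z"
  by (simp add: is_obs_ext_def)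

text \<open>
  On the domain, constant sequences are admissible approximations. Hence the extension agrees there
  almost everywhere with the observation itself, and so do the Gramians.
\<close>

lemma obs_ext_gramian:
  fixes \<beta> :: "'y \<Rightarrow> 'y \<Rightarrow> 'c::banach"
  assumes \<beta>: "bounded_bilinear \<beta>" and w: "continuous_on {0..T} w" and T: "0 < T"
    and x: "x \<in> D" "is_obs_ext Y D F E b x (\<lambda>_. 0) zx" and y: "y \<in> D" "is_obs_ext Y D F E b y (\<lambda>_. 0) zy"
  shows "integral {0..T} (\<lambda>s. w s *\<^sub>R \<beta> (zx s) (zy s)) = integral {0..T} (\<lambda>s. w s *\<^sub>R \<beta> (b (E (- s) x)) (b (E (- s) y)))"
proof -
  have cont: "continuous_on A (\<lambda>s. b (E (- s) v))" if "v \<in> D" for v A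
    by (intro b_orbit_continuous that continuous_intros)
  have sub: "{0 + 0..T + 0} \<subseteq> {-T..T}"
    using T by auto
  note lim = obs_ext_homogeneous_tendsto[OF _ T, of _ _ "\<lambda>_. _", OF _ _ tendsto_const]
  note X = L2_tendsto_subinterval[OF cont[OF x(1)] is_obs_ext_L2[OF x(2) T] lim[OF x(2,1)] sub, simplified]
  note Y = L2_tendsto_subinterval[OF cont[OF y(1)] is_obs_ext_L2[OF y(2) T] lim[OF y(2,1)] sub, simplified]
  have "(\<lambda>n::nat. integral {0..T} (\<lambda>s. w s *\<^sub>R \<beta> (b (E (- s) x)) (b (E (- s) y))))
      \<longlonglongrightarrow> integral {0..T} (\<lambda>s. w s *\<^sub>R \<beta> (zx s) (zy s))"
    using X Y by (intro integral_bilinear_tendsto(2)[OF \<beta> w cont[OF x(1)] cont[OF y(1)]]) simp_all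
  then show ?thesis
    by (simp add: LIMSEQ_const_iff)
qed

end

section \<open>The variation of constants formula\<close>

text \<open>
  The product rule, with the derivative of the group on the domain of its generator.
\<close>

lemma (in generated_group) moving_orbit_deriv:
  assumes c: "(c has_vector_derivative c') (at r)" and D: "c r \<in> D"
  shows "((\<lambda>s. E s (c s)) has_vector_derivative E r c' + E r (F (c r))) (at r)"
  unfolding has_vector_derivative_iff_quotient
proof -
  have "((\<lambda>h. E (r + h) ((c (r + h) - c r) /\<^sub>R h)) \<longlongrightarrow> E r c') (at 0)"
  proof (rule jointly_tendsto)
    have "((\<lambda>h. r + h) \<longlongrightarrow> r + 0) (at 0)"
      by (intro tendsto_intros)
    then show "((\<lambda>h. r + h) \<longlongrightarrow> r) (at 0)"
      by simp
  qed (rule c[unfolded has_vector_derivative_iff_quotient])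
  moreover have "((\<lambda>h. (E (r + h) (c r) - E r (c r)) /\<^sub>R h) \<longlongrightarrow> E r (F (c r))) (at 0)"
    using orbit_deriv[OF D] unfolding has_vector_derivative_iff_quotient by simp
  ultimately have "((\<lambda>h. E (r + h) ((c (r + h) - c r) /\<^sub>R h) + (E (r + h) (c r) - E r (c r)) /\<^sub>R h)
    \<longlongrightarrow> E r c' + E r (F (c r))) (at 0)"
    by (rule tendsto_add)
  then show "((\<lambda>h. (E (r + h) (c (r + h)) - E r (c r)) /\<^sub>R h) \<longlongrightarrow> E r c' + E r (F (c r))) (at 0)"
    by (simp add: linear_simps(5)[OF lin] linear_simps(2)[OF lin] flip: scaleR_add_right)
qed

text \<open>
  Duhamel's formula for a bounded perturbation: in the derivative of \<open>E s (V s x)\<close> the two occurrences of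
  the generator cancel and only the perturbation remains.
\<close>

lemma (in generated_group) perturbed_orbit_eq_traj:
  assumes V: "generated_group V D (\<lambda>x. - F x - K x)" and K: "bounded_linear K" and x: "x \<in> D"
  shows "traj E x (\<lambda>r. - K (V r x)) t = V t x"
proof -
  interpret V: generated_group V D "\<lambda>x. - F x - K x"
    by (rule V)
  have cont: "continuous_on UNIV (\<lambda>r. - K (V r x))"
    by (intro continuous_on_minus bounded_linear.continuous_on[OF K] V.cont)
  have deriv: "((\<lambda>s. E s (V s x)) has_vector_derivative E r (- K (V r x))) (at r)" for r
  proof -
    have "((\<lambda>t. V t x) has_vector_derivative - F (V r x) - K (V r x)) (at r)"
      using V.orbit_deriv[OF x, of r] V.F_E[OF x, of r] by simp
    from moving_orbit_deriv[OF this V.E_mem[OF x]] show ?thesis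
      by (simp flip: linear_simps(1)[OF lin])
  qed
  have "traj E x (\<lambda>r. - K (V r x)) t = E (- t) x + E (- t) (E t (V t x) - E 0 (V 0 x))"
    unfolding traj_def convolution_eq[OF cont] oriented_integral_ftc[OF deriv] ..
  then show ?thesis
    by (simp add: E_diff E_minus_inverse)
qed

context admissible_observation
begin

text \<open>
  The algebraic Riccati equation of the regularised observation: it is the integral of the derivative
  of \<open>w s\<close> times \<open>\<beta> (b (reg n (E (- s) x))) (b (reg n (E (- s) y)))\<close>.
\<close>

lemma gramian_riccati:
  fixes \<beta> :: "'y \<Rightarrow> 'y \<Rightarrow> 'c::banach"
  assumes a: "bounded_bilinear a" and \<beta>: "bounded_bilinear \<beta>"
    and w: "\<And>s. (w has_vector_derivative w' s) (at s)" and w': "continuous_on UNIV w'"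
    and T: "0 < T" and w0: "w 0 = 1" and wT: "w T = 0"
    and gram: "\<And>x y. x \<in> D \<Longrightarrow> y \<in> D \<Longrightarrow>
      a x y = integral {0..T} (\<lambda>s. w s *\<^sub>R \<beta> (b (E (- s) x)) (b (E (- s) y)))"
    and gram': "\<And>x y. x \<in> D \<Longrightarrow> y \<in> D \<Longrightarrow>
      a (K x) y = - integral {0..T} (\<lambda>s. w' s *\<^sub>R \<beta> (b (E (- s) x)) (b (E (- s) y)))"
    and x: "x \<in> D" and y: "y \<in> D"
  shows "a (reg n (F x)) (reg n y) + a (reg n x) (reg n (F y)) = \<beta> (b (reg n x)) (b (reg n y)) - a (K (reg n x)) (reg n y)"
proof -
  interpret \<beta>: bounded_bilinear \<beta>
    by fact
  define B where "B v s = b (reg n (E (- s) v))" for v s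
  have B_eq: "b (E (- s) (reg n v)) = B v s" for v s
    by (simp add: B_def E_reg)
  have B_cont: "continuous_on A (B v)" for A v
    unfolding B_def[abs_def] by (intro reg_observation_jointly_continuous continuous_intros)
  have w_cont: "continuous_on A w" for A
    using w by (intro continuous_at_imp_continuous_on) (auto intro: has_vector_derivative_continuous)
  have B_deriv: "(B v has_vector_derivative - B (F v) s) (at s)" if "v \<in> D" for v s
  proof -
    have "((\<lambda>s. E (- s) v) has_vector_derivative - E (- s) (F v)) (at s)"
      using has_vector_derivative_reflect[of "\<lambda>t. E t v" "E (0 - s) (F v)" 0 s] orbit_deriv[OF that, of "0 - s"] by simp
    from bounded_linear.has_vector_derivative[OF bounded_linear_b_reg this, of n]
    show ?thesis
      unfolding B_def[abs_def] by (simp add: linear_neg[OF bounded_linear.linear[OF bounded_linear_b_reg]])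
  qed
  have deriv: "((\<lambda>s. w s *\<^sub>R \<beta> (B x s) (B y s)) has_vector_derivative
      (w' s *\<^sub>R \<beta> (B x s) (B y s) - (w s *\<^sub>R \<beta> (B (F x) s) (B y s) + w s *\<^sub>R \<beta> (B x s) (B (F y) s)))) (at s)" for s
    using bounded_bilinear.has_vector_derivative[OF bounded_bilinear_scaleR w
        \<beta>.has_vector_derivative[OF B_deriv[OF x] B_deriv[OF y]], of s]
    by (simp add: \<beta>.minus_left \<beta>.minus_right algebra_simps)
  have int: "(\<lambda>s. w s *\<^sub>R \<beta> (B u s) (B v s)) integrable_on {0..T}"
    "(\<lambda>s. w' s *\<^sub>R \<beta> (B u s) (B v s)) integrable_on {0..T}" for u v
    by (intro integrable_continuous_interval continuous_on_scaleR \<beta>.continuous_on B_cont w_cont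
        continuous_on_subset[OF w' subset_UNIV])+
  have "integral {0..T} (\<lambda>s. w' s *\<^sub>R \<beta> (B x s) (B y s) - (w s *\<^sub>R \<beta> (B (F x) s) (B y s) + w s *\<^sub>R \<beta> (B x s) (B (F y) s)))
    = - \<beta> (B x 0) (B y 0)"
    using integral_interval_ftc[OF deriv, of 0 T] T w0 wT by simp
  moreover have "integral {0..T} (\<lambda>s. w' s *\<^sub>R \<beta> (B x s) (B y s) - (w s *\<^sub>R \<beta> (B (F x) s) (B y s) + w s *\<^sub>R \<beta> (B x s) (B (F y) s)))
    = - a (K (reg n x)) (reg n y) - (a (reg n (F x)) (reg n y) + a (reg n x) (reg n (F y)))"
    by (simp add: integral_diff integral_add integrable_add int gram gram' reg_mem B_eq)
  ultimately show ?thesis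
    by (simp add: B_def algebra_simps)
qed

text \<open>
  The Riccati equation makes the derivative of \<open>r \<mapsto> a (reg n (V r x)) (reg n (E (t - r) y))\<close> equal to
  \<open>- \<beta> (b (reg n (V r x))) (b (reg n (E (t - r) y)))\<close> up to a commutator of \<open>K\<close> and \<open>reg n\<close>.
\<close>

lemma regularised_variation_of_constants:
  fixes \<beta> :: "'y \<Rightarrow> 'y \<Rightarrow> 'c::banach"
  assumes a: "bounded_bilinear a" and \<beta>: "bounded_bilinear \<beta>"
    and riccati: "\<And>x y. x \<in> D \<Longrightarrow> y \<in> D \<Longrightarrow>
      a (reg n (F x)) (reg n y) + a (reg n x) (reg n (F y)) = \<beta> (b (reg n x)) (b (reg n y)) - a (K (reg n x)) (reg n y)"
    and V: "generated_group V D (\<lambda>x. - F x - K x)" and K: "bounded_linear K"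
    and x: "x \<in> D" and y: "y \<in> D"
  shows "a (reg n (V t x)) (reg n y) - a (reg n x) (reg n (E t y)) =
    oriented_integral 0 t (\<lambda>r. a (K (reg n (V r x)) - reg n (K (V r x))) (reg n (E (t - r) y)))
    - oriented_integral 0 t (\<lambda>r. \<beta> (b (reg n (V r x))) (b (reg n (E (t - r) y))))"
proof -
  interpret V: generated_group V D "\<lambda>x. - F x - K x"
    by (rule V)
  interpret a: bounded_bilinear a
    by fact
  interpret \<beta>: bounded_bilinear \<beta>
    by fact
  have V_deriv: "((\<lambda>r. reg n (V r x)) has_vector_derivative reg n (- F (V r x) - K (V r x))) (at r)" for r
    using bounded_linear.has_vector_derivative[OF bounded_linear_reg V.orbit_deriv[OF x, of r], of n] V.F_E[OF x, of r]
    by simp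
  have E_deriv: "((\<lambda>r. reg n (E (t - r) y)) has_vector_derivative - reg n (F (E (t - r) y))) (at r)" for r
  proof -
    have "((\<lambda>r. E (t - r) y) has_vector_derivative - E (t - r) (F y)) (at r)"
      using has_vector_derivative_reflect[of "\<lambda>t. E t y" "E (t - r) (F y)" t r] orbit_deriv[OF y, of "t - r"] by simp
    from bounded_linear.has_vector_derivative[OF bounded_linear_reg this, of n]
    show ?thesis
      by (simp add: F_E y linear_neg[OF bounded_linear.linear[OF bounded_linear_reg]])
  qed
  let ?P = "\<lambda>r. a (K (reg n (V r x)) - reg n (K (V r x))) (reg n (E (t - r) y))"
  let ?Q = "\<lambda>r. \<beta> (b (reg n (V r x))) (b (reg n (E (t - r) y)))"
  have "((\<lambda>r. a (reg n (V r x)) (reg n (E (t - r) y))) has_vector_derivative ?P r - ?Q r) (at r)" for r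
  proof -
    let ?X = "V r x" and ?Y = "E (t - r) y"
    have "a (reg n ?X) (- reg n (F ?Y)) + a (reg n (- F ?X - K ?X)) (reg n ?Y)
      = - (a (reg n (F ?X)) (reg n ?Y) + a (reg n ?X) (reg n (F ?Y))) - a (reg n (K ?X)) (reg n ?Y)"
      by (simp add: linear_simps(2)[OF bounded_linear_reg] linear_neg[OF bounded_linear.linear[OF bounded_linear_reg]]
          a.minus_left a.minus_right a.diff_left)
    also have "\<dots> = ?P r - ?Q r"
      unfolding riccati[OF V.E_mem[OF x] E_mem[OF y]] by (simp add: a.diff_left)
    finally show ?thesis
      using a.has_vector_derivative[OF V_deriv E_deriv, of r] by simp
  qed
  note ftc = oriented_integral_ftc[OF this, of 0 t]
  have X_cont: "continuous_on A (\<lambda>r. V r x)" and Y_cont: "continuous_on A (\<lambda>r. E (t - r) y)" for A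
    by (auto intro!: continuous_on_subset[OF V.cont] jointly_continuous_on continuous_intros)
  have "?P integrable_on {u..v}" "?Q integrable_on {u..v}" for u v
    by (intro integrable_continuous_interval a.continuous_on \<beta>.continuous_on continuous_on_diff X_cont Y_cont
        bounded_linear.continuous_on[OF bounded_linear_reg] bounded_linear.continuous_on[OF K]
        bounded_linear.continuous_on[OF bounded_linear_b_reg])+
  then show ?thesis
    using ftc by (simp add: oriented_integral_diff)
qed

text \<open>
  The limit of the regularised formula for \<open>X n = reg n x\<close> and \<open>Y' n = reg n y\<close>. Since
  \<open>reg n (V r (X n))\<close> is the trajectory with the admissible data \<open>reg n (X n)\<close> and
  \<open>reg n (- K (V r (X n)))\<close>, its observation tends to \<open>zx\<close> in \<open>L\<^sup>2\<close> by the definition of the extension. The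
  commutator tends to \<open>0\<close> boundedly.
\<close>

theorem variation_of_constants:
  fixes \<beta> :: "'y \<Rightarrow> 'y \<Rightarrow> 'c::euclidean_space"
  assumes a: "bounded_bilinear a" and \<beta>: "bounded_bilinear \<beta>"
    and riccati: "\<And>n x y. x \<in> D \<Longrightarrow> y \<in> D \<Longrightarrow>
      a (reg n (F x)) (reg n y) + a (reg n x) (reg n (F y)) = \<beta> (b (reg n x)) (b (reg n y)) - a (K (reg n x)) (reg n y)"
    and V: "generated_group V D (\<lambda>x. - F x - K x)" and K: "bounded_linear K"
    and zx: "is_obs_ext Y D F E b x (\<lambda>r. - K (V r x)) zx" and zy: "is_obs_ext Y D F E b y (\<lambda>_. 0) zy"
  shows "a (V t x) y = a x (E t y) - oriented_integral 0 t (\<lambda>r. \<beta> (zx r) (zy (- (t - r))))"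
proof -
  interpret V: generated_group V D "\<lambda>x. - F x - K x"
    by (rule V)
  interpret a: bounded_bilinear a
    by fact
  interpret K: bounded_linear K
    by fact
  define \<tau> where "\<tau> = \<bar>t\<bar> + 1"
  have \<tau>: "0 < \<tau>"
    by (simp add: \<tau>_def)
  define X where "X n = reg n x" for n
  define Y' where "Y' n = reg n y" for n
  have X: "X n \<in> D" "X \<longlonglongrightarrow> x" and Y': "Y' n \<in> D" "Y' \<longlonglongrightarrow> y" for n
    unfolding X_def Y'_def by (intro reg_mem reg_tendsto tendsto_const)+
  obtain M1 where M1: "0 < M1" "\<And>n x. norm (reg n x) \<le> M1 * norm x"
    using reg_bounded by blast
  obtain M2 where M2: "0 < M2" "\<And>s x. s \<in> {-\<tau>..\<tau>} \<Longrightarrow> norm (V s x) \<le> M2 * norm x"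
    using V.locally_bounded by blast
  obtain M3 where M3: "0 < M3" "\<And>s x. s \<in> {-\<tau>..\<tau>} \<Longrightarrow> norm (E s x) \<le> M3 * norm x"
    using locally_bounded by blast
  obtain M4 where M4: "0 < M4" "\<And>x. norm (K x) \<le> norm x * M4"
    using K.pos_bounded by blast
  obtain M5 where M5: "0 < M5" "\<And>u v. norm (a u v) \<le> norm u * norm v * M5"
    using a.pos_bounded by blast
  have VX: "norm (V r (X n)) \<le> M2 * (M1 * norm x)" if "r \<in> {-\<tau>..\<tau>}" for r n
  proof -
    have "norm (V r (X n)) \<le> M2 * norm (X n)"
      by (rule M2(2)[OF that])
    also have "\<dots> \<le> M2 * (M1 * norm x)"
      unfolding X_def using M2(1) by (intro mult_left_mono M1) auto
    finally show ?thesis .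
  qed
  define N where "N = M4 * (M2 * (M1 * norm x))"
  have KVX: "norm (K (V r (X n))) \<le> N" if "r \<in> {-\<tau>..\<tau>}" for r n
  proof -
    have "norm (K (V r (X n))) \<le> M4 * norm (V r (X n))"
      using M4(2) by (simp add: mult.commute)
    also have "\<dots> \<le> N"
      unfolding N_def using M4(1) by (intro mult_left_mono VX that) auto
    finally show ?thesis .
  qed
  have KVX_lim: "(\<lambda>n. K (V r (X n))) \<longlonglongrightarrow> K (V r x)" for r
    by (intro K.tendsto bounded_linear.tendsto[OF V.lin] X)
  have V_cont: "continuous_on A (\<lambda>r. V r u)" for A u
    by (rule continuous_on_subset[OF V.cont]) simp
  have KV_cont: "continuous_on A (\<lambda>r. K (V r u))" for A u
    by (intro K.continuous_on V_cont)

  have zx_lim: "(\<lambda>n. integral {-\<tau>..\<tau>} (\<lambda>r. (norm (b (reg n (V r (X n))) - zx r))\<^sup>2)) \<longlonglongrightarrow> 0"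
  proof -
    define gn where "gn n r = reg n (- K (V r (X n)))" for n r
    have "(\<lambda>n. integral {-\<tau>..\<tau>} (\<lambda>r. norm (gn n r - (- K (V r x))))) \<longlonglongrightarrow> integral {-\<tau>..\<tau>} (\<lambda>r. 0)"
    proof (rule dominated_convergence(2))
      show "(\<lambda>r. norm (gn n r - (- K (V r x)))) integrable_on {-\<tau>..\<tau>}" for n
        unfolding gn_def by (intro integrable_continuous_interval continuous_on_norm continuous_on_diff continuous_on_minus KV_cont
            bounded_linear.continuous_on[OF bounded_linear_reg])
      show "(\<lambda>r. M1 * N + norm (K (V r x))) integrable_on {-\<tau>..\<tau>}"
        by (intro integrable_continuous_interval continuous_intros KV_cont)
      show "norm (norm (gn n r - (- K (V r x)))) \<le> M1 * N + norm (K (V r x))" if "r \<in> {-\<tau>..\<tau>}" for n r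
      proof -
        have "norm (gn n r) \<le> M1 * norm (K (V r (X n)))"
          unfolding gn_def using M1(2)[of n "- K (V r (X n))"] by simp
        also have "\<dots> \<le> M1 * N"
          using KVX[OF that, of n] M1(1) by simp
        finally show ?thesis
          using norm_triangle_ineq[of "gn n r" "K (V r x)"] by simp
      qed
      fix r
      have "(\<lambda>n. norm (gn n r - (- K (V r x)))) \<longlonglongrightarrow> norm (- K (V r x) - (- K (V r x)))"
        unfolding gn_def by (intro tendsto_norm tendsto_diff reg_tendsto tendsto_minus KVX_lim tendsto_const)
      then show "(\<lambda>n. norm (gn n r - (- K (V r x)))) \<longlonglongrightarrow> 0"
        by simp
    qed
    then have "(\<lambda>n. integral {-\<tau>..\<tau>} (\<lambda>r. norm (gn n r - (- K (V r x))))) \<longlonglongrightarrow> 0"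
      by simp
    moreover have "L1_graph_on D F {-\<tau>..\<tau>} (gn n)" for n
      unfolding gn_def[abs_def] by (intro L1_graph_on_reg continuous_on_minus KV_cont)
    moreover have "reg n (X n) \<in> D" "(\<lambda>n. reg n (X n)) \<longlonglongrightarrow> x" for n
      by (intro reg_mem reg_tendsto X)+
    ultimately have "(\<lambda>n. integral {-\<tau>..\<tau>} (\<lambda>r. (norm (b (traj E (reg n (X n)) (gn n) r) - zx r))\<^sup>2)) \<longlonglongrightarrow> 0"
      using zx \<tau> unfolding is_obs_ext_def
      by (elim conjE allE[of _ \<tau>] allE[of _ "\<lambda>n. reg n (X n)"] allE[of _ gn] impE) blast+
    moreover have "traj E (reg n (X n)) (gn n) r = reg n (V r (X n))" if "r \<in> {-\<tau>..\<tau>}" for n r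
    proof -
      have "continuous_on UNIV (\<lambda>r. - K (V r (X n)))"
        by (intro continuous_on_minus KV_cont)
      from reg_traj[OF L1_on_continuous[OF this] that, of n "X n"] show ?thesis
        unfolding gn_def perturbed_orbit_eq_traj[OF V K X(1)] ..
    qed
    then have "integral {-\<tau>..\<tau>} (\<lambda>r. (norm (b (traj E (reg n (X n)) (gn n) r) - zx r))\<^sup>2)
        = integral {-\<tau>..\<tau>} (\<lambda>r. (norm (b (reg n (V r (X n))) - zx r))\<^sup>2)" for n
      by (intro integral_cong) simp
    ultimately show ?thesis
      by simp
  qed
  have zy_lim: "(\<lambda>n. integral {-\<tau>..\<tau>} (\<lambda>s. (norm (b (reg n (E (- s) (Y' n))) - zy s))\<^sup>2)) \<longlonglongrightarrow> 0"
    using obs_ext_homogeneous_tendsto[OF zy \<tau>, of "\<lambda>n. reg n (Y' n)"] reg_mem reg_tendsto[OF Y'(2)]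
    by (simp add: E_reg)

  let ?I = "{min 0 t..max 0 t}"
  have sub: "{min 0 t + 0..max 0 t + 0} \<subseteq> {-\<tau>..\<tau>}" "{min 0 t + (- t)..max 0 t + (- t)} \<subseteq> {-\<tau>..\<tau>}"
    by (auto simp: \<tau>_def)
  have Xo: "continuous_on UNIV (\<lambda>r. b (reg n (V r (X n))))" for n
    by (intro bounded_linear.continuous_on[OF bounded_linear_b_reg] V.cont)
  have Yo: "continuous_on UNIV (\<lambda>s. b (reg n (E (- s) (Y' n))))" for n
    by (intro reg_observation_jointly_continuous continuous_intros)
  note X2 = L2_tendsto_subinterval[OF Xo is_obs_ext_L2[OF zx \<tau>] zx_lim sub(1), simplified]
  note Y2 = L2_tendsto_subinterval[OF Yo is_obs_ext_L2[OF zy \<tau>] zy_lim sub(2)]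
  have Xc: "continuous_on ?I (\<lambda>r. b (reg n (V r (X n))))" for n
    by (rule continuous_on_subset[OF Xo]) simp
  have Yc: "continuous_on ?I (\<lambda>r. b (reg n (E (- (- t + r)) (Y' n))))" for n
    by (intro reg_observation_jointly_continuous continuous_intros)
  have "(\<lambda>n. integral ?I (\<lambda>r. 1 *\<^sub>R \<beta> (b (reg n (V r (X n)))) (b (reg n (E (- (- t + r)) (Y' n))))))
      \<longlonglongrightarrow> integral ?I (\<lambda>r. 1 *\<^sub>R \<beta> (zx r) (zy (- t + r)))"
    by (rule integral_bilinear_tendsto(2)[OF \<beta> continuous_on_const Xc Yc X2(1) Y2(1) X2(2) Y2(2) X2(3) Y2(3)])
  then have "(\<lambda>n. integral ?I (\<lambda>r. \<beta> (b (reg n (V r (X n)))) (b (reg n (E (t - r) (Y' n))))))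
      \<longlonglongrightarrow> integral ?I (\<lambda>r. \<beta> (zx r) (zy (- (t - r))))"
    by simp
  then have main: "(\<lambda>n. oriented_integral 0 t (\<lambda>r. \<beta> (b (reg n (V r (X n)))) (b (reg n (E (t - r) (Y' n))))))
      \<longlonglongrightarrow> oriented_integral 0 t (\<lambda>r. \<beta> (zx r) (zy (- (t - r))))"
    by (cases "0 \<le> t") (auto simp: oriented_integral_def min_def max_def intro!: tendsto_minus)

  let ?C = "\<lambda>n r. a (K (reg n (V r (X n))) - reg n (K (V r (X n)))) (reg n (E (t - r) (Y' n)))"
  have "(\<lambda>n. integral ?I (?C n)) \<longlonglongrightarrow> integral ?I (\<lambda>r. 0)"
  proof (rule dominated_convergence(2))
    show "?C n integrable_on ?I" for n
      by (intro integrable_continuous_interval a.continuous_on continuous_on_diff K.continuous_on V_cont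
          bounded_linear.continuous_on[OF bounded_linear_reg] jointly_continuous_on continuous_intros)
    show "(\<lambda>r. (M4 * (M1 * (M2 * (M1 * norm x))) + M1 * N) * (M1 * (M3 * (M1 * norm y))) * M5) integrable_on ?I"
      by (rule integrable_const_ivl)
    show "norm (?C n r) \<le> (M4 * (M1 * (M2 * (M1 * norm x))) + M1 * N) * (M1 * (M3 * (M1 * norm y))) * M5"
      if r: "r \<in> ?I" for n r
    proof -
      have r1: "r \<in> {-\<tau>..\<tau>}" and r2: "t - r \<in> {-\<tau>..\<tau>}"
        using r by (auto simp: \<tau>_def min_def max_def split: if_splits)
      have "norm (K (reg n (V r (X n)))) \<le> M4 * norm (reg n (V r (X n)))"
        using M4(2) by (simp add: mult.commute)
      also have "\<dots> \<le> M4 * (M1 * norm (V r (X n)))"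
        using M4(1) by (intro mult_left_mono M1) auto
      also have "\<dots> \<le> M4 * (M1 * (M2 * (M1 * norm x)))"
        using M4(1) M1(1) by (intro mult_left_mono VX r1) auto
      finally have 1: "norm (K (reg n (V r (X n)))) \<le> M4 * (M1 * (M2 * (M1 * norm x)))" .
      have "norm (reg n (K (V r (X n)))) \<le> M1 * norm (K (V r (X n)))"
        by (rule M1)
      also have "\<dots> \<le> M1 * N"
        using M1(1) by (intro mult_left_mono KVX r1) auto
      finally have 2: "norm (K (reg n (V r (X n))) - reg n (K (V r (X n)))) \<le> M4 * (M1 * (M2 * (M1 * norm x))) + M1 * N"
        by (intro norm_triangle_le_diff add_mono 1)
      have "norm (reg n (E (t - r) (Y' n))) \<le> M1 * norm (E (t - r) (Y' n))"
        by (rule M1)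
      also have "\<dots> \<le> M1 * (M3 * norm (Y' n))"
        using M1(1) by (intro mult_left_mono M3 r2) auto
      also have "\<dots> \<le> M1 * (M3 * (M1 * norm y))"
        unfolding Y'_def using M1(1) M3(1) by (intro mult_left_mono M1) auto
      finally have 3: "norm (reg n (E (t - r) (Y' n))) \<le> M1 * (M3 * (M1 * norm y))" .
      have "norm (?C n r) \<le> norm (K (reg n (V r (X n))) - reg n (K (V r (X n)))) * norm (reg n (E (t - r) (Y' n))) * M5"
        by (rule M5)
      also have "\<dots> \<le> (M4 * (M1 * (M2 * (M1 * norm x))) + M1 * N) * (M1 * (M3 * (M1 * norm y))) * M5"
      proof (intro mult_right_mono mult_mono 2 3)
        show "0 \<le> M4 * (M1 * (M2 * (M1 * norm x))) + M1 * N"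
          using 2 norm_ge_zero by (rule order_trans[rotated])
      qed (use M5(1) in auto)
      finally show ?thesis .
    qed
    fix r
    have "(\<lambda>n. ?C n r) \<longlonglongrightarrow> a (K (V r x) - K (V r x)) (E (t - r) y)"
      by (intro a.tendsto tendsto_diff K.tendsto reg_tendsto bounded_linear.tendsto[OF V.lin]
          bounded_linear.tendsto[OF lin] X Y')
    then show "(\<lambda>n. ?C n r) \<longlonglongrightarrow> 0"
      by (simp add: a.zero_left)
  qed
  then have comm: "(\<lambda>n. oriented_integral 0 t (?C n)) \<longlonglongrightarrow> 0"
    using tendsto_minus[of "\<lambda>n. integral ?I (?C n)" 0 sequentially]
    by (cases "0 \<le> t") (simp_all add: oriented_integral_def min_def max_def)
  have "(\<lambda>n. a (reg n (V t (X n))) (reg n (Y' n)) - a (reg n (X n)) (reg n (E t (Y' n)))) \<longlonglongrightarrow> a (V t x) y - a x (E t y)"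
    by (intro tendsto_diff a.tendsto reg_tendsto bounded_linear.tendsto[OF V.lin] bounded_linear.tendsto[OF lin] X Y')
  moreover have "(\<lambda>n. a (reg n (V t (X n))) (reg n (Y' n)) - a (reg n (X n)) (reg n (E t (Y' n))))
      \<longlonglongrightarrow> 0 - oriented_integral 0 t (\<lambda>r. \<beta> (zx r) (zy (- (t - r))))"
  proof -
    have "a (reg n (V t (X n))) (reg n (Y' n)) - a (reg n (X n)) (reg n (E t (Y' n))) = oriented_integral 0 t (?C n)
        - oriented_integral 0 t (\<lambda>r. \<beta> (b (reg n (V r (X n)))) (b (reg n (E (t - r) (Y' n)))))" for n
      by (rule regularised_variation_of_constants[OF a \<beta> riccati V K X(1) Y'(1)])
    then show ?thesis
      using tendsto_diff[OF comm main] by simp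
  qed
  ultimately have "a (V t x) y - a x (E t y) = 0 - oriented_integral 0 t (\<lambda>r. \<beta> (zx r) (zy (- (t - r))))"
    by (rule LIMSEQ_unique)
  then show ?thesis
    by (simp add: algebra_simps)
qed

end

section \<open>Operators on a Hilbert space and on its antidual\<close>

lemma pr_eqI: "(\<And>x. pr x f = pr x g) \<Longrightarrow> f = g"
  by (rule blinfun_eqI) (metis pr_def kconj_kconj)

lemma dscl_of_real: "dscl (of_real r) f = r *\<^sub>R f"
proof (rule blinfun_eqI)
  fix x
  have "bounded_linear (\<lambda>x. of_real r * blinfun_apply f x)"
    by (rule bounded_linear_compose[OF bounded_linear_mult_right blinfun.bounded_linear_right])
  then show "blinfun_apply (dscl (of_real r) f) x = blinfun_apply (r *\<^sub>R f) x"
    by (simp add: dscl_def bounded_linear_Blinfun_apply scaleR_blinfun.rep_eq scaleR_conv_of_real)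
qed

lemma closed_antidual:
  fixes scl :: "'k::rc_field \<Rightarrow> 'h::banach \<Rightarrow> 'h"
  shows "closed (antidual scl)"
proof -
  have "antidual scl = (\<Inter>a. \<Inter>x. {f. blinfun_apply f (scl a x) = kconj a * blinfun_apply f x})"
    by (auto simp: antidual_def)
  moreover have "closed {f :: 'h \<Rightarrow>\<^sub>L 'k. blinfun_apply f (scl a x) = kconj a * blinfun_apply f x}" for a x
    by (intro closed_Collect_eq continuous_intros blinfun.continuous_on)
  ultimately show ?thesis
    by (simp only:) (intro closed_INT ballI)
qed

lemma bounded_op_imp_bounded_linear:
  assumes op: "bounded_op UNIV sX UNIV sY T" and sX: "\<And>r x. sX (of_real r) x = r *\<^sub>R x" and sY: "\<And>r x. sY (of_real r) x = r *\<^sub>R x"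
  shows "bounded_linear T"
proof -
  obtain c where c: "\<And>x. norm (T x) \<le> c * norm x"
    using op by (auto simp: bounded_op_def)
  show ?thesis
  proof (rule bounded_linear_intro)
    show "T (x + y) = T x + T y" for x y
      using op by (simp add: bounded_op_def)
    show "T (r *\<^sub>R x) = r *\<^sub>R T x" for r x
      using op unfolding bounded_op_def sX[symmetric] sY[symmetric] by blast
    show "norm (T x) \<le> norm x * c" for x
      using c[of x] by (simp add: mult.commute)
  qed
qed

context hilbert
begin

lemma bounded_op_bounded_linear: "bounded_op UNIV scl UNIV scl T \<Longrightarrow> bounded_linear T"
  by (rule bounded_op_imp_bounded_linear) (auto simp: scl_of_real)

lemma banach_group_of_C0_group: "C0_group UNIV scl G \<Longrightarrow> banach_group G"
  unfolding banach_group_def C0_group_def using bounded_op_bounded_linear by auto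

lemma pr_riesz_rep: "f \<in> antidual scl \<Longrightarrow> pr x f = ip x (rep f)"
  using pr_riesz[of x "rep f"] by (simp add: riesz_rep)

lemma ip_diff_left: "ip (x - y) z = ip x z - ip y z"
  by (rule bounded_bilinear.diff_left[OF bounded_bilinear_ip])

lemma ip_diff_right: "ip z (x - y) = ip z x - ip z y"
  by (rule bounded_bilinear.diff_right[OF bounded_bilinear_ip])

lemma ip_ext: "(\<And>x. ip x y = ip x z) \<Longrightarrow> y = z"
  by (rule ip_eqI) simp

lemma ip_ext_dense:
  assumes "closure D = UNIV" "\<And>x. x \<in> D \<Longrightarrow> ip x y = ip x z"
  shows "y = z"
proof (rule ip_ext)
  fix x
  have "x \<in> closure D"
    using assms(1) by simp
  then obtain X where X: "\<And>n. X n \<in> D" "X \<longlonglongrightarrow> x"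
    unfolding closure_sequential by blast
  have "(\<lambda>n. ip (X n) y) \<longlonglongrightarrow> ip x y" "(\<lambda>n. ip (X n) z) \<longlonglongrightarrow> ip x z"
    by (intro bounded_bilinear.tendsto[OF bounded_bilinear_ip] X tendsto_const)+
  then show "ip x y = ip x z"
    using assms(2)[OF X(1)] LIMSEQ_unique by auto
qed

lemma adj_riesz:
  assumes "closure D = UNIV" "\<And>x. x \<in> D \<Longrightarrow> ip (T x) y = ip x w"
  shows "adj scl D T (riesz ip y) = riesz ip w"
  unfolding adj_def
proof (rule the_equality)
  show "riesz ip w \<in> antidual scl \<and> (\<forall>x\<in>D. pr (T x) (riesz ip y) = pr x (riesz ip w))"
    using assms(2) by (simp add: riesz_mem pr_riesz)
  fix g
  assume g: "g \<in> antidual scl \<and> (\<forall>x\<in>D. pr (T x) (riesz ip y) = pr x g)"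
  then have "ip x (rep g) = ip x w" if "x \<in> D" for x
    using assms(2)[OF that] that by (simp add: pr_riesz pr_riesz_rep)
  then have "rep g = w"
    using ip_ext_dense[OF assms(1)] by blast
  then show "g = riesz ip w"
    using g by (metis riesz_rep)
qed

lemma hilbert_adjoint_exists:
  assumes "bounded_op UNIV scl UNIV scl T"
  shows "\<exists>T'. \<forall>x y. ip (T x) y = ip x (T' y)"
proof -
  have T: "bounded_linear T" "\<And>a x. T (scl a x) = scl a (T x)"
    using bounded_op_bounded_linear[OF assms] assms by (auto simp: bounded_op_def)
  have "\<exists>w. \<forall>x. ip (T x) y = ip x w" for y
  proof -
    define f where "f = Blinfun (\<lambda>x. kconj (ip (T x) y))"
    have "bounded_linear (\<lambda>x. kconj (ip (T x) y))"
      by (rule bounded_linear_compose[OF bounded_linear_kconj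
            bounded_linear_compose[OF bounded_bilinear.bounded_linear_left[OF bounded_bilinear_ip] T(1)]])
    then have f: "blinfun_apply f x = kconj (ip (T x) y)" for x
      by (simp add: f_def bounded_linear_Blinfun_apply)
    then have "f \<in> antidual scl"
      by (simp add: antidual_def T(2) ip_scl_left kconj_mult)
    then have "ip (T x) y = ip x (rep f)" for x
      using pr_riesz_rep[of f x] by (simp add: pr_def f)
    then show ?thesis
      by blast
  qed
  then show ?thesis
    by metis
qed

lemma adjoint_bounded_linear:
  assumes T: "bounded_linear T" and adj: "\<And>x y. ip (T x) y = ip x (T' y)"
    and M: "\<And>x. norm (T x) \<le> M * norm x"
  shows "bounded_linear T'" "norm (T' y) \<le> M * norm y"
proof -
  have bound: "norm (T' y) \<le> M * norm y" for y
  proof -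
    have "(norm (T' y))\<^sup>2 = ip (T (T' y)) y \<bullet> 1"
      by (simp add: adj inner_one_ip_self)
    also have "\<dots> \<le> norm (T (T' y)) * norm y"
      by (rule inner_one_ip_le)
    also have "\<dots> \<le> M * norm (T' y) * norm y"
      by (intro mult_right_mono M) auto
    finally have *: "norm (T' y) * norm (T' y) \<le> norm (T' y) * (M * norm y)"
      by (simp add: power2_eq_square mult.commute mult.left_commute)
    show ?thesis
    proof (cases "norm (T' y) = 0")
      case True
      have "0 \<le> M * norm y"
        using M[of y] norm_ge_zero[of "T y"] by linarith
      then show ?thesis
        using True by simp
    next
      case False
      then show ?thesis
        using * by simp
    qed
  qed
  show "norm (T' y) \<le> M * norm y"
    by (rule bound)
  show "bounded_linear T'"
  proof (rule bounded_linear_intro)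
    show "T' (x + y) = T' x + T' y" for x y
      by (rule ip_ext) (simp add: ip_add_right flip: adj)
    show "T' (r *\<^sub>R x) = r *\<^sub>R T' x" for r x
      by (rule ip_ext) (simp add: ip_scaleR_right flip: adj)
    show "norm (T' y) \<le> norm y * M" for y
      using bound[of y] by (simp add: mult.commute)
  qed
qed

text \<open>
  The adjoint of a group is strongly continuous as soon as the adjoint of its generator is densely
  defined: on that domain the adjoint orbits are Lipschitz at \<open>0\<close>, since
  \<open>S h x - x = h A (mean h x)\<close>. The same identity gives its generator.
\<close>

lemma adjoint_generated_group:
  assumes S: "generated_group S DA A"
    and adj: "\<And>t x y. ip (S t x) y = ip x (E t y)"
    and D: "\<And>y. y \<in> D \<longleftrightarrow> (\<exists>w. \<forall>x\<in>DA. ip (A x) y = ip x w)"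
    and F: "\<And>x y. y \<in> D \<Longrightarrow> x \<in> DA \<Longrightarrow> ip (A x) y = ip x (F y)"
    and dense: "closure D = UNIV"
  shows "generated_group E D F"
proof -
  interpret S: generated_group S DA A
    by (rule S)
  note dense_DA = S.closure_domain
  obtain M where M: "0 < M" "\<And>t x. t \<in> {-1..1} \<Longrightarrow> norm (S t x) \<le> M * norm x"
    using S.locally_bounded by blast
  have lin: "bounded_linear (E t)" for t
  proof -
    obtain c where "\<And>x. norm (S t x) \<le> norm x * c"
      using bounded_linear.bounded[OF S.lin] by blast
    then show ?thesis
      by (intro adjoint_bounded_linear(1)[OF S.lin adj, of t c]) (simp add: mult.commute)
  qed
  have E_bound: "norm (E t y) \<le> M * norm y" if "t \<in> {-1..1}" for t y
    by (rule adjoint_bounded_linear(2)[OF S.lin adj M(2)[OF that]])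
  have zero: "E 0 y = y" for y
    by (rule ip_ext) (simp flip: adj)
  have add: "E (s + t) y = E s (E t y)" for s t y
    by (rule ip_ext) (simp only: adj[symmetric] S.add S.E_commute[of s t])
  obtain M' where M': "0 < M'" "\<And>h x. 0 < \<bar>h\<bar> \<Longrightarrow> \<bar>h\<bar> \<le> 1 \<Longrightarrow> norm (S.mean h x) \<le> M' * norm x"
    using S.mean_bounded by blast
  have quot: "ip x ((E h y - y) /\<^sub>R h) = ip (S.mean h x) (F y)" if "y \<in> D" "h \<noteq> 0" for h x y
  proof -
    have "ip x ((E h y - y) /\<^sub>R h) = ip ((S h x - x) /\<^sub>R h) y"
      by (simp add: ip_scaleR_right ip_scaleR_left ip_diff_left ip_diff_right adj)
    also have "\<dots> = ip (A (S.mean h x)) y"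
      by (simp add: S.F_mean that)
    finally show ?thesis
      by (simp add: F[OF that(1) S.mean_mem])
  qed
  have lim0: "((\<lambda>h. E h y) \<longlongrightarrow> y) (at 0)" if y: "y \<in> D" for y
  proof -
    have "((\<lambda>h. E h y - y) \<longlongrightarrow> 0) (at 0)"
    proof (rule Lim_null_comparison)
      have "norm (E h y - y) \<le> \<bar>h\<bar> * (M' * norm (F y))" if h: "h \<noteq> 0" "\<bar>h\<bar> \<le> 1" for h
      proof -
        let ?q = "(E h y - y) /\<^sub>R h"
        have "(norm ?q)\<^sup>2 = ip (S.mean h ?q) (F y) \<bullet> 1"
          unfolding quot[OF y h(1), symmetric] by (rule inner_one_ip_self[symmetric])
        also have "\<dots> \<le> norm (S.mean h ?q) * norm (F y)"
          by (rule inner_one_ip_le)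
        also have "\<dots> \<le> (M' * norm ?q) * norm (F y)"
          using h by (intro mult_right_mono M') auto
        finally have "norm ?q * norm ?q \<le> norm ?q * (M' * norm (F y))"
          by (simp add: power2_eq_square ac_simps)
        then have "norm ?q \<le> M' * norm (F y)"
          using M'(1) by (cases "norm ?q = 0") auto
        then have "norm (E h y - y) / \<bar>h\<bar> \<le> M' * norm (F y)"
          by (simp add: divide_inverse_commute)
        then show ?thesis
          using h by (simp add: pos_divide_le_eq mult.commute)
      qed
      then show "\<forall>\<^sub>F h in at 0. norm (E h y - y) \<le> \<bar>h\<bar> * (M' * norm (F y))"
        unfolding eventually_at by (intro exI[of _ 1]) (auto simp: dist_real_def)
      have "((\<lambda>h. \<bar>h\<bar> * (M' * norm (F y))) \<longlongrightarrow> \<bar>0\<bar> * (M' * norm (F y))) (at 0)"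
        by (intro tendsto_intros)
      then show "((\<lambda>h. \<bar>h\<bar> * (M' * norm (F y))) \<longlongrightarrow> 0) (at 0)"
        by simp
    qed
    then show ?thesis
      by (rule Lim_null[THEN iffD2])
  qed
  have lim: "((\<lambda>h. E h y) \<longlongrightarrow> y) (at 0)" for y
  proof (rule tendstoI)
    fix e :: real
    assume e: "0 < e"
    have pos: "0 < e / (2 * (M + 1))"
      using e M(1) by simp
    have "y \<in> closure D"
      using dense by simp
    then obtain y' where y': "y' \<in> D" "dist y' y < e / (2 * (M + 1))"
      unfolding closure_approachable using pos by blast
    have "\<forall>\<^sub>F h in at 0. dist (E h y') y' < e / 2"
      using lim0[OF y'(1)] e by (intro tendstoD) auto
    moreover have "\<forall>\<^sub>F h in at 0. \<bar>h\<bar> \<le> (1::real)"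
      unfolding eventually_at by (intro exI[of _ 1]) (auto simp: dist_real_def)
    ultimately show "\<forall>\<^sub>F h in at 0. dist (E h y) y < e"
    proof eventually_elim
      fix h :: real
      assume h: "dist (E h y') y' < e / 2" "\<bar>h\<bar> \<le> 1"
      have "E h y - y = E h (y - y') + (E h y' - y') + (y' - y)"
        by (simp add: linear_simps(2)[OF lin])
      then have "norm (E h y - y) \<le> norm (E h (y - y')) + norm (E h y' - y') + norm (y' - y)"
        by (metis norm_triangle_ineq norm_triangle_le add_right_mono)
      also have "\<dots> \<le> M * norm (y' - y) + norm (E h y' - y') + norm (y' - y)"
        using E_bound[of h "y - y'"] h(2) by (simp add: norm_minus_commute abs_le_iff)
      also have "\<dots> = (M + 1) * dist y' y + dist (E h y') y'"
        by (simp add: dist_norm algebra_simps)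
      also have "\<dots> < e"
      proof -
        have "(M + 1) * dist y' y < (M + 1) * (e / (2 * (M + 1)))"
          using y'(2) M(1) by (intro mult_strict_left_mono) auto
        also have "\<dots> = e / 2"
          using M(1) by (simp add: field_simps)
        finally show ?thesis
          using h(1) by simp
      qed
      finally show "dist (E h y) y < e"
        by (simp add: dist_norm)
    qed
  qed
  have E_cont: "continuous_on UNIV (\<lambda>t. E t x)" for x
  proof (intro continuous_at_imp_continuous_on ballI)
    fix t
    have "((\<lambda>h. E t (E h x)) \<longlongrightarrow> E t x) (at 0)"
      by (rule bounded_linear.tendsto[OF lin lim])
    then show "isCont (\<lambda>t. E t x) t"
      by (simp add: isCont_iff add)
  qed
  interpret E: banach_group E
    using lin zero add E_cont by (simp add: banach_group_def)
  have ip_mean: "ip (S.mean h x) y = ip x (E.mean h y)" for h x y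
  proof -
    have "ip (oriented_integral 0 h (\<lambda>s. S s x)) y = oriented_integral 0 h (\<lambda>s. ip (S s x) y)"
      by (rule oriented_integral_linear[OF bounded_bilinear.bounded_linear_left[OF bounded_bilinear_ip]
            S.orbit_integrable, symmetric])
    also have "\<dots> = ip x (oriented_integral 0 h (\<lambda>s. E s y))"
      unfolding adj by (rule oriented_integral_linear[OF bounded_bilinear.bounded_linear_right[OF bounded_bilinear_ip]
            E.orbit_integrable])
    finally show ?thesis
      by (simp add: S.mean_def E.mean_def ip_scaleR_left ip_scaleR_right)
  qed
  have "has_generator UNIV E D F"
    unfolding has_generator_def
  proof (intro conjI ballI allI iffI)
    fix y w
    assume *: "((\<lambda>h. (E h y - y) /\<^sub>R h) \<longlongrightarrow> w) (at 0)"
    have eq: "ip (A x) y = ip x w" if "x \<in> DA" for x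
    proof (rule tendsto_unique)
      show "((\<lambda>h. ip ((S h x - x) /\<^sub>R h) y) \<longlongrightarrow> ip (A x) y) (at 0)"
        by (intro bounded_bilinear.tendsto[OF bounded_bilinear_ip] S.generator_lim that tendsto_const)
      have "((\<lambda>h. ip x ((E h y - y) /\<^sub>R h)) \<longlongrightarrow> ip x w) (at 0)"
        by (intro bounded_bilinear.tendsto[OF bounded_bilinear_ip] * tendsto_const)
      then show "((\<lambda>h. ip ((S h x - x) /\<^sub>R h) y) \<longlongrightarrow> ip x w) (at 0)"
        by (simp add: ip_scaleR_right ip_scaleR_left ip_diff_left ip_diff_right adj)
    qed simp
    then show "y \<in> D"
      unfolding D by blast
    then show "w = F y"
      by (intro ip_ext_dense[OF dense_DA]) (simp add: eq flip: F)
  next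
    fix y w
    assume y: "y \<in> D \<and> w = F y"
    have eq: "(E h y - y) /\<^sub>R h = E.mean h (F y)" if "h \<noteq> 0" for h
      by (rule ip_ext) (use quot[of y h] y that in \<open>simp add: ip_mean\<close>)
    have "((\<lambda>h. E.mean h (F y)) \<longlongrightarrow> w) (at 0)"
      using E.mean_tendsto_point[of "F y"] y by simp
    then show "((\<lambda>h. (E h y - y) /\<^sub>R h) \<longlongrightarrow> w) (at 0)"
      by (rule Lim_transform_eventually) (auto simp: eventually_at_filter eq)
  qed simp
  then show ?thesis
    by unfold_locales
qed

text \<open>
  For a small multiple \<open>\<rho>\<close> the map \<open>x \<mapsto> x - \<rho> (T x - z)\<close> is a contraction, and its fixed point solves
  \<open>T x = z\<close>.
\<close>

lemma coercive_imp_bij: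
  assumes T: "bounded_linear T" and c: "0 < c" and coercive: "\<And>x. c * (norm x)\<^sup>2 \<le> ip (T x) x \<bullet> 1"
  shows "bij T" "c * norm x \<le> norm (T x)"
proof -
  interpret T: bounded_linear T
    by fact
  have below: "c * norm x \<le> norm (T x)" for x
  proof -
    have "c * (norm x)\<^sup>2 \<le> norm (T x) * norm x"
      using coercive[of x] inner_one_ip_le[of "T x" x] by simp
    then show ?thesis
      by (cases "norm x = 0") (auto simp: power2_eq_square)
  qed
  then show "c * norm x \<le> norm (T x)" .
  have "inj T"
  proof (rule injI)
    fix x y
    assume "T x = T y"
    then have "c * norm (x - y) \<le> 0"
      using below[of "x - y"] by (simp add: T.diff)
    then show "x = y"
      using c by (simp add: mult_le_0_iff)
  qed
  moreover have "\<exists>x. T x = z" for z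
  proof -
    obtain M0 where M0: "0 < M0" "\<And>x. norm (T x) \<le> norm x * M0"
      using T.pos_bounded by blast
    define M where "M = M0 + c"
    have M: "0 < M" "c \<le> M" "norm (T x) \<le> M * norm x" for x
      using M0 c mult_right_mono[of M0 M "norm x"] order_trans[OF M0(2)[of x]]
      by (auto simp: M_def mult.commute)
    define \<rho> where "\<rho> = c / M\<^sup>2"
    define q where "q = sqrt (1 - (c / M)\<^sup>2)"
    have cM: "0 < c / M" "c / M \<le> 1"
      using c M by auto
    then have q: "0 \<le> q" "q < 1" "q\<^sup>2 = 1 - (c / M)\<^sup>2"
      by (auto simp: q_def power_le_one)
    define \<phi> where "\<phi> x = x - \<rho> *\<^sub>R (T x - z)" for x
    have "\<exists>!x. \<phi> x = x"
    proof (rule banach_fix_type[OF q(1,2)])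
      show "\<forall>x. \<forall>y. dist (\<phi> x) (\<phi> y) \<le> q * dist x y"
      proof (intro allI)
        fix x y :: 'h
        let ?d = "x - y"
        have "\<phi> x - \<phi> y = ?d + (- \<rho>) *\<^sub>R T ?d"
          by (simp add: \<phi>_def T.diff algebra_simps)
        then have "(norm (\<phi> x - \<phi> y))\<^sup>2 = (norm ?d)\<^sup>2 + 2 * (ip ?d ((- \<rho>) *\<^sub>R T ?d) \<bullet> 1) + (norm ((- \<rho>) *\<^sub>R T ?d))\<^sup>2"
          by (simp only: norm_add_sq)
        also have "\<dots> = (norm ?d)\<^sup>2 - 2 * \<rho> * (ip (T ?d) ?d \<bullet> 1) + \<rho>\<^sup>2 * (norm (T ?d))\<^sup>2"
          unfolding ip_scaleR_right by (simp add: inner_one_ip_sym[of ?d "T ?d"] power_mult_distrib)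
        also have "\<dots> \<le> (norm ?d)\<^sup>2 - 2 * \<rho> * (c * (norm ?d)\<^sup>2) + \<rho>\<^sup>2 * (M * norm ?d)\<^sup>2"
          using coercive[of ?d] M(3)[of ?d] c M(1)
          by (intro add_mono diff_mono mult_left_mono power_mono) (auto simp: \<rho>_def)
        also have "\<dots> = (1 - 2 * (\<rho> * c) + (\<rho> * M)\<^sup>2) * (norm ?d)\<^sup>2"
          by (simp add: algebra_simps power_mult_distrib)
        also have "\<rho> * c = (c / M)\<^sup>2"
          by (simp add: \<rho>_def power2_eq_square)
        also have "\<rho> * M = c / M"
          using M(1) by (simp add: \<rho>_def power2_eq_square)
        also have "(1 - 2 * (c / M)\<^sup>2 + (c / M)\<^sup>2) * (norm ?d)\<^sup>2 = (q * norm ?d)\<^sup>2"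
          by (simp add: power_mult_distrib q(3))
        finally have "norm (\<phi> x - \<phi> y) \<le> q * norm ?d"
          by (rule power2_le_imp_le) (simp add: q(1))
        then show "dist (\<phi> x) (\<phi> y) \<le> q * dist x y"
          by (simp add: dist_norm)
      qed
    qed
    then obtain x where "\<phi> x = x"
      by blast
    then have "\<rho> *\<^sub>R (T x - z) = 0"
      by (simp add: \<phi>_def)
    then show ?thesis
      using c M(1) by (auto simp: \<rho>_def)
  qed
  then have "surj T"
    unfolding surj_def by (metis (no_types))
  ultimately show "bij T"
    by (simp add: bij_def)
qed

text \<open>
  Trajectories, graph norms and \<open>L\<^sup>1\<close> distances correspond under \<open>riesz ip\<close> and \<open>rep\<close>, and so do the
  approximating sequences over which the extension is defined.
\<close>

lemma is_obs_ext_riesz: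
  assumes E: "generated_group E D F"
    and D: "\<And>x. x \<in> D \<longleftrightarrow> riesz ip x \<in> D'" and D': "D' \<subseteq> antidual scl"
    and F': "\<And>x. x \<in> D \<Longrightarrow> F' (riesz ip x) = riesz ip (F x)"
    and E': "\<And>t x. E' t (riesz ip x) = riesz ip (E t x)"
    and b': "\<And>x. x \<in> D \<Longrightarrow> b' (riesz ip x) = b x"
  shows "is_obs_ext Y D' F' E' b' (riesz ip y0) (\<lambda>r. riesz ip (g r)) z \<longleftrightarrow> is_obs_ext Y D F E b y0 g z"
proof -
  interpret generated_group E D F
    by (rule E)
  interpret R: bounded_linear "riesz ip"
    by (rule bounded_linear_riesz)
  interpret rep: bounded_linear rep
    by (rule bounded_linear_rep)
  have graph1: "L1_graph_on D' F' {-\<tau>..\<tau>} (\<lambda>r. riesz ip (u r))" if "L1_graph_on D F {-\<tau>..\<tau>} u" for u \<tau>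
    unfolding L1_graph_on_def
  proof
    have "bounded_linear (\<lambda>p. (riesz ip (fst p), riesz ip (snd p)))"
      by (intro bounded_linear_Pair bounded_linear_compose[OF bounded_linear_riesz] bounded_linear_fst bounded_linear_snd)
    from L1_on_bounded_linear[OF this, of "-\<tau>" \<tau> "\<lambda>t. (u t, F (u t))"]
    have "L1_on {-\<tau>..\<tau>} (\<lambda>t. (riesz ip (u t), riesz ip (F (u t))))"
      using that by (simp add: L1_graph_on_def)
    then show "L1_on {-\<tau>..\<tau>} (\<lambda>t. (riesz ip (u t), F' (riesz ip (u t))))"
      by (rule L1_on_cong[rotated]) (use that in \<open>auto simp: L1_graph_on_def F'\<close>)
  qed (use that in \<open>auto simp: L1_graph_on_def D\<close>)
  have riesz_rep': "riesz ip (rep f) = f" if "f \<in> D'" for f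
    using that D' riesz_rep by blast
  have graph2: "L1_graph_on D F {-\<tau>..\<tau>} (\<lambda>r. rep (u r))" if "L1_graph_on D' F' {-\<tau>..\<tau>} u" for u \<tau>
    unfolding L1_graph_on_def
  proof
    show mem: "\<forall>t\<in>{-\<tau>..\<tau>}. rep (u t) \<in> D"
      using that by (auto simp: L1_graph_on_def D riesz_rep')
    have "bounded_linear (\<lambda>p. (rep (fst p), rep (snd p)))"
      by (intro bounded_linear_Pair bounded_linear_compose[OF bounded_linear_rep] bounded_linear_fst bounded_linear_snd)
    from L1_on_bounded_linear[OF this, of "-\<tau>" \<tau> "\<lambda>t. (u t, F' (u t))"]
    have L1: "L1_on {-\<tau>..\<tau>} (\<lambda>t. (rep (u t), rep (F' (u t))))"
      using that by (simp add: L1_graph_on_def)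
    have "rep (F' (u t)) = F (rep (u t))" if t: "t \<in> {-\<tau>..\<tau>}" for t
    proof -
      have "rep (F' (u t)) = rep (F' (riesz ip (rep (u t))))"
        using t \<open>L1_graph_on D' F' {-\<tau>..\<tau>} u\<close> by (simp add: L1_graph_on_def riesz_rep')
      then show ?thesis
        using mem t by (simp add: F')
    qed
    then show "L1_on {-\<tau>..\<tau>} (\<lambda>t. (rep (u t), F (rep (u t))))"
      by (intro L1_on_cong[OF _ L1]) simp
  qed
  have obs: "b' (traj E' (riesz ip y) u' t) = b (traj E y u t)"
    if y: "y \<in> D" and u: "L1_graph_on D F {-\<tau>..\<tau>} u" and eq: "\<And>r. r \<in> {-\<tau>..\<tau>} \<Longrightarrow> u' r = riesz ip (u r)"
      and t: "t \<in> {-\<tau>..\<tau>}" for y u u' t \<tau>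
  proof -
    have "oriented_integral 0 t (\<lambda>r. E' (- (t - r)) (u' r)) = oriented_integral 0 t (\<lambda>r. riesz ip (E (- (t - r)) (u r)))"
      using subsetD[OF min_max_subset[OF t]] by (intro oriented_integral_cong) (simp add: eq E')
    also have "\<dots> = riesz ip (oriented_integral 0 t (\<lambda>r. E (- (t - r)) (u r)))"
      by (rule oriented_integral_linear[OF bounded_linear_riesz convolution_integrable[OF L1_graph_on_imp(1)[OF u] t]])
    finally have "traj E' (riesz ip y) u' t = riesz ip (traj E y u t)"
      by (simp add: traj_def E' R.add)
    then show ?thesis
      by (simp add: b' traj_graph(1)[OF y u t])
  qed
  show ?thesis
  proof
    assume L: "is_obs_ext Y D' F' E' b' (riesz ip y0) (\<lambda>r. riesz ip (g r)) z"
    show "is_obs_ext Y D F E b y0 g z"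
      unfolding is_obs_ext_def
    proof (intro conjI allI impI)
      fix \<tau> :: real and yn gn
      assume \<tau>: "0 < \<tau>" and *: "(\<forall>n. yn n \<in> D \<and> L1_graph_on D F {-\<tau>..\<tau>} (gn n)) \<and> yn \<longlonglongrightarrow> y0 \<and>
        (\<lambda>n. integral {-\<tau>..\<tau>} (\<lambda>t. norm (gn n t - g t))) \<longlonglongrightarrow> 0"
      have "(\<lambda>n. integral {-\<tau>..\<tau>} (\<lambda>t. (norm (b' (traj E' (riesz ip (yn n)) (\<lambda>r. riesz ip (gn n r)) t) - z t))\<^sup>2)) \<longlonglongrightarrow> 0"
      proof (rule L[unfolded is_obs_ext_def, THEN conjunct2, rule_format, OF \<tau>, THEN conjunct2, rule_format],
          intro conjI allI)
        show "riesz ip (yn n) \<in> D'" "L1_graph_on D' F' {-\<tau>..\<tau>} (\<lambda>r. riesz ip (gn n r))" for n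
          using * graph1 by (simp_all add: D)
        show "(\<lambda>n. riesz ip (yn n)) \<longlonglongrightarrow> riesz ip y0"
          using * by (intro R.tendsto) simp
        show "(\<lambda>n. integral {-\<tau>..\<tau>} (\<lambda>t. norm (riesz ip (gn n t) - riesz ip (g t)))) \<longlonglongrightarrow> 0"
          using * by (simp flip: R.diff)
      qed
      moreover have "integral {-\<tau>..\<tau>} (\<lambda>t. (norm (b' (traj E' (riesz ip (yn n)) (\<lambda>r. riesz ip (gn n r)) t) - z t))\<^sup>2)
          = integral {-\<tau>..\<tau>} (\<lambda>t. (norm (b (traj E (yn n) (gn n) t) - z t))\<^sup>2)" for n
      proof (rule integral_cong)
        fix t
        assume "t \<in> {-\<tau>..\<tau>}"
        then have "b' (traj E' (riesz ip (yn n)) (\<lambda>r. riesz ip (gn n r)) t) = b (traj E (yn n) (gn n) t)"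
          using * by (intro obs[of "yn n" \<tau> "gn n"]) auto
        then show "(norm (b' (traj E' (riesz ip (yn n)) (\<lambda>r. riesz ip (gn n r)) t) - z t))\<^sup>2
            = (norm (b (traj E (yn n) (gn n) t) - z t))\<^sup>2"
          by simp
      qed
      ultimately show "(\<lambda>n. integral {-\<tau>..\<tau>} (\<lambda>t. (norm (b (traj E (yn n) (gn n) t) - z t))\<^sup>2)) \<longlonglongrightarrow> 0"
        by simp
    qed (use L in \<open>auto simp: is_obs_ext_def\<close>)
  next
    assume R: "is_obs_ext Y D F E b y0 g z"
    show "is_obs_ext Y D' F' E' b' (riesz ip y0) (\<lambda>r. riesz ip (g r)) z"
      unfolding is_obs_ext_def
    proof (intro conjI allI impI)
      fix \<tau> :: real and yn gn
      assume \<tau>: "0 < \<tau>" and *: "(\<forall>n. yn n \<in> D' \<and> L1_graph_on D' F' {-\<tau>..\<tau>} (gn n)) \<and> yn \<longlonglongrightarrow> riesz ip y0 \<and>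
        (\<lambda>n. integral {-\<tau>..\<tau>} (\<lambda>t. norm (gn n t - riesz ip (g t)))) \<longlonglongrightarrow> 0"
      have gn: "gn n t = riesz ip (rep (gn n t))" if "t \<in> {-\<tau>..\<tau>}" for n t
        using * that by (simp add: L1_graph_on_def riesz_rep')
      have yn: "rep (yn n) \<in> D" for n
        using * by (simp add: D riesz_rep')
      have "(\<lambda>n. integral {-\<tau>..\<tau>} (\<lambda>t. (norm (b (traj E (rep (yn n)) (\<lambda>r. rep (gn n r)) t) - z t))\<^sup>2)) \<longlonglongrightarrow> 0"
      proof (rule R[unfolded is_obs_ext_def, THEN conjunct2, rule_format, OF \<tau>, THEN conjunct2, rule_format],
          intro conjI allI)
        show "rep (yn n) \<in> D" "L1_graph_on D F {-\<tau>..\<tau>} (\<lambda>r. rep (gn n r))" for n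
          using * graph2 yn by simp_all
        show "(\<lambda>n. rep (yn n)) \<longlonglongrightarrow> y0"
          using * rep.tendsto[of yn "riesz ip y0" sequentially] by simp
        have "integral {-\<tau>..\<tau>} (\<lambda>t. norm (gn n t - riesz ip (g t))) = integral {-\<tau>..\<tau>} (\<lambda>t. norm (rep (gn n t) - g t))" for n
        proof (rule integral_cong)
          fix t
          assume t: "t \<in> {-\<tau>..\<tau>}"
          have "norm (gn n t - riesz ip (g t)) = norm (riesz ip (rep (gn n t) - g t))"
            unfolding R.diff gn[OF t, symmetric] ..
          then show "norm (gn n t - riesz ip (g t)) = norm (rep (gn n t) - g t)"
            by simp
        qed
        then show "(\<lambda>n. integral {-\<tau>..\<tau>} (\<lambda>t. norm (rep (gn n t) - g t))) \<longlonglongrightarrow> 0"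
          using * by simp
      qed
      moreover have "integral {-\<tau>..\<tau>} (\<lambda>t. (norm (b' (traj E' (yn n) (gn n) t) - z t))\<^sup>2)
          = integral {-\<tau>..\<tau>} (\<lambda>t. (norm (b (traj E (rep (yn n)) (\<lambda>r. rep (gn n r)) t) - z t))\<^sup>2)" for n
      proof (rule integral_cong)
        fix t
        assume t: "t \<in> {-\<tau>..\<tau>}"
        have "b' (traj E' (riesz ip (rep (yn n))) (gn n) t) = b (traj E (rep (yn n)) (\<lambda>r. rep (gn n r)) t)"
          by (rule obs[OF yn graph2 gn t]) (use * in auto)
        then show "(norm (b' (traj E' (yn n) (gn n) t) - z t))\<^sup>2 = (norm (b (traj E (rep (yn n)) (\<lambda>r. rep (gn n r)) t) - z t))\<^sup>2"
          using * by (simp add: riesz_rep')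
      qed
      ultimately show "(\<lambda>n. integral {-\<tau>..\<tau>} (\<lambda>t. (norm (b' (traj E' (yn n) (gn n) t) - z t))\<^sup>2)) \<longlonglongrightarrow> 0"
        by simp
    qed (use R in \<open>auto simp: is_obs_ext_def\<close>)
  qed
qed

end

section \<open>The weight\<close>

text \<open>
  The two branches have the same value and the same slope at \<open>T\<close>.
\<close>

lemma weight_has_vector_derivative:
  assumes "0 < \<omega>"
  shows "(weight \<omega> T has_vector_derivative - 2 * \<omega> * exp (- 2 * \<omega> * min s T)) (at s)"
proof -
  define f g where "f s = exp (- 2 * \<omega> * s)" and "g s = 2 * \<omega> * exp (- 2 * \<omega> * T) * (T + 1 / (2 * \<omega>) - s)" for s :: real
  have f: "(f has_vector_derivative - 2 * \<omega> * exp (- 2 * \<omega> * s)) (at s within A)" for s A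
    unfolding f_def has_real_derivative_iff_has_vector_derivative[symmetric] by (auto intro!: derivative_eq_intros)
  have g: "(g has_vector_derivative - 2 * \<omega> * exp (- 2 * \<omega> * T)) (at s within A)" for s A
    unfolding g_def has_real_derivative_iff_has_vector_derivative[symmetric] by (auto intro!: derivative_eq_intros)
  have w: "weight \<omega> T = (\<lambda>s. if s \<in> {..T} then f s else g s)"
    by (rule ext) (simp add: weight_def f_def g_def)
  have "((\<lambda>s. if s \<in> {..T} then f s else g s) has_vector_derivative
      (if s \<in> {..T} then - 2 * \<omega> * exp (- 2 * \<omega> * s) else - 2 * \<omega> * exp (- 2 * \<omega> * T))) (at s within {..T} \<union> {T..})"
  proof (rule has_vector_derivative_If_within_closures[where S = "{..T}" and T = "{T..}" and f = f and g = g
        and f' = "\<lambda>s. - 2 * \<omega> * exp (- 2 * \<omega> * s)" and g' = "\<lambda>s. - 2 * \<omega> * exp (- 2 * \<omega> * T)", OF _ refl f g])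
    assume "s \<in> closure {..T}" "s \<in> closure {T..}"
    then have "s = T"
      by simp
    then show "f s = g s" "- 2 * \<omega> * exp (- 2 * \<omega> * s) = - 2 * \<omega> * exp (- 2 * \<omega> * T)"
      using assms by (simp_all add: f_def g_def)
  qed auto
  moreover have "{..T} \<union> {T..} = UNIV"
    by auto
  ultimately show ?thesis
    by (auto simp: w min_def split: if_splits)
qed

lemma deriv_weight: "0 < \<omega> \<Longrightarrow> deriv (weight \<omega> T) s = - 2 * \<omega> * exp (- 2 * \<omega> * min s T)"
  using weight_has_vector_derivative[of \<omega> T s]
  by (intro DERIV_imp_deriv) (simp add: has_real_derivative_iff_has_vector_derivative)

lemma weight_lower_bound:
  assumes "0 < \<omega>" "s \<le> T"
  shows "exp (- 2 * \<omega> * T) \<le> weight \<omega> T s"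
  using assms by (simp add: weight_def)

lemma weight_nonneg: "0 < \<omega> \<Longrightarrow> s \<le> T + 1 / (2 * \<omega>) \<Longrightarrow> 0 \<le> weight \<omega> T s"
  by (simp add: weight_def)

section \<open>The feedback group\<close>

lemma (in hilbert) control_adj_works:
  assumes B: "control_op scl D F B" and y: "y \<in> D"
  shows "control_adj scl B y \<in> antidual scl" "B u y = pr u (control_adj scl B y)"
    "\<exists>c\<ge>0. \<forall>y\<in>D. norm (control_adj scl B y) \<le> c * graph_norm F y"
proof -
  obtain c where c: "\<And>u y. y \<in> D \<Longrightarrow> norm (B u y) \<le> c * norm u * graph_norm F y"
    using B unfolding control_op_def by blast
  have works: "control_adj scl B y \<in> antidual scl \<and> (\<forall>u. B u y = pr u (control_adj scl B y))" if y: "y \<in> D" for y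
  proof -
    define f where "f = Blinfun (\<lambda>u. kconj (B u y))"
    have "bounded_linear (\<lambda>u. kconj (B u y))"
    proof (rule bounded_linear_intro)
      show "kconj (B (u + v) y) = kconj (B u y) + kconj (B v y)" for u v
        using B y by (simp add: control_op_def kconj_add)
      show "kconj (B (r *\<^sub>R u) y) = r *\<^sub>R kconj (B u y)" for r u
        using B y unfolding control_op_def scl_of_real[symmetric]
        by (simp add: kconj_mult scaleR_conv_of_real)
      show "norm (kconj (B u y)) \<le> norm u * (c * graph_norm F y)" for u
        using c[OF y, of u] by (simp add: ac_simps)
    qed
    then have f: "blinfun_apply f u = kconj (B u y)" for u
      by (simp add: f_def bounded_linear_Blinfun_apply)
    have "control_adj scl B y = f"
      unfolding control_adj_def
    proof (rule the_equality)
      show "f \<in> antidual scl \<and> (\<forall>u. B u y = pr u f)"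
        using B y by (simp add: antidual_def f pr_def control_op_def kconj_mult)
      show "g = f" if "g \<in> antidual scl \<and> (\<forall>u. B u y = pr u g)" for g
        using that by (intro pr_eqI) (simp add: pr_def f)
    qed
    moreover have "f \<in> antidual scl \<and> (\<forall>u. B u y = pr u f)"
      using B y by (simp add: antidual_def f pr_def control_op_def kconj_mult)
    ultimately show ?thesis
      by simp
  qed
  show "control_adj scl B y \<in> antidual scl" "B u y = pr u (control_adj scl B y)"
    using works[OF y] by auto
  have "norm (control_adj scl B y) \<le> \<bar>c\<bar> * graph_norm F y" if y: "y \<in> D" for y
  proof (rule norm_blinfun_bound)
    show "0 \<le> \<bar>c\<bar> * graph_norm F y"
      by (simp add: graph_norm_def)
    show "norm (blinfun_apply (control_adj scl B y) u) \<le> \<bar>c\<bar> * graph_norm F y * norm u" for u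
    proof -
      have "norm (blinfun_apply (control_adj scl B y) u) = norm (B u y)"
        using works[OF y] by (simp add: pr_def)
      also have "\<dots> \<le> c * norm u * graph_norm F y"
        by (rule c[OF y])
      also have "\<dots> \<le> \<bar>c\<bar> * norm u * graph_norm F y"
        by (intro mult_right_mono) (auto simp: graph_norm_def)
      finally show ?thesis
        by (simp add: ac_simps)
    qed
  qed
  then show "\<exists>c\<ge>0. \<forall>y\<in>D. norm (control_adj scl B y) \<le> c * graph_norm F y"
    by (intro exI[of _ "\<bar>c\<bar>"]) simp
qed

theorem theorem3p1:
  fixes sclH :: "'k::rc_field \<Rightarrow> 'h::banach \<Rightarrow> 'h" and ipH :: "'h \<Rightarrow> 'h \<Rightarrow> 'k"
    and sclU :: "'k \<Rightarrow> 'u::banach \<Rightarrow> 'u" and ipU :: "'u \<Rightarrow> 'u \<Rightarrow> 'k"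
    and DA :: "'h set" and A :: "'h \<Rightarrow> 'h" and S :: "real \<Rightarrow> 'h \<Rightarrow> 'h"
    and H' :: "('h \<Rightarrow>\<^sub>L 'k) set" and U' :: "('u \<Rightarrow>\<^sub>L 'k) set"
    and DAs :: "('h \<Rightarrow>\<^sub>L 'k) set" and As :: "('h \<Rightarrow>\<^sub>L 'k) \<Rightarrow> ('h \<Rightarrow>\<^sub>L 'k)"
    and Ss :: "real \<Rightarrow> ('h \<Rightarrow>\<^sub>L 'k) \<Rightarrow> ('h \<Rightarrow>\<^sub>L 'k)"
    and Jt :: "'h \<Rightarrow> ('h \<Rightarrow>\<^sub>L 'k)" and J :: "('u \<Rightarrow>\<^sub>L 'k) \<Rightarrow> 'u"
    and B :: "'u \<Rightarrow> ('h \<Rightarrow>\<^sub>L 'k) \<Rightarrow> 'k" and Bs :: "('h \<Rightarrow>\<^sub>L 'k) \<Rightarrow> ('u \<Rightarrow>\<^sub>L 'k)"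
    and Bext :: "('h \<Rightarrow>\<^sub>L 'k) \<Rightarrow> (real \<Rightarrow> ('h \<Rightarrow>\<^sub>L 'k)) \<Rightarrow> real \<Rightarrow> ('u \<Rightarrow>\<^sub>L 'k)"
    and BS :: "('h \<Rightarrow>\<^sub>L 'k) \<Rightarrow> real \<Rightarrow> ('u \<Rightarrow>\<^sub>L 'k)"
    and BV :: "('h \<Rightarrow>\<^sub>L 'k) \<Rightarrow> real \<Rightarrow> ('u \<Rightarrow>\<^sub>L 'k)"
    and T \<omega> T\<omega> :: real
    and \<Lambda> :: "('h \<Rightarrow>\<^sub>L 'k) \<Rightarrow> 'h" and \<Lambda>inv :: "'h \<Rightarrow> ('h \<Rightarrow>\<^sub>L 'k)"
    and L C :: "'h \<Rightarrow> 'h" and Cs :: "('h \<Rightarrow>\<^sub>L 'k) \<Rightarrow> ('h \<Rightarrow>\<^sub>L 'k)"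
    and G :: "('h \<Rightarrow>\<^sub>L 'k) \<Rightarrow> ('h \<Rightarrow>\<^sub>L 'k)"
    and V :: "real \<Rightarrow> ('h \<Rightarrow>\<^sub>L 'k) \<Rightarrow> ('h \<Rightarrow>\<^sub>L 'k)" and Ugrp :: "real \<Rightarrow> 'h \<Rightarrow> 'h"
  assumes hilbert_H: "hilbert sclH ipH" and hilbert_U: "hilbert sclU ipU"
    and H'_def: "H' = antidual sclH" and U'_def: "U' = antidual sclU"
    and Jt_def: "Jt = riesz ipH" and J_def: "J = inv (riesz ipU)"
    \<comment> \<open>(H1)\<close>
    and S_group: "C0_group UNIV sclH S" and S_gen: "has_generator UNIV S DA A"
    and DAs_def: "DAs = adj_dom sclH DA A" and As_def: "As = adj sclH DA A"
    and Ss_def: "\<And>t. Ss t = adj sclH UNIV (S t)"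
    \<comment> \<open>(H2)\<close>
    and H2: "control_op sclU DAs As B" and Bs_def: "Bs = control_adj sclU B"
    \<comment> \<open>(H3)\<close>
    and H3: "\<And>\<tau>. \<tau> > 0 \<Longrightarrow> \<exists>c>0. \<forall>x\<in>DAs.
               integral {0..\<tau>} (\<lambda>t. (norm (Bs (Ss (- t) x)))\<^sup>2) \<le> c * (norm x)\<^sup>2"
    \<comment> \<open>(H4)\<close>
    and T_pos: "T > 0"
    and H4: "\<exists>c>0. \<forall>x\<in>DAs.
               c * (norm x)\<^sup>2 \<le> integral {0..T} (\<lambda>t. (norm (Bs (Ss (- t) x)))\<^sup>2)"
    and Bext_def: "Bext = obs_ext U' DAs As Ss Bs"
    and BS_def: "\<And>x. BS x = Bext x (\<lambda>_. 0)"
    and \<omega>_pos: "\<omega> > 0" and T\<omega>_def: "T\<omega> = T + 1 / (2 * \<omega>)"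
    and \<Lambda>_op: "bounded_op H' dscl UNIV sclH \<Lambda>"
    and \<Lambda>_eq: "\<And>x y. x \<in> H' \<Longrightarrow> y \<in> H' \<Longrightarrow>
               pr (\<Lambda> x) y = integral {0..T\<omega>} (\<lambda>s. of_real (weight \<omega> T s) * pr (J (BS x s)) (BS y s))"
    and \<Lambda>inv_def: "\<Lambda>inv = inv_into H' \<Lambda>"
    and L_op: "bounded_op UNIV sclH UNIV sclH L"
    and L_eq: "\<And>x y. ipH (L x) y =
               - integral {0..T\<omega>} (\<lambda>s. of_real (deriv (weight \<omega> T) s) *
                   pr (J (BS (\<Lambda>inv x) s)) (BS (\<Lambda>inv y) s))"
    and C_sqrt: "is_pos_sqrt sclH ipH L C" and Cs_def: "Cs = adj sclH UNIV C"
    and G_def: "\<And>f. G f = - As f - Cs (Jt (C (\<Lambda> f)))"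
    and V_group: "C0_group H' dscl V" and V_gen: "has_generator H' V DAs G"
    and BV_def: "\<And>y0. BV y0 = Bext y0 (\<lambda>r. - Cs (Jt (C (\<Lambda> (V r y0)))))"
    and Ugrp_def: "\<And>t x. Ugrp t x = \<Lambda> (V t (\<Lambda>inv x))"
  shows "C0_group UNIV sclH Ugrp
    \<and> has_generator UNIV Ugrp (\<Lambda> ` DAs) (\<lambda>x. \<Lambda> (G (\<Lambda>inv x)))
    \<and> (\<forall>x0. \<forall>y\<in>H'. \<forall>t.
         pr (Ugrp t x0) y = pr (S t x0) y
           - oriented_integral 0 t (\<lambda>r. pr (J (BV (\<Lambda>inv x0) r)) (BS y (- (t - r)))))"
proof -
  interpret H: hilbert sclH ipH
    by (rule hilbert_H)
  interpret U: hilbert sclU ipU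
    by (rule hilbert_U)
  let ?R = "riesz ipH"
  note R_linear = H.bounded_linear_riesz
  interpret R: bounded_linear ?R
    by (rule R_linear)
  have H'_eq: "H' = range ?R"
    by (simp add: H'_def H.antidual_eq_range)
  have R_mem: "?R x \<in> H'" for x
    by (simp add: H'_def H.riesz_mem)
  have R_rep: "?R (H.rep f) = f" if "f \<in> H'" for f
    using that by (simp add: H'_def H.riesz_rep)

  \<comment> \<open>The operators on the antidual, transported to the space by the Riesz isometry. The perturbation
    \<open>C\<^sup>* J C \<Lambda>\<close> becomes \<open>L\<close> after the transported Gramian, because \<open>C\<close> is a symmetric root of \<open>L\<close>.\<close>
  define \<Lambda>t where "\<Lambda>t x = \<Lambda> (?R x)" for x
  define Vt where "Vt t x = H.rep (V t (?R x))" for t x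
  define D where "D = {x. ?R x \<in> DAs}"
  define F where "F x = H.rep (As (?R x))" for x
  define b where "b x = Bs (?R x)" for x
  define K where "K x = L (\<Lambda>t x)" for x

  have S: "generated_group S DA A"
    using H.banach_group_of_C0_group[OF S_group] S_gen by (simp add: generated_group_def generated_group_axioms_def)
  interpret S: generated_group S DA A
    by (rule S)
  have "\<exists>E. \<forall>x y. ipH (S t x) y = ipH x (E y)" for t
    using H.hilbert_adjoint_exists[of "S t"] S_group by (simp add: C0_group_def)
  then obtain E where E: "\<And>t x y. ipH (S t x) y = ipH x (E t y)"
    by metis
  have Ss_R: "Ss t (?R x) = ?R (E t x)" for t x
    unfolding Ss_def by (rule H.adj_riesz) (simp_all add: E)

  have D_iff: "y \<in> D \<longleftrightarrow> (\<exists>w. \<forall>x\<in>DA. ipH (A x) y = ipH x w)" for y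
    unfolding D_def DAs_def adj_dom_def mem_Collect_eq H.antidual_eq_range
    by (auto simp: H.pr_riesz)
  have As_R: "As (?R y) = ?R w" if "\<And>x. x \<in> DA \<Longrightarrow> ipH (A x) y = ipH x w" for y w
    unfolding As_def by (rule H.adj_riesz[OF S.closure_domain that])
  have As_F: "As (?R y) = ?R (F y)" if y: "y \<in> D" for y
  proof -
    obtain w where "\<And>x. x \<in> DA \<Longrightarrow> ipH (A x) y = ipH x w"
      using y D_iff by blast
    then have "As (?R y) = ?R w"
      by (rule As_R)
    then show ?thesis
      by (simp add: F_def)
  qed
  have F_adj: "ipH (A x) y = ipH x (F y)" if y: "y \<in> D" and x: "x \<in> DA" for x y
  proof -
    obtain w where w: "\<And>x. x \<in> DA \<Longrightarrow> ipH (A x) y = ipH x w"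
      using y D_iff by blast
    then have "F y = w"
      using As_R[of y w] by (simp add: F_def)
    then show ?thesis
      using w x by simp
  qed
  have DAs_sub: "DAs \<subseteq> H'"
    by (auto simp: DAs_def adj_dom_def H'_def)
  have DAs_eq: "DAs = ?R ` D"
  proof (intro equalityI subsetI)
    fix f
    assume f: "f \<in> DAs"
    then have "?R (H.rep f) = f"
      using DAs_sub R_rep by blast
    then show "f \<in> ?R ` D"
      using f by (intro image_eqI[of f ?R "H.rep f"]) (simp_all add: D_def)
  qed (auto simp: D_def)

  have \<Lambda>_add: "\<Lambda> (x + y) = \<Lambda> x + \<Lambda> y" and \<Lambda>_scl: "\<Lambda> (dscl a x) = sclH a (\<Lambda> x)"
    if "x \<in> H'" "y \<in> H'" for x y a
    using \<Lambda>_op that by (auto simp: bounded_op_def)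
  have \<Lambda>t_scl: "\<Lambda>t (sclH a x) = sclH a (\<Lambda>t x)" for a x
    unfolding \<Lambda>t_def H.dscl_riesz[symmetric] by (rule \<Lambda>_scl[OF R_mem R_mem])
  have \<Lambda>t: "bounded_linear \<Lambda>t"
  proof -
    obtain c where c: "\<And>f. f \<in> H' \<Longrightarrow> norm (\<Lambda> f) \<le> c * norm f"
      using \<Lambda>_op unfolding bounded_op_def by blast
    show ?thesis
    proof (rule bounded_linear_intro)
      show "\<Lambda>t (x + y) = \<Lambda>t x + \<Lambda>t y" for x y
        unfolding \<Lambda>t_def R.add by (rule \<Lambda>_add[OF R_mem R_mem])
      show "\<Lambda>t (r *\<^sub>R x) = r *\<^sub>R \<Lambda>t x" for r x
        using \<Lambda>t_scl[of "of_real r" x] by (simp add: H.scl_of_real)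
      show "norm (\<Lambda>t x) \<le> norm x * c" for x
        using c[OF R_mem[of x]] by (simp add: \<Lambda>t_def mult.commute)
    qed
  qed
  interpret \<Lambda>t: bounded_linear \<Lambda>t
    by (rule \<Lambda>t)

  \<comment> \<open>The group \<open>V\<close>, whose generator shows that the domain of the adjoint is dense.\<close>
  have V_R: "V t (?R x) = ?R (Vt t x)" for t x
    using V_group R_mem[of x] by (simp add: Vt_def R_rep C0_group_def bounded_op_def)
  have Vt_scl: "Vt t (sclH a x) = sclH a (Vt t x)" for t a x
  proof -
    have "?R (Vt t (sclH a x)) = V t (dscl a (?R x))"
      by (simp add: V_R H.dscl_riesz)
    also have "\<dots> = dscl a (V t (?R x))"
      using V_group R_mem[of x] by (simp add: C0_group_def bounded_op_def)
    also have "\<dots> = ?R (sclH a (Vt t x))"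
      by (simp add: V_R H.dscl_riesz)
    finally show ?thesis
      using H.inj_riesz by (simp add: inj_eq)
  qed
  have Vt: "banach_group Vt"
    unfolding banach_group_def
  proof (intro conjI allI)
    fix t
    have "\<exists>c. \<forall>f\<in>H'. norm (V t f) \<le> c * norm f"
      using V_group by (simp add: C0_group_def bounded_op_def)
    then obtain c where c: "\<And>f. f \<in> H' \<Longrightarrow> norm (V t f) \<le> c * norm f"
      by blast
    show "bounded_linear (Vt t)"
    proof (rule bounded_linear_intro)
      show "Vt t (x + y) = Vt t x + Vt t y" for x y
      proof -
        have "?R (Vt t (x + y)) = V t (?R x + ?R y)"
          by (simp add: V_R R.add[symmetric])
        also have "\<dots> = V t (?R x) + V t (?R y)"
          using V_group R_mem by (simp add: C0_group_def bounded_op_def)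
        also have "\<dots> = ?R (Vt t x + Vt t y)"
          by (simp add: V_R R.add)
        finally show ?thesis
          using H.inj_riesz by (simp add: inj_eq)
      qed
      show "Vt t (r *\<^sub>R x) = r *\<^sub>R Vt t x" for r x
        using Vt_scl[of t "of_real r" x] by (simp add: H.scl_of_real)
      show "norm (Vt t x) \<le> norm x * c" for x
        using c[OF R_mem[of x]] by (simp add: V_R mult.commute)
    qed
  next
    show "Vt 0 x = x" for x
      using V_group R_mem[of x] by (simp add: Vt_def C0_group_def)
    show "Vt (s + t) x = Vt s (Vt t x)" for s t x
    proof -
      have "?R (Vt (s + t) x) = ?R (Vt s (Vt t x))"
        unfolding V_R[symmetric] using V_group R_mem[of x] by (simp add: C0_group_def)
      then show ?thesis
        using H.inj_riesz by (simp add: inj_eq)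
    qed
    show "continuous_on UNIV (\<lambda>t. Vt t x)" for x
      unfolding Vt_def using V_group R_mem[of x]
      by (intro bounded_linear.continuous_on[OF H.bounded_linear_rep]) (simp add: C0_group_def)
  qed

  have C_sym: "ipH (C x) y = ipH x (C y)" and C_sq: "C (C x) = L x" for x y
    using C_sqrt by (auto simp: is_pos_sqrt_def)
  have L_lin: "bounded_linear L"
    by (rule H.bounded_op_bounded_linear[OF L_op])
  have Cs_R: "Cs (?R y) = ?R (C y)" for y
    unfolding Cs_def by (rule H.adj_riesz) (simp_all add: C_sym)
  have pert: "Cs (Jt (C (\<Lambda> (?R x)))) = ?R (K x)" for x
    by (simp add: Jt_def Cs_R C_sq K_def \<Lambda>t_def)
  have K_lin: "bounded_linear K"
    unfolding K_def by (rule bounded_linear_compose[OF L_lin \<Lambda>t])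
  have G_R: "G (?R x) = ?R (- F x - K x)" if "x \<in> D" for x
    by (simp add: G_def As_F[OF that] pert R.diff R.neg)

  have Vt_gen: "has_generator UNIV Vt D (\<lambda>x. - F x - K x)"
    unfolding has_generator_def
  proof (intro conjI ballI allI)
    fix x y
    have quot: "(V h (?R x) - ?R x) /\<^sub>R h = ?R ((Vt h x - x) /\<^sub>R h)" for h
      by (simp add: V_R R.diff R.scaleR)
    have "((\<lambda>h. (Vt h x - x) /\<^sub>R h) \<longlongrightarrow> y) (at 0) \<longleftrightarrow> ((\<lambda>h. (V h (?R x) - ?R x) /\<^sub>R h) \<longlongrightarrow> ?R y) (at 0)"
      unfolding quot
    proof
      assume "((\<lambda>h. ?R ((Vt h x - x) /\<^sub>R h)) \<longlongrightarrow> ?R y) (at 0)"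
      from bounded_linear.tendsto[OF H.bounded_linear_rep this]
      show "((\<lambda>h. (Vt h x - x) /\<^sub>R h) \<longlongrightarrow> y) (at 0)"
        by simp
    qed (rule R.tendsto)
    also have "\<dots> \<longleftrightarrow> ?R x \<in> DAs \<and> ?R y = G (?R x)"
      using V_gen R_mem[of x] by (simp add: has_generator_def)
    also have "\<dots> \<longleftrightarrow> x \<in> D \<and> y = - F x - K x"
      using G_R[of x] H.inj_riesz by (auto simp: D_def inj_eq)
    finally show "((\<lambda>h. (Vt h x - x) /\<^sub>R h) \<longlongrightarrow> y) (at 0) \<longleftrightarrow> x \<in> D \<and> y = - F x - K x" .
  qed simp
  have V: "generated_group Vt D (\<lambda>x. - F x - K x)"
    using Vt Vt_gen by (simp add: generated_group_def generated_group_axioms_def)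
  interpret V: generated_group Vt D "\<lambda>x. - F x - K x"
    by (rule V)

  have E_group: "generated_group E D F"
    by (rule H.adjoint_generated_group[OF S E D_iff F_adj V.closure_domain])
  interpret E: generated_group E D F
    by (rule E_group)

  \<comment> \<open>The observation takes its values in the antidual of the control space.\<close>
  have b_eq: "Bs (?R x) \<in> U'" "B u (?R x) = pr u (b x)" if "x \<in> D" for x u
    using U.control_adj_works(1)[OF H2, of "?R x"] U.control_adj_works(2)[OF H2, of "?R x" u] that by (simp_all add: Bs_def b_def U'_def D_def)
  have graph: "graph_norm As (?R x) = graph_norm F x" if "x \<in> D" for x
    by (simp add: graph_norm_def As_F[OF that])
  have obs: "admissible_observation E D F b U'"
  proof (intro admissible_observation.intro[OF E_group] admissible_observation_axioms.intro)
    show "b (x + y) = b x + b y" if "x \<in> D" "y \<in> D" for x y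
    proof (rule pr_eqI)
      fix u
      have "pr u (b (x + y)) = B u (?R x + ?R y)"
        using b_eq(2)[of "x + y" u] E.D_add[OF that] by (simp add: R.add)
      also have "\<dots> = B u (?R x) + B u (?R y)"
        using H2 that by (simp add: control_op_def D_def)
      also have "\<dots> = pr u (b x + b y)"
        by (simp add: b_eq that) (simp add: pr_def plus_blinfun.rep_eq kconj_add)
      finally show "pr u (b (x + y)) = pr u (b x + b y)" .
    qed
    show "b (r *\<^sub>R x) = r *\<^sub>R b x" if "x \<in> D" for x r
    proof (rule pr_eqI)
      fix u
      have "pr u (b (r *\<^sub>R x)) = B u (dscl (of_real r) (?R x))"
        using b_eq(2)[of "r *\<^sub>R x" u] E.D_scaleR[OF that] by (simp add: dscl_of_real R.scaleR)
      also have "\<dots> = kconj (of_real r) * B u (?R x)"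
        using H2 that unfolding control_op_def by (simp add: D_def del: kconj_of_real)
      also have "\<dots> = pr u (r *\<^sub>R b x)"
        by (simp add: b_eq that) (simp add: pr_def scaleR_blinfun.rep_eq scaleR_conv_of_real kconj_mult)
      finally show "pr u (b (r *\<^sub>R x)) = pr u (r *\<^sub>R b x)" .
    qed
    show "\<exists>c. \<forall>x\<in>D. norm (b x) \<le> c * graph_norm F x"
    proof (cases "D = {}")
      case False
      then obtain x0 where "x0 \<in> D"
        by blast
      then obtain c where "\<forall>y\<in>DAs. norm (Bs y) \<le> c * graph_norm As y"
        using U.control_adj_works(3)[OF H2, of "?R x0"] by (auto simp: Bs_def D_def)
      then show ?thesis
        by (intro exI[of _ c]) (auto simp: b_def D_def simp flip: graph)
    qed simp
    show "b x \<in> U'" if "x \<in> D" for x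
      using b_eq[OF that] by (simp add: b_def)
    show "closed U'"
      unfolding U'_def by (rule closed_antidual)
    show "\<exists>c. \<forall>x\<in>D. integral {0..\<tau>} (\<lambda>t. (norm (b (E (- t) x)))\<^sup>2) \<le> c * (norm x)\<^sup>2" if \<tau>: "0 < \<tau>" for \<tau>
    proof -
      obtain c where "\<forall>x\<in>DAs. integral {0..\<tau>} (\<lambda>t. (norm (Bs (Ss (- t) x)))\<^sup>2) \<le> c * (norm x)\<^sup>2"
        using H3[OF \<tau>] by blast
      then have "\<forall>x\<in>D. integral {0..\<tau>} (\<lambda>t. (norm (b (E (- t) x)))\<^sup>2) \<le> c * (norm x)\<^sup>2"
        by (auto simp: DAs_eq Ss_R b_def)
      then show ?thesis ..
    qed
  qed
  interpret obs: admissible_observation E D F b U'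
    by (rule obs)

  have ext: "is_obs_ext U' D F E b x g (Bext (?R x) (\<lambda>r. ?R (g r)))" if g: "continuous_on UNIV g" for x g
  proof -
    have iff: "is_obs_ext U' DAs As Ss Bs (?R x) (\<lambda>r. ?R (g r)) z \<longleftrightarrow> is_obs_ext U' D F E b x g z" for z
      using DAs_sub by (intro H.is_obs_ext_riesz[OF E_group]) (simp_all add: D_def As_F Ss_R b_def H'_def)
    then have "\<exists>z. is_obs_ext U' DAs As Ss Bs (?R x) (\<lambda>r. ?R (g r)) z"
      using obs.obs_ext_exists[OF g] by blast
    then show ?thesis
      unfolding iff[symmetric] Bext_def obs_ext_def by (rule someI_ex)
  qed
  have BS_ext: "is_obs_ext U' D F E b x (\<lambda>_. 0) (BS (?R x))" for x
    using ext[of "\<lambda>_. 0" x] by (simp add: BS_def R.zero)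
  have BV_ext: "is_obs_ext U' D F E b x (\<lambda>r. - K (Vt r x)) (BV (?R x))" for x
  proof -
    have "continuous_on UNIV (\<lambda>r. - K (Vt r x))"
      by (intro continuous_on_minus bounded_linear.continuous_on[OF K_lin] V.cont)
    from ext[OF this, of x] show ?thesis
      by (simp add: BV_def V_R pert R.neg)
  qed
  have ext_mem: "z t \<in> U'" if "is_obs_ext U' D F E b x g z" for x g z t
    using that by (simp add: is_obs_ext_def)

  define \<beta> where "\<beta> f g = ipU (U.rep f) (U.rep g)" for f g
  have \<beta>: "bounded_bilinear \<beta>"
    unfolding \<beta>_def by (rule bounded_bilinear.comp[OF U.bounded_bilinear_ip U.bounded_linear_rep U.bounded_linear_rep])
  have J_eq: "pr (J f) g = \<beta> f g" if "f \<in> U'" "g \<in> U'" for f g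
    using that by (simp add: J_def U'_def U.inv_riesz U.pr_riesz_rep \<beta>_def)
  have \<beta>_sym: "\<beta> g f = kconj (\<beta> f g)" for f g
    unfolding \<beta>_def by (rule U.ip_conj)
  have \<beta>_self: "\<beta> f f \<bullet> 1 = (norm f)\<^sup>2" if "f \<in> U'" for f
    using that by (simp add: \<beta>_def U.inner_one_ip_self U.norm_rep U'_def)

  \<comment> \<open>The Gramian as a form on the space. On the domain it is an integral of genuine observations.\<close>
  define a where "a x y = ipH (\<Lambda>t x) y" for x y
  have a: "bounded_bilinear a"
    unfolding a_def by (rule bounded_bilinear.comp1[OF H.bounded_bilinear_ip \<Lambda>t])
  interpret a: bounded_bilinear a
    by (rule a)
  have T\<omega>_pos: "0 < T\<omega>"
    using T_pos \<omega>_pos by (simp add: T\<omega>_def add_pos_pos)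
  define w' where "w' s = - 2 * \<omega> * exp (- 2 * \<omega> * min s T)" for s
  have w_deriv: "(weight \<omega> T has_vector_derivative w' s) (at s)" for s
    unfolding w'_def by (rule weight_has_vector_derivative[OF \<omega>_pos])
  have w_cont: "continuous_on A (weight \<omega> T)" for A
    using w_deriv by (intro continuous_at_imp_continuous_on) (auto intro: has_vector_derivative_continuous)
  have w'_cont: "continuous_on A w'" for A
    unfolding w'_def by (intro continuous_intros)
  have gram: "a x y = integral {0..T\<omega>} (\<lambda>s. weight \<omega> T s *\<^sub>R \<beta> (b (E (- s) x)) (b (E (- s) y)))"
    if "x \<in> D" "y \<in> D" for x y
  proof -
    have "a x y = pr (\<Lambda> (?R x)) (?R y)"
      by (simp add: a_def \<Lambda>t_def H.pr_riesz)
    also have "\<dots> = integral {0..T\<omega>} (\<lambda>s. weight \<omega> T s *\<^sub>R \<beta> (BS (?R x) s) (BS (?R y) s))"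
      unfolding \<Lambda>_eq[OF R_mem R_mem]
      by (simp add: J_eq ext_mem[OF BS_ext] scaleR_conv_of_real)
    also have "\<dots> = integral {0..T\<omega>} (\<lambda>s. weight \<omega> T s *\<^sub>R \<beta> (b (E (- s) x)) (b (E (- s) y)))"
      by (rule obs.obs_ext_gramian[OF \<beta> w_cont T\<omega>_pos that(1) BS_ext that(2) BS_ext])
    finally show ?thesis .
  qed
  have gram_int: "(\<lambda>s. c s *\<^sub>R \<beta> (b (E (- s) x)) (b (E (- s) y))) integrable_on {0..u}"
    if "x \<in> D" "y \<in> D" "\<And>A. continuous_on A c" for x y u and c :: "real \<Rightarrow> real"
    by (intro integrable_continuous_interval continuous_on_scaleR that bounded_bilinear.continuous_on[OF \<beta>]
        obs.b_orbit_continuous continuous_intros)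

  \<comment> \<open>Symmetry and coercivity extend from the dense domain by continuity.\<close>
  have a_sym: "a x y = kconj (a y x)" for x y
  proof (rule LIMSEQ_unique)
    have D: "a x y = kconj (a y x)" if "x \<in> D" "y \<in> D" for x y
      unfolding gram[OF that] gram[OF that(2,1)]
        integral_linear[OF gram_int[OF that(2,1) w_cont] bounded_linear_kconj, symmetric] o_def kconj_scaleR
      by (simp flip: \<beta>_sym)
    have lim: "(\<lambda>n. a (E.reg n x) (E.reg n y)) \<longlonglongrightarrow> a x y" for x y
      by (intro a.tendsto E.reg_tendsto tendsto_const)
    show "(\<lambda>n. a (E.reg n x) (E.reg n y)) \<longlonglongrightarrow> a x y"
      by (rule lim)
    show "(\<lambda>n. a (E.reg n x) (E.reg n y)) \<longlonglongrightarrow> kconj (a y x)"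
    proof -
      have "a (E.reg n x) (E.reg n y) = kconj (a (E.reg n y) (E.reg n x))" for n
        by (rule D[OF E.reg_mem E.reg_mem])
      then show ?thesis
        using bounded_linear.tendsto[OF bounded_linear_kconj lim[of y x]] by presburger
    qed
  qed

  obtain c2 where c2: "0 < c2"
    "\<And>x. x \<in> D \<Longrightarrow> c2 * (norm x)\<^sup>2 \<le> integral {0..T} (\<lambda>t. (norm (b (E (- t) x)))\<^sup>2)"
    using H4 by (auto simp: DAs_eq Ss_R b_def)
  \<comment> \<open>The first factor bounds the weight from below on \<open>{0..T}\<close>.\<close>
  define c where "c = exp (- 2 * \<omega> * T) * c2"
  have c: "0 < c"
    using c2 by (simp add: c_def)
  have coercive: "c * (norm x)\<^sup>2 \<le> ipH (\<Lambda>t x) x \<bullet> 1" for x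
  proof (rule LIMSEQ_le)
    show "(\<lambda>n. c * (norm (E.reg n x))\<^sup>2) \<longlonglongrightarrow> c * (norm x)\<^sup>2"
      by (intro tendsto_intros E.reg_tendsto)
    show "(\<lambda>n. a (E.reg n x) (E.reg n x) \<bullet> 1) \<longlonglongrightarrow> ipH (\<Lambda>t x) x \<bullet> 1"
      unfolding a_def[symmetric] by (intro tendsto_inner a.tendsto E.reg_tendsto tendsto_const)
    have "c * (norm x)\<^sup>2 \<le> a x x \<bullet> 1" if x: "x \<in> D" for x
    proof -
      define h where "h s = (norm (b (E (- s) x)))\<^sup>2" for s
      have h_cont: "continuous_on A h" for A
        unfolding h_def by (intro continuous_intros obs.b_orbit_continuous x)
      have i: "h integrable_on {0..T}" "(\<lambda>s. weight \<omega> T s * h s) integrable_on {0..T}"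
        "(\<lambda>s. weight \<omega> T s * h s) integrable_on {0..T\<omega>}"
        by (intro integrable_continuous_interval continuous_on_mult h_cont w_cont)+
      have "c * (norm x)\<^sup>2 \<le> exp (- 2 * \<omega> * T) * integral {0..T} h"
        using c2(2)[OF x] by (simp add: c_def h_def[abs_def])
      also have "\<dots> = integral {0..T} (\<lambda>s. exp (- 2 * \<omega> * T) * h s)"
        by simp
      also have "\<dots> \<le> integral {0..T} (\<lambda>s. weight \<omega> T s * h s)"
        using weight_lower_bound[OF \<omega>_pos]
        by (intro integral_le i integrable_on_mult_right mult_right_mono) (auto simp: h_def)
      also have "\<dots> \<le> integral {0..T\<omega>} (\<lambda>s. weight \<omega> T s * h s)"
        using weight_nonneg[OF \<omega>_pos] \<omega>_pos
        by (intro integral_subset_le i) (auto simp: h_def T\<omega>_def add_increasing2)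
      also have "\<dots> = integral {0..T\<omega>} (\<lambda>s. (weight \<omega> T s *\<^sub>R \<beta> (b (E (- s) x)) (b (E (- s) x))) \<bullet> 1)"
        by (simp add: h_def \<beta>_self obs.b_mem E.E_mem[OF x])
      also have "\<dots> = a x x \<bullet> 1"
        unfolding gram[OF x x]
        using integral_linear[OF gram_int[OF x x w_cont] bounded_linear_inner_left[of 1]] by (simp add: o_def)
      finally show ?thesis .
    qed
    then show "\<exists>N. \<forall>n\<ge>N. c * (norm (E.reg n x))\<^sup>2 \<le> a (E.reg n x) (E.reg n x) \<bullet> 1"
      using E.reg_mem by blast
  qed

  note \<Lambda>t_bij = H.coercive_imp_bij(1)[OF \<Lambda>t c coercive]
  note \<Lambda>t_below = H.coercive_imp_bij(2)[OF \<Lambda>t c coercive]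
  define I where "I = inv \<Lambda>t"
  have I: "\<Lambda>t (I z) = z" "I (\<Lambda>t x) = x" for x z
    using \<Lambda>t_bij by (simp_all add: I_def bij_is_surj surj_f_inv_f bij_is_inj)
  have I_eq: "I z = x" if "\<Lambda>t x = z" for x z
    using that I by metis
  have I_lin: "bounded_linear I"
  proof (rule bounded_linear_intro)
    show "I (x + y) = I x + I y" for x y
      by (rule I_eq) (simp add: \<Lambda>t.add I)
    show "I (r *\<^sub>R x) = r *\<^sub>R I x" for r x
      by (rule I_eq) (simp add: \<Lambda>t.scaleR I)
    show "norm (I x) \<le> norm x * (1 / c)" for x
      using \<Lambda>t_below[of "I x"] c by (simp add: I field_simps)
  qed
  have \<Lambda>inv_eq: "\<Lambda>inv z = ?R (I z)" for z
    unfolding \<Lambda>inv_def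
  proof (rule inv_into_f_eq)
    show "inj_on \<Lambda> H'"
    proof (rule inj_onI)
      fix f g
      assume "f \<in> H'" "g \<in> H'" "\<Lambda> f = \<Lambda> g"
      then have "\<Lambda>t (H.rep f) = \<Lambda>t (H.rep g)"
        by (simp add: \<Lambda>t_def R_rep)
      then have "H.rep f = H.rep g"
        using I(2) by metis
      then show "f = g"
        using \<open>f \<in> H'\<close> \<open>g \<in> H'\<close> R_rep by metis
    qed
    show "\<Lambda> (?R (I z)) = z"
      using I(1) by (simp add: \<Lambda>t_def)
  qed (rule R_mem)
  have Ugrp_eq: "Ugrp t z = \<Lambda>t (Vt t (I z))" for t z
    by (simp add: Ugrp_def \<Lambda>inv_eq V_R \<Lambda>t_def)

  \<comment> \<open>The form that defines \<open>L\<close>, read through the symmetry of the Gramian.\<close>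
  have gram': "a (K x) y = - integral {0..T\<omega>} (\<lambda>s. w' s *\<^sub>R \<beta> (b (E (- s) x)) (b (E (- s) y)))"
    if "x \<in> D" "y \<in> D" for x y
  proof -
    have "a (K x) y = ipH (L (\<Lambda>t x)) (\<Lambda>t y)"
      using a_sym[of "K x" y] H.ip_conj[of "K x" "\<Lambda>t y"] by (simp add: a_def K_def)
    also have "\<dots> = - integral {0..T\<omega>} (\<lambda>s. w' s *\<^sub>R \<beta> (BS (?R x) s) (BS (?R y) s))"
      unfolding L_eq \<Lambda>inv_eq I
      by (simp add: J_eq ext_mem[OF BS_ext] scaleR_conv_of_real deriv_weight[OF \<omega>_pos] w'_def)
    also have "integral {0..T\<omega>} (\<lambda>s. w' s *\<^sub>R \<beta> (BS (?R x) s) (BS (?R y) s))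
        = integral {0..T\<omega>} (\<lambda>s. w' s *\<^sub>R \<beta> (b (E (- s) x)) (b (E (- s) y)))"
      by (rule obs.obs_ext_gramian[OF \<beta> w'_cont T\<omega>_pos that(1) BS_ext that(2) BS_ext])
    finally show ?thesis .
  qed
  have w_ends: "weight \<omega> T 0 = 1" "weight \<omega> T T\<omega> = 0"
    using T_pos \<omega>_pos by (simp_all add: weight_def T\<omega>_def)
  note riccati = obs.gramian_riccati[OF a \<beta> w_deriv w'_cont T\<omega>_pos w_ends gram gram']

  show ?thesis
  proof (intro conjI allI ballI)
    show "C0_group UNIV sclH Ugrp"
      unfolding C0_group_def
    proof (intro conjI allI ballI)
      fix t
      have lin: "bounded_linear (Ugrp t)"
        unfolding Ugrp_eq[abs_def] by (intro bounded_linear_compose[OF \<Lambda>t] bounded_linear_compose[OF V.lin] I_lin)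
      have I_scl: "I (sclH r x) = sclH r (I x)" for r x
        by (rule I_eq) (simp add: \<Lambda>t_scl I)
      obtain k where k: "\<And>x. norm (Ugrp t x) \<le> norm x * k"
        using bounded_linear.bounded[OF lin] by blast
      have scl: "Ugrp t (sclH r x) = sclH r (Ugrp t x)" for r x
        by (simp add: Ugrp_eq I_scl Vt_scl \<Lambda>t_scl)
      show "bounded_op UNIV sclH UNIV sclH (Ugrp t)"
        unfolding bounded_op_def using k
        by (auto simp: linear_simps(1)[OF lin] scl mult.commute intro!: exI[of _ k])
    next
      show "Ugrp 0 x = x" "Ugrp (s + t) x = Ugrp s (Ugrp t x)" for s t x
        by (simp_all add: Ugrp_eq I V.add)
      show "continuous_on UNIV (\<lambda>t. Ugrp t x)" for x
        unfolding Ugrp_eq by (intro \<Lambda>t.continuous_on V.cont)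
    qed
    show "has_generator UNIV Ugrp (\<Lambda> ` DAs) (\<lambda>x. \<Lambda> (G (\<Lambda>inv x)))"
      unfolding has_generator_def
    proof (intro conjI ballI allI)
      fix z y
      have quot: "(Ugrp h z - z) /\<^sub>R h = \<Lambda>t ((Vt h (I z) - I z) /\<^sub>R h)" for h
        by (simp add: Ugrp_eq \<Lambda>t.diff \<Lambda>t.scaleR I)
      have "((\<lambda>h. (Ugrp h z - z) /\<^sub>R h) \<longlongrightarrow> y) (at 0) \<longleftrightarrow> ((\<lambda>h. (Vt h (I z) - I z) /\<^sub>R h) \<longlongrightarrow> I y) (at 0)"
        unfolding quot
      proof
        assume "((\<lambda>h. \<Lambda>t ((Vt h (I z) - I z) /\<^sub>R h)) \<longlongrightarrow> y) (at 0)"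
        from bounded_linear.tendsto[OF I_lin this]
        show "((\<lambda>h. (Vt h (I z) - I z) /\<^sub>R h) \<longlongrightarrow> I y) (at 0)"
          by (simp add: I)
      next
        assume "((\<lambda>h. (Vt h (I z) - I z) /\<^sub>R h) \<longlongrightarrow> I y) (at 0)"
        from \<Lambda>t.tendsto[OF this]
        show "((\<lambda>h. \<Lambda>t ((Vt h (I z) - I z) /\<^sub>R h)) \<longlongrightarrow> y) (at 0)"
          by (simp add: I)
      qed
      also have "\<dots> \<longleftrightarrow> I z \<in> D \<and> I y = - F (I z) - K (I z)"
        by (rule V.generator_iff)
      also have "\<dots> \<longleftrightarrow> I z \<in> D \<and> y = \<Lambda>t (- F (I z) - K (I z))"
        using I by metis
      also have "\<dots> \<longleftrightarrow> z \<in> \<Lambda> ` DAs \<and> y = \<Lambda> (G (\<Lambda>inv z))"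
      proof (intro conj_cong)
        show "I z \<in> D \<longleftrightarrow> z \<in> \<Lambda> ` DAs"
          using I unfolding DAs_eq image_image \<Lambda>t_def[symmetric] image_iff by metis
        then show "(y = \<Lambda>t (- F (I z) - K (I z))) = (y = \<Lambda> (G (\<Lambda>inv z)))" if "z \<in> \<Lambda> ` DAs"
          using G_R[of "I z"] that by (simp add: \<Lambda>inv_eq \<Lambda>t_def)
      qed
      finally show "((\<lambda>h. (Ugrp h z - z) /\<^sub>R h) \<longlongrightarrow> y) (at 0) \<longleftrightarrow> z \<in> \<Lambda> ` DAs \<and> y = \<Lambda> (G (\<Lambda>inv z))" .
    qed simp
    fix x0 y t
    assume "y \<in> H'"
    then obtain v where y: "y = ?R v"
      by (auto simp: H'_eq)
    define x where "x = I x0"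
    have "pr (Ugrp t x0) y = a (Vt t x) v"
      by (simp add: y H.pr_riesz Ugrp_eq a_def x_def)
    also have "\<dots> = a x (E t v) - oriented_integral 0 t (\<lambda>r. \<beta> (BV (?R x) r) (BS (?R v) (- (t - r))))"
      by (rule obs.variation_of_constants[OF a \<beta> riccati V K_lin BV_ext BS_ext])
    also have "a x (E t v) = pr (S t x0) y"
      by (simp add: a_def x_def I y H.pr_riesz E)
    also have "oriented_integral 0 t (\<lambda>r. \<beta> (BV (?R x) r) (BS (?R v) (- (t - r))))
        = oriented_integral 0 t (\<lambda>r. pr (J (BV (\<Lambda>inv x0) r)) (BS y (- (t - r))))"
      by (intro oriented_integral_cong) (simp only: J_eq ext_mem[OF BV_ext] ext_mem[OF BS_ext] \<Lambda>inv_eq x_def y)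
    finally show "pr (Ugrp t x0) y = pr (S t x0) y
        - oriented_integral 0 t (\<lambda>r. pr (J (BV (\<Lambda>inv x0) r)) (BS y (- (t - r))))" .
  qed
qed

end
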